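(* Let $n\ge 1$ and consider the joint eigenfunction problem $$D^{x}(u)\,f(x;s)=f(x;s)\prod_{i=1}^{n}(1-us_i)$$ for formal series of the form $f(x;s)=x^{\lambda}\varphi(x;s)$, where $s_i=t^{n-i}q^{\lambda_i}$ $(1\le i\le n)$ and $\varphi(x;s)=\sum_{\mu\in Q_+}x^{-\mu}\varphi_\mu(s)\in\mathbb{C}(s^{-Q_+})[[x^{-Q_+}]]$ has initial term $\varphi_0(s)=1$. Then: (1) Such a series $\varphi(x;s)$ exists and is unique. (2) For each $\mu\in Q_+$ the coefficient $\varphi_\mu(s)\in\mathbb{C}(s^{-Q_+})$ is regular at the origin $(s_2/s_1,\ldots,s_n/s_{n-1})=0$. (3) Each $\varphi_\mu(s)$ has at most simple poles, along the divisors $q^{k+1}s_j/s_i=1$ $(1\le i<j\le n;\ k=0,1,2,\ldots)$.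
   Context: Fix $q,t\in\mathbb{C}^*$ with $|q|<1$. $T_{q,x_i}$ is the $q$-shift operator $x_i\mapsto qx_i$. The Ruijsenaars-Macdonald operators in $x=(x_1,\ldots,x_n)$ are $$D_r^{x}=t^{\binom{r}{2}}\sum_{I\subseteq\{1,\ldots,n\},\,|I|=r}\ \prod_{i\in I,\,j\notin I}\frac{tx_i-x_j}{x_i-x_j}\prod_{i\in I}T_{q,x_i}\quad(0\le r\le n),\qquad D^x(u)=\sum_{r=0}^n(-u)^rD^x_r .$$ $Q_+=\bigoplus_{i=1}^{n-1}\mathbb{N}(\epsilon_i-\epsilon_{i+1})\subset\bigoplus_{i=1}^n\mathbb{Z}\epsilon_i$, $\mathbb{N}=\{0,1,2,\ldots\}$, and $x^{-\mu}=\prod_i x_i^{-\mu_i}$ for $\mu=\sum_i\mu_i\epsilon_i\in Q_+$. $\mathbb{C}[[x^{-Q_+}]]=\mathbb{C}[[x_2/x_1,\ldots,x_n/x_{n-1}]]$ (formal power series in $n-1$ independent variables), $\mathbb{C}(s^{-Q_+})=\mathbb{C}(s_2/s_1,\ldots,s_n/s_{n-1})$ (rational functions). For $i<j$, $x_j/x_i$ denotes the monomial $\prod_{a=i}^{j-1}x_{a+1}/x_a$, and similarly for $s$. Formal conventions: $x^\lambda=\prod_i x_i^{\lambda_i}$ is treated as a symbol with $T_{q,x_i}x^\lambda=q^{\lambda_i}x^\lambda=s_it^{i-n}x^\lambda$; the coefficients of $D^x_r$ are expanded as power series in the $x_j/x_i$ $(i<j)$; and $T_{q,x_i}x^{-\mu}=q^{-\mu_i}x^{-\mu}$.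 The variables $s_1,\ldots,s_n$ are indeterminates and the equation is required to hold identically in $u$. "At most simple poles along the divisors" means that the polar divisor of the rational function is contained in the union of the listed divisors and each occurs with multiplicity at most one. *)

theory Defs
  imports
    Complex_Main
    "HOL-Library.Poly_Mapping"
    "HOL-Computational_Algebra.Polynomial"
    "HOL-Computational_Algebra.Fraction_Field"
begin

section \<open>Formal power series in several variables\<close>

text \<open>
  A series in commuting variables \<open>z\<^sub>0, z\<^sub>1, z\<^sub>2, \<dots>\<close> is an arbitrary family of coefficients indexed by
  the finitely supported exponents; series in finitely many of the variables are singled out by
  a condition on the support.
\<close>

typedef 'a mfps = "UNIV :: ((nat \<Rightarrow>\<^sub>0 nat) \<Rightarrow> 'a) set"
  morphisms mfps_nth Abs_mfps ..

lemma mfps_nth_Abs [simp]: "mfps_nth (Abs_mfps f) = f"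
  by (simp add: Abs_mfps_inverse)

lemma mfps_eqI: "(\<And>m. mfps_nth f m = mfps_nth g m) \<Longrightarrow> f = g"
  by (metis ext mfps_nth_inject)

definition splits :: "(nat \<Rightarrow>\<^sub>0 nat) \<Rightarrow> ((nat \<Rightarrow>\<^sub>0 nat) \<times> (nat \<Rightarrow>\<^sub>0 nat)) set"
  where "splits m = {(a, b). a + b = m}"

lemma splits_iff: "(a, b) \<in> splits m \<longleftrightarrow> a + b = m"
  by (simp add: splits_def)

lemma finite_splits [simp]: "finite (splits m)"
proof -
  let ?F = "\<lambda>(a :: nat \<Rightarrow>\<^sub>0 nat, b :: nat \<Rightarrow>\<^sub>0 nat). Poly_Mapping.lookup a"
  let ?S = "{f. \<forall>k. (k \<in> Poly_Mapping.keys m \<longrightarrow> f k \<in> {..(\<Sum>k\<in>Poly_Mapping.keys m. Poly_Mapping.lookup m k)}) \<and> (k \<notin> Poly_Mapping.keys m \<longrightarrow> f k = (0::nat))}"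
  have "finite ?S"
    by (rule finite_set_of_finite_funs) auto
  moreover have "?F ` splits m \<subseteq> ?S"
  proof clarify
    fix a b k
    assume "(a, b) \<in> splits m"
    then have m: "m = a + b" by (simp add: splits_def)
    have "Poly_Mapping.lookup a k \<le> Poly_Mapping.lookup m k" by (simp add: m lookup_add)
    moreover have "Poly_Mapping.lookup m k \<le> (\<Sum>k\<in>Poly_Mapping.keys m. Poly_Mapping.lookup m k)" if "k \<in> Poly_Mapping.keys m"
      using that by (intro member_le_sum) auto
    ultimately show "(k \<in> Poly_Mapping.keys m \<longrightarrow> Poly_Mapping.lookup a k \<in> {..(\<Sum>k\<in>Poly_Mapping.keys m. Poly_Mapping.lookup m k)}) \<and>
        (k \<notin> Poly_Mapping.keys m \<longrightarrow> Poly_Mapping.lookup a k = 0)"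
      by (auto simp: in_keys_iff)
  qed
  moreover have "inj_on ?F (splits m)"
    by (rule inj_onI) (auto simp: splits_def poly_mapping_eq_iff[symmetric])
  ultimately show ?thesis
    by (meson finite_imageD finite_subset)
qed

instantiation mfps :: (comm_ring_1) comm_ring_1
begin

definition zero_mfps :: "'a mfps" where "0 = Abs_mfps (\<lambda>_. 0)"
definition one_mfps :: "'a mfps" where "1 = Abs_mfps (\<lambda>m. if m = 0 then 1 else 0)"
definition plus_mfps :: "'a mfps \<Rightarrow> 'a mfps \<Rightarrow> 'a mfps"
  where "f + g = Abs_mfps (\<lambda>m. mfps_nth f m + mfps_nth g m)"
definition uminus_mfps :: "'a mfps \<Rightarrow> 'a mfps"
  where "- f = Abs_mfps (\<lambda>m. - mfps_nth f m)"
definition minus_mfps :: "'a mfps \<Rightarrow> 'a mfps \<Rightarrow> 'a mfps"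
  where "f - g = Abs_mfps (\<lambda>m. mfps_nth f m - mfps_nth g m)"
definition times_mfps :: "'a mfps \<Rightarrow> 'a mfps \<Rightarrow> 'a mfps"
  where "f * g = Abs_mfps (\<lambda>m. \<Sum>(a, b)\<in>splits m. mfps_nth f a * mfps_nth g b)"

lemma mfps_mult_assoc: "(f * g) * h = f * (g * (h :: 'a mfps))"
proof (rule mfps_eqI)
  fix m
  let ?f = "mfps_nth f" and ?g = "mfps_nth g" and ?h = "mfps_nth h"
  have "mfps_nth ((f * g) * h) m =
      (\<Sum>p\<in>splits m. \<Sum>r\<in>splits (fst p). ?f (fst r) * ?g (snd r) * ?h (snd p))"
    by (simp add: times_mfps_def sum_distrib_right case_prod_beta)
  also have "\<dots> = (\<Sum>(p, r)\<in>Sigma (splits m) (\<lambda>p. splits (fst p)). ?f (fst r) * ?g (snd r) * ?h (snd p))"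
    by (rule sum.Sigma) auto
  also have "\<dots> = (\<Sum>(p, r)\<in>Sigma (splits m) (\<lambda>p. splits (snd p)). ?f (fst p) * (?g (fst r) * ?h (snd r)))"
    by (rule sum.reindex_bij_witness[where
          i = "\<lambda>((a, _), (b, c)). ((a + b, c), (a, b))" and
          j = "\<lambda>((_, c), (a, b)). ((a, b + c), (b, c))"])
       (auto simp: splits_def algebra_simps)
  also have "\<dots> = (\<Sum>p\<in>splits m. \<Sum>r\<in>splits (snd p). ?f (fst p) * (?g (fst r) * ?h (snd r)))"
    by (rule sum.Sigma[symmetric]) auto
  also have "\<dots> = mfps_nth (f * (g * h)) m"
    by (simp add: times_mfps_def sum_distrib_left case_prod_beta)
  finally show "mfps_nth ((f * g) * h) m = mfps_nth (f * (g * h)) m" .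
qed

lemma mfps_mult_commute: "f * g = g * (f :: 'a mfps)"
proof (rule mfps_eqI)
  fix m
  show "mfps_nth (f * g) m = mfps_nth (g * f) m"
    unfolding times_mfps_def mfps_nth_Abs
    by (rule sum.reindex_bij_witness[where i = prod.swap and j = prod.swap])
       (auto simp: splits_def algebra_simps)
qed

lemma mfps_mult_one: "1 * f = (f :: 'a mfps)"
proof (rule mfps_eqI)
  fix m
  have "mfps_nth (1 * f) m = (\<Sum>p\<in>splits m. if p = (0, m) then mfps_nth f m else 0)"
    unfolding times_mfps_def one_mfps_def mfps_nth_Abs
    by (rule sum.cong) (auto simp: splits_def split: if_splits)
  also have "\<dots> = mfps_nth f m" by (simp add: sum.delta splits_iff)
  finally show "mfps_nth (1 * f) m = mfps_nth f m" .
qed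

instance
proof
  fix f g h :: "'a mfps"
  show "f * g * h = f * (g * h)" by (rule mfps_mult_assoc)
  show "f * g = g * f" by (rule mfps_mult_commute)
  show "1 * f = f" by (rule mfps_mult_one)
  show "(f + g) * h = f * h + g * h"
    by (rule mfps_eqI)
       (simp add: plus_mfps_def times_mfps_def case_prod_beta sum.distrib algebra_simps)
  have "mfps_nth (0 :: 'a mfps) 0 \<noteq> mfps_nth 1 0"
    by (simp add: zero_mfps_def one_mfps_def)
  then show "(0 :: 'a mfps) \<noteq> 1" by metis
qed (auto simp: plus_mfps_def minus_mfps_def uminus_mfps_def zero_mfps_def
       intro!: mfps_eqI)

end

definition mfps_monom :: "(nat \<Rightarrow>\<^sub>0 nat) \<Rightarrow> 'a :: comm_ring_1 \<Rightarrow> 'a mfps"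
  where "mfps_monom e c = Abs_mfps (\<lambda>m. if m = e then c else 0)"

abbreviation mfps_const :: "'a :: comm_ring_1 \<Rightarrow> 'a mfps"
  where "mfps_const \<equiv> mfps_monom 0"

section \<open>The root monoid\<close>

text \<open>
  An element \<open>\<mu> = \<Sum>\<^sub>a m\<^sub>a (\<epsilon>\<^sub>a - \<epsilon>\<^sub>a\<^sub>+\<^sub>1)\<close> of \<open>Q\<^sub>+\<close> is represented by its (unique) coordinates \<open>m\<close>. With
  \<open>z\<^sub>a = x\<^sub>a\<^sub>+\<^sub>1 / x\<^sub>a\<close> the monomial \<open>x\<^sup>-\<^sup>\<mu>\<close> is \<open>\<Prod>\<^sub>a z\<^sub>a^m\<^sub>a\<close>, so \<open>\<bbbC>[[x\<^sup>-\<^sup>Q\<^sup>+]]\<close> consists of the series in the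
  \<open>z\<^sub>a\<close> whose exponents lie in \<open>Qplus n\<close>.
\<close>

definition Qplus :: "nat \<Rightarrow> (nat \<Rightarrow>\<^sub>0 nat) set"
  where "Qplus n = {m. Poly_Mapping.keys m \<subseteq> {1..<n}}"

text \<open>The element of \<open>\<Oplus>\<^sub>i \<int>\<epsilon>\<^sub>i\<close> with the given coordinates.\<close>

definition root_weight :: "(nat \<Rightarrow>\<^sub>0 nat) \<Rightarrow> (nat \<Rightarrow>\<^sub>0 int)"
  where "root_weight m =
    (\<Sum>a\<in>Poly_Mapping.keys m. Poly_Mapping.single a (int (Poly_Mapping.lookup m a)) - Poly_Mapping.single (Suc a) (int (Poly_Mapping.lookup m a)))"

text \<open>Coordinates of \<open>k (\<epsilon>\<^sub>i - \<epsilon>\<^sub>j)\<close> for \<open>i < j\<close>, that is, the exponent of \<open>(x\<^sub>j / x\<^sub>i)\<^sup>k\<close>.\<close>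

definition root_multiple :: "nat \<Rightarrow> nat \<Rightarrow> nat \<Rightarrow> (nat \<Rightarrow>\<^sub>0 nat)"
  where "root_multiple i j k = (\<Sum>a = i..<j. Poly_Mapping.single a k)"

text \<open>The monomial \<open>x\<^sub>j / x\<^sub>i\<close> and the expansion of \<open>1 / (1 - x\<^sub>j / x\<^sub>i)\<close>, for \<open>i < j\<close>.\<close>

definition xratio :: "nat \<Rightarrow> nat \<Rightarrow> 'a :: comm_ring_1 mfps"
  where "xratio i j = mfps_monom (root_multiple i j 1) 1"

definition xgeom :: "nat \<Rightarrow> nat \<Rightarrow> 'a :: comm_ring_1 mfps"
  where "xgeom i j = Abs_mfps (\<lambda>m. if \<exists>k. m = root_multiple i j k then 1 else 0)"

lemma lookup_root_multiple: "Poly_Mapping.lookup (root_multiple i j k) a = (if a \<in> {i..<j} then k else 0)"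
  by (auto simp: root_multiple_def lookup_sum lookup_single when_def)

lemma xgeom_inverse:
  assumes "i < j"
  shows "(1 - xratio i j) * xgeom i j = (1 :: 'a :: comm_ring_1 mfps)"
proof (rule mfps_eqI)
  fix m
  let ?e = "root_multiple i j 1"
  have add: "?e + root_multiple i j k = root_multiple i j (Suc k)" for k
    by (rule poly_mapping_eqI) (simp add: lookup_add lookup_root_multiple)
  have zero: "root_multiple i j 0 = 0"
    by (rule poly_mapping_eqI) (simp add: lookup_root_multiple)
  have pos: "root_multiple i j (Suc k) \<noteq> 0" for k
  proof
    assume "root_multiple i j (Suc k) = 0"
    then have "Poly_Mapping.lookup (root_multiple i j (Suc k)) i = 0" by simp
    with assms show False by (simp add: lookup_root_multiple)
  qed
  have prod: "mfps_nth (xratio i j * xgeom i j :: 'a mfps) m =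
      (if \<exists>k. m = root_multiple i j (Suc k) then 1 else 0)"
  proof -
    let ?t = "\<lambda>(a, b). if a = ?e \<and> (\<exists>k. b = root_multiple i j k) then 1 else (0 :: 'a)"
    have "mfps_nth (xratio i j * xgeom i j :: 'a mfps) m = (\<Sum>p\<in>splits m. ?t p)"
      unfolding times_mfps_def xratio_def mfps_monom_def xgeom_def mfps_nth_Abs
      by (rule sum.cong) auto
    also have "\<dots> = (if \<exists>k. m = root_multiple i j (Suc k) then 1 else 0)"
    proof (cases "\<exists>k. m = root_multiple i j (Suc k)")
      case True
      then obtain k where k: "m = root_multiple i j (Suc k)" by blast
      have "(\<Sum>p\<in>splits m. ?t p) = (\<Sum>p\<in>splits m. if p = (?e, root_multiple i j k) then 1 else 0)"
      proof (rule sum.cong)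
        fix p assume "p \<in> splits m"
        then obtain a b where p: "p = (a, b)" "a + b = m" by (auto simp: splits_def)
        have "b = root_multiple i j k" if "a = ?e"
          using p(2) that k add[of k] by (metis add_left_cancel)
        with p show "?t p = (if p = (?e, root_multiple i j k) then 1 else 0)"
          by auto
      qed simp
      also have "\<dots> = 1" using k add[of k] by (simp add: sum.delta splits_iff)
      finally show ?thesis using True by simp
    next
      case False
      then have "(\<Sum>p\<in>splits m. ?t p) = 0"
        by (intro sum.neutral) (auto simp: splits_def add[simplified])
      with False show ?thesis by simp
    qed
    finally show ?thesis .
  qed
  have "(\<exists>k. m = root_multiple i j k) \<longleftrightarrow> m = 0 \<or> (\<exists>k. m = root_multiple i j (Suc k))"
    by (metis zero not0_implies_Suc)
  moreover have "\<not> (m = 0 \<and> (\<exists>k. m = root_multiple i j (Suc k)))"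
    using pos by auto
  moreover have "mfps_nth ((1 - xratio i j) * xgeom i j :: 'a mfps) m =
      mfps_nth (xgeom i j) m - mfps_nth (xratio i j * xgeom i j) m"
    unfolding left_diff_distrib mult_1_left by (simp add: minus_mfps_def)
  moreover have "mfps_nth (xgeom i j :: 'a mfps) m = (if \<exists>k. m = root_multiple i j k then 1 else 0)"
    by (simp add: xgeom_def)
  moreover have "mfps_nth (1 :: 'a mfps) m = (if m = 0 then 1 else 0)"
    by (simp add: one_mfps_def)
  ultimately show "mfps_nth ((1 - xratio i j) * xgeom i j) m = mfps_nth (1 :: 'a mfps) m"
    unfolding prod by (auto split: if_splits)
qed

section \<open>Rational functions of the spectral variables\<close>

type_synonym mpolynomial = "(nat \<Rightarrow>\<^sub>0 nat) \<Rightarrow>\<^sub>0 complex"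

type_synonym ratfun = "mpolynomial fract"

definition ratconst :: "complex \<Rightarrow> ratfun"
  where "ratconst c = Fract (Poly_Mapping.single 0 c) 1"

definition svar :: "nat \<Rightarrow> ratfun"
  where "svar i = Fract (Poly_Mapping.single (Poly_Mapping.single i 1) 1) 1"

text \<open>
  Next to the functions of \<open>s\<close> itself we use polynomials in independent coordinates
  \<open>w\<^sub>1, \<dots>, w\<^sub>n\<^sub>-\<^sub>1\<close>, which are specialised to \<open>w\<^sub>a = s\<^sub>a\<^sub>+\<^sub>1 / s\<^sub>a\<close> by \<open>at_ratios\<close>. This
  substitution is injective, so the denominators below do not vanish.
\<close>

definition wpolys :: "nat \<Rightarrow> mpolynomial set"
  where "wpolys n = {P. Poly_Mapping.keys P \<subseteq> Qplus n}"

definition at_ratios :: "mpolynomial \<Rightarrow> ratfun"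
  where "at_ratios P =
    (\<Sum>m\<in>Poly_Mapping.keys P. ratconst (Poly_Mapping.lookup P m) * (\<Prod>a\<in>Poly_Mapping.keys m. (svar (Suc a) / svar a) ^ Poly_Mapping.lookup m a))"

definition sratio_field :: "nat \<Rightarrow> ratfun set"  \<comment> \<open>\<open>\<bbbC>(s\<^sub>2 / s\<^sub>1, \<dots>, s\<^sub>n / s\<^sub>n\<^sub>-\<^sub>1)\<close>\<close>
  where "sratio_field n =
    {at_ratios P / at_ratios Q | P Q. P \<in> wpolys n \<and> Q \<in> wpolys n \<and> Q \<noteq> 0}"

definition regular_at_origin :: "nat \<Rightarrow> ratfun \<Rightarrow> bool"
  where "regular_at_origin n F \<longleftrightarrow>
    (\<exists>P\<in>wpolys n. \<exists>Q\<in>wpolys n. Poly_Mapping.lookup Q 0 \<noteq> 0 \<and> F = at_ratios P / at_ratios Q)"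

text \<open>The equation \<open>1 - q\<^sup>k\<^sup>+\<^sup>1 s\<^sub>j / s\<^sub>i\<close> of a divisor, as a polynomial in \<open>w\<close>.\<close>

definition pole_equation :: "complex \<Rightarrow> nat \<Rightarrow> nat \<Rightarrow> nat \<Rightarrow> mpolynomial"
  where "pole_equation q i j k = 1 - Poly_Mapping.single (root_multiple i j 1) (q ^ (k + 1))"

definition lowest_terms :: "nat \<Rightarrow> ratfun \<Rightarrow> mpolynomial \<Rightarrow> mpolynomial \<Rightarrow> bool"
  where "lowest_terms n F P Q \<longleftrightarrow> P \<in> wpolys n \<and> Q \<in> wpolys n \<and> Q \<noteq> 0 \<and>
    (\<forall>d. d dvd P \<longrightarrow> d dvd Q \<longrightarrow> d dvd 1) \<and> F = at_ratios P / at_ratios Q"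

text \<open>
  The polar divisor is taken on the affine space with coordinates \<open>w\<close>: its components are the
  irreducible factors \<open>p\<close> of the reduced denominator, counted with their exponents. A
  component is identified with its equation up to associates.
\<close>

definition simple_poles :: "nat \<Rightarrow> complex \<Rightarrow> ratfun \<Rightarrow> bool"
  where "simple_poles n q F \<longleftrightarrow>
    (\<exists>P Q. lowest_terms n F P Q \<and>
      (\<forall>p. irreducible p \<and> p dvd Q \<longrightarrow>
        \<not> p ^ 2 dvd Q \<and>
        (\<exists>i j k. 1 \<le> i \<and> i < j \<and> j \<le> n \<and>
          p dvd pole_equation q i j k \<and> pole_equation q i j k dvd p)))"

section \<open>Ruijsenaars--Macdonald operators\<close>

text \<open>
  The expansion in powers of \<open>x\<^sub>j / x\<^sub>i\<close> (\<open>i < j\<close>), resp. \<open>x\<^sub>i / x\<^sub>j\<close> (\<open>j < i\<close>), of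
  \<open>(t x\<^sub>i - x\<^sub>j) / (x\<^sub>i - x\<^sub>j)\<close>, which equals \<open>(t - x\<^sub>j / x\<^sub>i) / (1 - x\<^sub>j / x\<^sub>i)\<close>, resp.
  \<open>(1 - t x\<^sub>i / x\<^sub>j) / (1 - x\<^sub>i / x\<^sub>j)\<close>.
\<close>

definition D_factor :: "complex \<Rightarrow> nat \<Rightarrow> nat \<Rightarrow> ratfun mfps"
  where "D_factor t i j =
    (if i < j then (mfps_const (ratconst t) - xratio i j) * xgeom i j
     else (1 - mfps_const (ratconst t) * xratio j i) * xgeom j i)"

text \<open>
  A formal series \<open>x\<^sup>\<lambda> \<phi>\<close> is represented by \<open>\<phi>\<close>. Since \<open>T\<^sub>q\<^sub>,\<^sub>x\<^sub>i x\<^sup>\<lambda> = s\<^sub>i t\<^sup>i\<^sup>-\<^sup>n x\<^sup>\<lambda>\<close> and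
  \<open>T\<^sub>q\<^sub>,\<^sub>x\<^sub>i x\<^sup>-\<^sup>\<mu> = q^(-\<mu>\<^sub>i) x\<^sup>-\<^sup>\<mu>\<close>, the operator \<open>\<Prod>\<^sub>i\<^sub>\<in>\<^sub>I T\<^sub>q\<^sub>,\<^sub>x\<^sub>i\<close> multiplies the coefficient at \<open>\<mu>\<close> by the
  product over \<open>I\<close> of these scalars.
\<close>

definition qshift :: "nat \<Rightarrow> complex \<Rightarrow> complex \<Rightarrow> nat set \<Rightarrow> ratfun mfps \<Rightarrow> ratfun mfps"
  where "qshift n q t I \<phi> = Abs_mfps (\<lambda>m.
    (\<Prod>i\<in>I. svar i * ratconst (t powi (int i - int n)) *
             ratconst (q powi (- Poly_Mapping.lookup (root_weight m) i))) * mfps_nth \<phi> m)"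

definition macdonald_D :: "nat \<Rightarrow> complex \<Rightarrow> complex \<Rightarrow> nat \<Rightarrow> ratfun mfps \<Rightarrow> ratfun mfps"
  where "macdonald_D n q t r \<phi> = mfps_const (ratconst (t ^ (r choose 2))) *
    (\<Sum>I | I \<subseteq> {1..n} \<and> card I = r.
      (\<Prod>i\<in>I. \<Prod>j\<in>{1..n} - I. D_factor t i j) * qshift n q t I \<phi>)"

text \<open>The parameter \<open>u\<close> is the indeterminate of a polynomial ring over the series.\<close>

definition upar :: "ratfun mfps poly"
  where "upar = [:0, 1:]"

definition macdonald_Du :: "nat \<Rightarrow> complex \<Rightarrow> complex \<Rightarrow> ratfun mfps \<Rightarrow> ratfun mfps poly"
  where "macdonald_Du n q t \<phi> = (\<Sum>r\<le>n. (- upar) ^ r * [:macdonald_D n q t r \<phi>:])"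

definition joint_eigenfunction :: "nat \<Rightarrow> complex \<Rightarrow> complex \<Rightarrow> ratfun mfps \<Rightarrow> bool"
  where "joint_eigenfunction n q t \<phi> \<longleftrightarrow>
    macdonald_Du n q t \<phi> = [:\<phi>:] * (\<Prod>i = 1..n. 1 - upar * [:mfps_const (svar i):])"

definition sratio_series :: "nat \<Rightarrow> ratfun mfps set"  \<comment> \<open>\<open>\<bbbC>(s\<^sup>-\<^sup>Q\<^sup>+)[[x\<^sup>-\<^sup>Q\<^sup>+]]\<close>\<close>
  where "sratio_series n = {\<phi>. (\<forall>m\<in>Qplus n. mfps_nth \<phi> m \<in> sratio_field n) \<and>
    (\<forall>m. m \<notin> Qplus n \<longrightarrow> mfps_nth \<phi> m = 0)}"

definition is_solution :: "nat \<Rightarrow> complex \<Rightarrow> complex \<Rightarrow> ratfun mfps \<Rightarrow> bool"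
  where "is_solution n q t \<phi> \<longleftrightarrow>
    \<phi> \<in> sratio_series n \<and> mfps_nth \<phi> 0 = 1 \<and> joint_eigenfunction n q t \<phi>"

end

(*
  D_r acts on a series in a triangular way: the coefficient of D_r \<phi> at \<mu> is e_r(q^(-\<mu>) s) \<phi>_\<mu>
  plus a combination of the \<phi>_\<nu> with \<nu> < \<mu>. The eigenvalue e_1(q^(-\<mu>) s) of D_1 differs from e_1(s)
  for \<mu> \<noteq> 0, so D_1 alone has a unique normalised eigenfunction \<phi>; since D_r commutes with D_1,
  D_r \<phi> is again an eigenfunction of D_1, hence equal to e_r(s) \<phi>. The commutation reduces to an
  identity of rational functions, an instance of the Lagrange interpolation formula.

  For the poles, all n equations are used at once. Each e_r(q^(-\<mu>) s) - e_r(s), divided by s_1 ... s_r,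
  is a polynomial in the w_a = s_(a+1) / s_a with constant term q^(-m_r) - 1, where \<mu> = \<Sum> m_a (\<epsilon>_a - \<epsilon>_(a+1)),
  and the equations combine at u = 1 / s_j to the factor \<Prod>_i (s_j - q^(-\<mu>_i) s_i). So the only possible new
  denominators of \<phi>_\<mu> are the w_a and linear forms s_a - c s_b; such a prime divides all these elements
  only if \<mu> = k (\<epsilon>_a - \<epsilon>_b) and c = q^k. Thus 1 - q^k s_b / s_a enters as a new denominator at
  exactly one \<mu>, with multiplicity one.
*)
theory Submission
  imports Defs
begin

text \<open>The recursion of D_1 alone has the denominators e_1(s) - e_1(q^(-\<mu>) s), linear forms
  in up to n variables that are in general not among the listed divisors. So D_1 serves only to
  construct the series; its denominators are then read off from the whole system, as a property of a
  series already known. For a fixed \<mu> the polynomials that clear the new denominator of the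
  coefficient form an ideal, and a prime p can be cancelled from an element p z of this ideal as
  soon as some element of the ideal is not divisible by p. Hence no general factorisation of
  polynomials enters, only the primality of the w_a and of the binomials; each of them is shown to
  generate the kernel of a homomorphism to a domain.

  The commutation is proved in a field of fractions, whereas the operators act on a ring of series.
  The two are linked by a relation between a fraction and its expansion, which respects sums,
  products and quotients and is single-valued.\<close>

abbreviation lookup :: "('a \<Rightarrow>\<^sub>0 'b::zero) \<Rightarrow> 'a \<Rightarrow> 'b" where "lookup \<equiv> Poly_Mapping.lookup"
abbreviation keys :: "('a \<Rightarrow>\<^sub>0 'b::zero) \<Rightarrow> 'a set" where "keys \<equiv> Poly_Mapping.keys"
abbreviation single :: "'a \<Rightarrow> 'b \<Rightarrow> 'a \<Rightarrow>\<^sub>0 'b::zero" where "single \<equiv> Poly_Mapping.single"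

section \<open>Substitution homomorphisms on polynomials and their extension to fractions\<close>

section \<open>Evaluation homomorphisms\<close>

locale comm_ring_hom =
  fixes h :: "'a::comm_ring_1 \<Rightarrow> 'b::comm_ring_1"
  assumes hom_add: "h (x + y) = h x + h y"
    and hom_mult: "h (x * y) = h x * h y"
    and hom_one: "h 1 = 1"
begin

lemma hom_zero: "h 0 = 0"
  using hom_add[of 0 0] by simp

lemma hom_uminus: "h (- x) = - h x"
  using hom_add[of x "- x"] hom_zero by (simp add: eq_neg_iff_add_eq_0 add.commute)

lemma hom_diff: "h (x - y) = h x - h y"
  using hom_add[of x "- y"] hom_uminus[of y] by simp

lemma hom_sum: "h (\<Sum>i\<in>A. f i) = (\<Sum>i\<in>A. h (f i))"
  by (induction A rule: infinite_finite_induct) (simp_all add: hom_zero hom_add)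

lemma hom_prod: "h (\<Prod>i\<in>A. f i) = (\<Prod>i\<in>A. h (f i))"
  by (induction A rule: infinite_finite_induct) (simp_all add: hom_one hom_mult)

lemma hom_power: "h (x ^ k) = h x ^ k"
  by (induction k) (simp_all add: hom_one hom_mult)

lemmas hom_simps = hom_zero hom_one hom_add hom_mult hom_uminus hom_diff hom_sum hom_prod hom_power

end

definition monom_eval :: "(nat \<Rightarrow> 'b::comm_ring_1) \<Rightarrow> (nat \<Rightarrow>\<^sub>0 nat) \<Rightarrow> 'b"
  where "monom_eval v m = (\<Prod>a\<in>keys m. v a ^ lookup m a)"

text \<open>The coefficient map \<open>c\<close> is a parameter because the targets differ: rational
  functions, series, polynomials and complex numbers.\<close>

definition poly_eval :: "(complex \<Rightarrow> 'b::comm_ring_1) \<Rightarrow> (nat \<Rightarrow> 'b) \<Rightarrow> mpolynomial \<Rightarrow> 'b"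
  where "poly_eval c v P = (\<Sum>m\<in>keys P. c (lookup P m) * monom_eval v m)"

lemma monom_eval_superset:
  assumes "finite A" "keys m \<subseteq> A"
  shows "monom_eval v m = (\<Prod>a\<in>A. v a ^ lookup m a)"
  unfolding monom_eval_def using assms
  by (intro prod.mono_neutral_left) (auto simp: in_keys_iff)

lemma monom_eval_0 [simp]: "monom_eval v 0 = 1"
  by (simp add: monom_eval_def)

lemma monom_eval_add: "monom_eval v (m + m') = monom_eval v m * monom_eval v m'"
proof -
  let ?A = "keys m \<union> keys m'"
  have "monom_eval v (m + m') = (\<Prod>a\<in>?A. v a ^ lookup (m + m') a)"
    by (rule monom_eval_superset) (use Poly_Mapping.keys_add[of m m'] in auto)
  also have "\<dots> = (\<Prod>a\<in>?A. v a ^ lookup m a) * (\<Prod>a\<in>?A. v a ^ lookup m' a)"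
    by (simp add: lookup_add power_add prod.distrib)
  finally show ?thesis
    using monom_eval_superset[of ?A m v] monom_eval_superset[of ?A m' v] by simp
qed

lemma monom_eval_single [simp]: "monom_eval v (single a k) = v a ^ k"
  by (simp add: monom_eval_def)

lemma monom_eval_sum: "monom_eval v (\<Sum>i\<in>A. f i) = (\<Prod>i\<in>A. monom_eval v (f i))"
  by (induction A rule: infinite_finite_induct) (simp_all add: monom_eval_add)

lemma poly_mapping_eq_sum_single: "(\<Sum>m\<in>keys P. single m (lookup P m)) = P"
proof (rule poly_mapping_eqI)
  fix k
  show "lookup (\<Sum>m\<in>keys P. single m (lookup P m)) k = lookup P k"
    by (simp add: lookup_sum lookup_single when_def in_keys_iff)
qed

locale const_hom = comm_ring_hom c for c :: "complex \<Rightarrow> 'b::comm_ring_1"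
begin

lemma poly_eval_superset:
  assumes "finite A" "keys P \<subseteq> A"
  shows "poly_eval c v P = (\<Sum>m\<in>A. c (lookup P m) * monom_eval v m)"
  unfolding poly_eval_def using assms
  by (intro sum.mono_neutral_left) (auto simp: in_keys_iff hom_zero)

lemma poly_eval_single: "poly_eval c v (single m x) = c x * monom_eval v m"
  by (simp add: poly_eval_def hom_zero)

lemma poly_eval_add: "poly_eval c v (P + Q) = poly_eval c v P + poly_eval c v Q"
proof -
  let ?A = "keys P \<union> keys Q"
  have "poly_eval c v (P + Q) = (\<Sum>m\<in>?A. c (lookup (P + Q) m) * monom_eval v m)"
    by (rule poly_eval_superset) (use Poly_Mapping.keys_add[of P Q] in auto)
  also have "\<dots> = (\<Sum>m\<in>?A. c (lookup P m) * monom_eval v m) + (\<Sum>m\<in>?A. c (lookup Q m) * monom_eval v m)"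
    by (simp add: lookup_add hom_add distrib_right sum.distrib)
  finally show ?thesis
    using poly_eval_superset[of ?A P v] poly_eval_superset[of ?A Q v] by simp
qed

lemma poly_eval_sum: "poly_eval c v (\<Sum>i\<in>A. f i) = (\<Sum>i\<in>A. poly_eval c v (f i))"
  by (induction A rule: infinite_finite_induct) (simp_all add: poly_eval_add, simp_all add: poly_eval_def)

lemma poly_eval_hom: "comm_ring_hom (poly_eval c v)"
proof
  fix P Q :: mpolynomial
  show "poly_eval c v (P + Q) = poly_eval c v P + poly_eval c v Q"
    by (rule poly_eval_add)
  show "poly_eval c v 1 = 1"
    using poly_eval_single[of v 0 1] hom_one by simp
  have "poly_eval c v (P * Q) =
      poly_eval c v ((\<Sum>m\<in>keys P. single m (lookup P m)) * (\<Sum>m\<in>keys Q. single m (lookup Q m)))"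
    by (simp add: poly_mapping_eq_sum_single)
  also have "\<dots> = (\<Sum>m\<in>keys P. \<Sum>m'\<in>keys Q. poly_eval c v (single m (lookup P m) * single m' (lookup Q m')))"
    by (simp add: sum_product poly_eval_sum)
  also have "\<dots> = (\<Sum>m\<in>keys P. \<Sum>m'\<in>keys Q. (c (lookup P m) * monom_eval v m) * (c (lookup Q m') * monom_eval v m'))"
    by (simp add: mult_single poly_eval_single hom_mult monom_eval_add mult_ac)
  also have "\<dots> = poly_eval c v P * poly_eval c v Q"
    by (simp add: poly_eval_def sum_product)
  finally show "poly_eval c v (P * Q) = poly_eval c v P * poly_eval c v Q" .
qed

end

lemma fract_hom: "comm_ring_hom (\<lambda>x :: 'a::idom. Fract x 1)"
  by unfold_locales (simp_all add: One_fract_def)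

lemma ratconst_hom: "comm_ring_hom ratconst"
  by unfold_locales (simp_all add: ratconst_def single_add mult_single One_fract_def)

lemma const_hom_ratconst: "const_hom ratconst"
  using ratconst_hom by (simp add: const_hom_def)

lemma const_hom_single: "const_hom (single 0 :: complex \<Rightarrow> mpolynomial)"
  by unfold_locales (simp_all add: single_add mult_single)

lemma const_hom_id: "const_hom (\<lambda>x. x)"
  by unfold_locales simp_all

lemma Fract_1_eq_iff [simp]: "Fract x 1 = Fract y 1 \<longleftrightarrow> x = (y :: 'a::idom)"
  by (simp add: eq_fract)

lemma Fract_1_eq_0_iff [simp]: "Fract x 1 = 0 \<longleftrightarrow> x = (0 :: 'a::idom)"
  by (simp add: Zero_fract_def eq_fract)

lemma ratconst_eq_iff [simp]: "ratconst x = ratconst y \<longleftrightarrow> x = y"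
  by (metis Fract_1_eq_iff lookup_single_eq ratconst_def)

lemma ratconst_0 [simp]: "ratconst 0 = 0" and ratconst_1 [simp]: "ratconst 1 = 1"
  using comm_ring_hom.hom_zero[OF ratconst_hom] comm_ring_hom.hom_one[OF ratconst_hom] by auto

lemma ratconst_eq_0_iff [simp]: "ratconst x = 0 \<longleftrightarrow> x = 0"
  using ratconst_eq_iff[of x 0] by simp

lemmas ratconst_simps = comm_ring_hom.hom_simps[OF ratconst_hom]

lemma single_eq_iff: "single m x = single m' y \<longleftrightarrow> x = y \<and> (x = 0 \<or> m = m')"
  by (metis lookup_single_eq lookup_single_not_eq single_zero)

lemma svar_neq_0 [simp]: "svar i \<noteq> 0"
  by (simp add: svar_def) (metis lookup_single_eq lookup_zero one_neq_zero)

lemma monom_eval_vars: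
  "monom_eval (\<lambda>a. single (single a 1) 1 :: mpolynomial) m = single m 1"
proof -
  have pow: "(single (single a 1) 1 :: mpolynomial) ^ k = single (single a k) 1" for a k
    by (induction k) (simp_all add: mult_single flip: single_add)
  have pr: "(\<Prod>a\<in>A. single (f a) 1 :: mpolynomial) = single (\<Sum>a\<in>A. f a) 1"
    for A and f :: "nat \<Rightarrow> nat \<Rightarrow>\<^sub>0 nat"
    by (induction A rule: infinite_finite_induct) (simp_all add: mult_single)
  show ?thesis
    by (simp add: monom_eval_def pow[unfolded One_nat_def] pr poly_mapping_eq_sum_single)
qed

lemma monom_eval_svar: "monom_eval svar m = Fract (single m 1) 1"
proof -
  have "monom_eval svar m = Fract (monom_eval (\<lambda>a. single (single a 1) 1) m) 1"
    by (simp add: monom_eval_def svar_def comm_ring_hom.hom_simps[OF fract_hom])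
  then show ?thesis by (simp add: monom_eval_vars[unfolded One_nat_def])
qed

lemma poly_eval_svar: "poly_eval ratconst svar P = Fract P 1"
proof -
  have "poly_eval ratconst svar P = (\<Sum>m\<in>keys P. Fract (single m (lookup P m)) 1)"
    by (simp add: poly_eval_def monom_eval_svar ratconst_def mult_single)
  also have "\<dots> = Fract P 1"
    by (simp only: comm_ring_hom.hom_sum[OF fract_hom, symmetric] poly_mapping_eq_sum_single)
  finally show ?thesis .
qed

section \<open>Transfer of rational identities\<close>

text \<open>
  \<open>frac_rel h f g\<close> says that \<open>g\<close> is the image of the fraction \<open>f\<close> under the extension of \<open>h\<close> to the
  fractions whose denominator becomes invertible.
\<close>

definition frac_rel :: "('a::idom \<Rightarrow> 'b::comm_ring_1) \<Rightarrow> 'a fract \<Rightarrow> 'b \<Rightarrow> bool"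
  where "frac_rel h f g \<longleftrightarrow> (\<exists>a b u. b \<noteq> 0 \<and> f = Fract a b \<and> h b * u = 1 \<and> g = h a * u)"

locale frac_transfer = comm_ring_hom h for h :: "'a::idom \<Rightarrow> 'b::comm_ring_1"
begin

text \<open>Independence of the chosen numerator and denominator. This is the transfer principle:
  two expressions related to the same fraction coincide, even in a target with zero
  divisors.\<close>

lemma rel_unique:
  assumes "frac_rel h f g" "frac_rel h f g'"
  shows "g = g'"
proof -
  obtain a b u where 1: "b \<noteq> 0" "f = Fract a b" "h b * u = 1" "g = h a * u"
    using assms(1) by (auto simp: frac_rel_def)
  obtain a' b' u' where 2: "b' \<noteq> 0" "f = Fract a' b'" "h b' * u' = 1" "g' = h a' * u'"
    using assms(2) by (auto simp: frac_rel_def)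
  have "a * b' = a' * b" using 1 2 by (simp add: eq_fract)
  then have e: "h a * h b' = h a' * h b" by (metis hom_mult)
  have "g = h a * u * (h b' * u')" using 1 2 by simp
  also have "\<dots> = (h a * h b') * u * u'" by (simp add: mult_ac)
  also have "\<dots> = h a' * u' * (h b * u)" unfolding e by (simp add: mult_ac)
  finally show ?thesis using 1 2 by simp
qed

lemma rel_base: "frac_rel h (Fract a 1) (h a)"
  unfolding frac_rel_def by (intro exI[of _ a] exI[of _ 1] exI[of _ 1]) (simp add: hom_one)

lemma rel_add:
  assumes "frac_rel h f g" "frac_rel h f' g'"
  shows "frac_rel h (f + f') (g + g')"
proof -
  obtain a b u where 1: "b \<noteq> 0" "f = Fract a b" "h b * u = 1" "g = h a * u"
    using assms(1) by (auto simp: frac_rel_def)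
  obtain a' b' u' where 2: "b' \<noteq> 0" "f' = Fract a' b'" "h b' * u' = 1" "g' = h a' * u'"
    using assms(2) by (auto simp: frac_rel_def)
  have "g + g' = h a * u * (h b' * u') + h a' * u' * (h b * u)" using 1 2 by simp
  also have "\<dots> = h (a * b' + a' * b) * (u * u')" by (simp add: hom_simps algebra_simps)
  finally have g: "g + g' = h (a * b' + a' * b) * (u * u')" .
  have "h (b * b') * (u * u') = (h b * u) * (h b' * u')" by (simp only: hom_mult mult_ac)
  then have "h (b * b') * (u * u') = 1" using 1 2 by simp
  moreover have "f + f' = Fract (a * b' + a' * b) (b * b')" using 1 2 by simp
  moreover have "b * b' \<noteq> 0" using 1 2 by simp
  ultimately show ?thesis unfolding frac_rel_def using g by blast
qed

lemma rel_mult: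
  assumes "frac_rel h f g" "frac_rel h f' g'"
  shows "frac_rel h (f * f') (g * g')"
proof -
  obtain a b u where 1: "b \<noteq> 0" "f = Fract a b" "h b * u = 1" "g = h a * u"
    using assms(1) by (auto simp: frac_rel_def)
  obtain a' b' u' where 2: "b' \<noteq> 0" "f' = Fract a' b'" "h b' * u' = 1" "g' = h a' * u'"
    using assms(2) by (auto simp: frac_rel_def)
  have g: "g * g' = h (a * a') * (u * u')" using 1 2 by (simp add: hom_simps mult_ac)
  have "h (b * b') * (u * u') = (h b * u) * (h b' * u')" by (simp only: hom_mult mult_ac)
  then have "h (b * b') * (u * u') = 1" using 1 2 by simp
  moreover have "f * f' = Fract (a * a') (b * b')" using 1 2 by simp
  moreover have "b * b' \<noteq> 0" using 1 2 by simp
  ultimately show ?thesis unfolding frac_rel_def using g by blast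
qed

text \<open>With \<open>f'\<close> = a / b, the given inverse \<open>i\<close> of \<open>g'\<close>
  makes h a invertible, so b / a is again an admissible fraction.\<close>

lemma rel_divide:
  assumes "frac_rel h f g" "frac_rel h f' g'" "f' \<noteq> 0" "g' * i = 1"
  shows "frac_rel h (f / f') (g * i)"
proof -
  obtain a b u where 1: "b \<noteq> 0" "f' = Fract a b" "h b * u = 1" "g' = h a * u"
    using assms(2) by (auto simp: frac_rel_def)
  have "a \<noteq> 0" using 1 assms(3) by (auto simp: Zero_fract_def eq_fract)
  moreover have "h a * (u * i) = 1" using 1(4) assms(4) by (simp add: mult_ac)
  moreover have "i = h b * (u * i)" using 1(3) by (simp add: mult.assoc[symmetric])
  moreover have "inverse f' = Fract b a" using 1 by simp
  ultimately have "frac_rel h (inverse f') i" unfolding frac_rel_def by blast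
  then show ?thesis using rel_mult[OF assms(1)] by (simp add: divide_inverse)
qed

lemma rel_1: "frac_rel h 1 1"
  using rel_base[of 1] by (simp add: hom_one One_fract_def)

lemma rel_0: "frac_rel h 0 0"
  using rel_base[of 0] by (simp add: hom_zero Zero_fract_def)

lemma rel_diff:
  assumes "frac_rel h f g" "frac_rel h f' g'"
  shows "frac_rel h (f - f') (g - g')"
  using rel_add[OF assms(1) rel_mult[OF rel_base[of "- 1"] assms(2)]]
  by (simp add: hom_simps) (metis One_fract_def minus_fract mult_minus1 uminus_add_conv_diff add.commute)

lemma rel_sum: "(\<And>i. i \<in> A \<Longrightarrow> frac_rel h (f i) (g i)) \<Longrightarrow> frac_rel h (\<Sum>i\<in>A. f i) (\<Sum>i\<in>A. g i)"
  by (induction A rule: infinite_finite_induct) (auto intro: rel_0 rel_add)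

lemma rel_prod: "(\<And>i. i \<in> A \<Longrightarrow> frac_rel h (f i) (g i)) \<Longrightarrow> frac_rel h (\<Prod>i\<in>A. f i) (\<Prod>i\<in>A. g i)"
  by (induction A rule: infinite_finite_induct) (auto intro: rel_1 rel_mult)

lemma rel_power: "frac_rel h f g \<Longrightarrow> frac_rel h (f ^ k) (g ^ k)"
  by (induction k) (auto intro: rel_1 rel_mult)

end

section \<open>Substitution of the ratios\<close>

lemma at_ratios_eval: "at_ratios P = poly_eval ratconst (\<lambda>a. svar (Suc a) / svar a) P"
  by (simp add: at_ratios_def poly_eval_def monom_eval_def)

lemma at_ratios_hom: "comm_ring_hom at_ratios"
  unfolding at_ratios_eval[abs_def] by (rule const_hom.poly_eval_hom[OF const_hom_ratconst])

lemmas at_ratios_simps = comm_ring_hom.hom_simps[OF at_ratios_hom]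

lemma at_ratios_single: "at_ratios (single m x) = ratconst x * monom_eval (\<lambda>a. svar (Suc a) / svar a) m"
  by (simp add: at_ratios_eval const_hom.poly_eval_single[OF const_hom_ratconst])

text \<open>The substitution \<open>s\<^sub>i \<mapsto> w\<^sub>0 \<cdots> w\<^sub>i\<^sub>-\<^sub>1\<close> is a left inverse.\<close>

lemma at_ratios_inj: "inj at_ratios"
proof -
  define X where "X i = (\<Prod>a<i. svar a)" for i
  define h where "h = poly_eval ratconst X"
  have X0: "X i \<noteq> 0" for i by (simp add: X_def)
  have XS: "X (Suc a) / X a = svar a" for a using X0[of a] by (simp add: X_def)
  interpret frac_transfer h
    unfolding frac_transfer_def h_def by (rule const_hom.poly_eval_hom[OF const_hom_ratconst])
  have rc: "frac_rel h (ratconst c) (ratconst c)" for c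
    using rel_base[of "single 0 c"]
    by (simp add: h_def const_hom.poly_eval_single[OF const_hom_ratconst] ratconst_def)
  have "frac_rel h (svar i) (X i)" for i
    using rel_base[of "single (single i 1) 1"]
    by (simp add: h_def const_hom.poly_eval_single[OF const_hom_ratconst] svar_def)
  then have rv: "frac_rel h (svar (Suc a) / svar a) (svar a)" for a
    using rel_divide[of "svar (Suc a)" "X (Suc a)" "svar a" "X a" "inverse (X a)"] X0 XS
    by (simp add: divide_inverse)
  have "frac_rel h (at_ratios P) (Fract P 1)" for P
  proof -
    have "frac_rel h (at_ratios P) (poly_eval ratconst svar P)"
      unfolding at_ratios_eval poly_eval_def monom_eval_def
      by (intro rel_sum rel_mult rel_prod rel_power rc rv)
    then show ?thesis by (simp add: poly_eval_svar)
  qed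
  then show ?thesis
    by (intro injI) (metis rel_unique Fract_1_eq_iff)
qed

lemma at_ratios_eq_iff [simp]: "at_ratios P = at_ratios Q \<longleftrightarrow> P = Q"
  using at_ratios_inj by (auto dest: injD)

lemma at_ratios_eq_0_iff [simp]: "at_ratios P = 0 \<longleftrightarrow> P = 0"
  using at_ratios_eq_iff[of P 0] at_ratios_simps(1) by simp

section \<open>The rational identity behind the commutation, by Lagrange interpolation\<close>

section \<open>The commutation identity\<close>

text \<open>\<open>P\<close> equals its interpolation polynomial \<open>L\<close>. Each basis
  polynomial \<open>l y\<close> is monic of degree card S - 1, so this coefficient of
  \<open>L\<close> is the sum of the weights \<open>c y\<close>.\<close>

lemma sum_lagrange_leading:
  fixes P :: "'a::field poly"
  assumes fin: "finite S" and deg: "degree P < card S"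
  shows "(\<Sum>y\<in>S. poly P y / (\<Prod>z\<in>S - {y}. y - z)) = coeff P (card S - 1)"
proof -
  define c where "c y = poly P y / (\<Prod>z\<in>S - {y}. y - z)" for y
  define l where "l y = (\<Prod>z\<in>S - {y}. [:- z, 1:])" for y
  define L where "L = (\<Sum>y\<in>S. smult (c y) (l y))"
  have dl: "degree (l y) = card S - 1" if "y \<in> S" for y
    using that fin by (simp add: l_def degree_prod_eq_sum_degree)
  have ll: "coeff (l y) (card S - 1) = 1" if "y \<in> S" for y
  proof -
    have "coeff (l y) (degree (l y)) = 1" by (simp add: l_def lead_coeff_prod)
    with dl[OF that] show ?thesis by simp
  qed
  have "degree L \<le> card S - 1"
    unfolding L_def by (intro degree_sum_le fin order_trans[OF degree_smult_le]) (simp add: dl)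
  then have dL: "degree L < card S" using deg by linarith
  have "poly L x = poly P x" if x: "x \<in> S" for x
  proof -
    have z: "poly (l y) x = 0" if "y \<noteq> x" for y
      unfolding l_def poly_prod by (rule prod_zero) (use fin x that in auto)
    have "poly L x = (\<Sum>y\<in>S. if y = x then c x * poly (l x) x else 0)"
      unfolding L_def poly_sum by (rule sum.cong) (auto simp: z)
    also have "\<dots> = c x * poly (l x) x" using fin x by simp
    also have "\<dots> = poly P x"
    proof -
      have e: "poly (l x) x = (\<Prod>z\<in>S - {x}. x - z)" by (simp add: l_def poly_prod)
      have "(\<Prod>z\<in>S - {x}. x - z) \<noteq> 0" using fin by simp
      then show ?thesis by (simp add: c_def e)
    qed
    finally show ?thesis .
  qed
  then have "L = P" by (intro poly_eqI_degree[of S] dL deg)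
  moreover have "coeff L (card S - 1) = (\<Sum>y\<in>S. c y)"
    by (simp add: L_def coeff_sum ll[unfolded One_nat_def] cong: sum.cong)
  ultimately show ?thesis by (simp add: c_def)
qed

definition afactor :: "'a::field \<Rightarrow> 'a \<Rightarrow> 'a \<Rightarrow> 'a"
  where "afactor t x y = (t * x - y) / (x - y)"

text \<open>
  Apply the Lagrange formula to \<open>\<Prod>\<^sub>i (t z - x\<^sub>i) (t x\<^sub>i - q z)\<close> at the nodes \<open>0\<close>, \<open>x\<^sub>k\<close> and \<open>x\<^sub>k / q\<close>:
  the term at \<open>0\<close> cancels the leading coefficient, and the other two families of terms are
  opposite multiples of the two sides, with the factor \<open>(t - 1) (t - q)\<close>.
\<close>

lemma afactor_sum_identity:
  fixes x :: "'i \<Rightarrow> 'a::field"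
  assumes fin: "finite J" and inj: "inj_on x J" and x0: "\<And>k. k \<in> J \<Longrightarrow> x k \<noteq> 0"
    and q0: "q \<noteq> 0" and qx: "\<And>i k. i \<in> J \<Longrightarrow> k \<in> J \<Longrightarrow> x i \<noteq> q * x k"
  shows "(\<Sum>k\<in>J. \<Prod>i\<in>J - {k}. afactor t (x k) (x i) * afactor t (x i) (q * x k)) =
         (\<Sum>k\<in>J. \<Prod>i\<in>J - {k}. afactor t (x i) (x k) * afactor t (x k) (q * x i))"
    (is "(\<Sum>k\<in>J. ?L k) = (\<Sum>k\<in>J. ?R k)")
proof -
  have xne: "x i \<noteq> x k" if "i \<in> J" "k \<in> J" "i \<noteq> k" for i k
    using inj that by (auto dest: inj_onD)
  \<comment> \<open>Interpolation gives the identity only up to the factor (t - 1) (t - q). At the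
    two excluded values the summands agree one by one: all factors are 1 for t = 1, and each product
    of two factors is q for t = q.\<close>
  consider "t = 1" | "t = q" | "t \<noteq> 1" "t \<noteq> q" by blast
  then show ?thesis
  proof cases
    case 1
    have "?L k = ?R k" if "k \<in> J" for k
    proof (rule prod.cong)
      fix i assume "i \<in> J - {k}"
      with that have "x i \<noteq> x k" "x i \<noteq> q * x k" "x k \<noteq> q * x i" using xne qx by auto
      then show "afactor t (x k) (x i) * afactor t (x i) (q * x k) = afactor t (x i) (x k) * afactor t (x k) (q * x i)"
        using 1 by (simp add: afactor_def)
    qed simp
    then show ?thesis by (rule sum.cong[OF refl])
  next
    case 2
    have "?L k = ?R k" if "k \<in> J" for k
    proof (rule prod.cong)
      fix i assume "i \<in> J - {k}"
      with that have n: "x i - x k \<noteq> 0" "x k - x i \<noteq> 0" "x i - q * x k \<noteq> 0" "x k - q * x i \<noteq> 0" "q * x k - x i \<noteq> 0" "q * x i - x k \<noteq> 0"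
        using xne[of i k] qx[of i k] qx[of k i] by auto
      have a: "afactor t u v * afactor t v (q * u) = q" if "u - v \<noteq> 0" "v - q * u \<noteq> 0" for u v :: 'a
      proof -
        have "afactor t u v * afactor t v (q * u) = ((q * u - v) * (q * (v - u))) / ((u - v) * (v - q * u))"
          using 2 by (simp add: afactor_def algebra_simps)
        also have "(q * u - v) * (q * (v - u)) = q * ((u - v) * (v - q * u))" by algebra
        finally show ?thesis using that by simp
      qed
      show "afactor t (x k) (x i) * afactor t (x i) (q * x k) = afactor t (x i) (x k) * afactor t (x k) (q * x i)"
        using a[of "x k" "x i"] a[of "x i" "x k"] n by simp
    qed simp
    then show ?thesis by (rule sum.cong[OF refl])
  next
    case 3
    define m where "m = card J"
    define A where "A = x ` J"
    define B where "B = (\<lambda>k. x k / q) ` J"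
    define S where "S = insert 0 (A \<union> B)"
    define P where "P = (\<Prod>i\<in>J. [:- x i, t:] * [:t * x i, - q:])"
    define T where "T y = poly P y / (\<Prod>z\<in>S - {y}. y - z)" for y
    have injB: "inj_on (\<lambda>k. x k / q) J" using inj q0 by (auto simp: inj_on_def)
    have AB: "A \<inter> B = {}"
    proof -
      have "x i \<noteq> x k / q" if "i \<in> J" "k \<in> J" for i k
        using qx[of k i] that q0 by (auto simp: field_simps)
      then show ?thesis by (auto simp: A_def B_def)
    qed
    have 0: "0 \<notin> A \<union> B" using x0 q0 by (auto simp: A_def B_def)
    have finS: "finite A" "finite B" "finite S" using fin by (auto simp: A_def B_def S_def)
    have cA: "card A = m" "card B = m" using inj injB by (auto simp: A_def B_def m_def card_image)
    have cS: "card S = 2 * m + 1" using 0 AB finS cA by (simp add: S_def card_Un_disjoint)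
    have prodS: "(\<Prod>z\<in>S. f z) = f 0 * (\<Prod>i\<in>J. f (x i) * f (x i / q))" for f :: "'a \<Rightarrow> 'a"
    proof -
      have "(\<Prod>z\<in>S. f z) = f 0 * ((\<Prod>z\<in>A. f z) * (\<Prod>z\<in>B. f z))"
        unfolding S_def using 0 AB finS by (simp add: prod.union_disjoint)
      also have "(\<Prod>z\<in>A. f z) = (\<Prod>i\<in>J. f (x i))" unfolding A_def using inj by (simp add: prod.reindex)
      also have "(\<Prod>z\<in>B. f z) = (\<Prod>i\<in>J. f (x i / q))" unfolding B_def using injB by (simp add: prod.reindex)
      finally show ?thesis by (simp add: prod.distrib)
    qed
    have degf: "degree ([:- x i, t:] * [:t * x i, - q:]) \<le> 2" for i
      by (rule order_trans[OF degree_mult_le]) simp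
    have "degree P \<le> (\<Sum>i\<in>J. 2)" unfolding P_def
      by (intro order_trans[OF degree_prod_sum_le] sum_mono fin) (use degf in auto)
    then have degP: "degree P \<le> 2 * m" by (simp add: m_def)
    have coeffP: "coeff P (2 * m) = (- (t * q)) ^ m"
    proof -
      have "coeff (\<Prod>i\<in>K. [:- x i, t:] * [:t * x i, - q:]) (2 * card K) = (- (t * q)) ^ card K \<and>
            degree (\<Prod>i\<in>K. [:- x i, t:] * [:t * x i, - q:]) \<le> 2 * card K" if "finite K" for K
        using that
      proof induction
        case empty
        then show ?case by simp
      next
        case (insert k K)
        let ?f = "[:- x k, t:] * [:t * x k, - q:]" and ?g = "\<Prod>i\<in>K. [:- x i, t:] * [:t * x i, - q:]"
        have "coeff (?f * ?g) (2 + 2 * card K) = coeff ?f 2 * coeff ?g (2 * card K)"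
        proof -
          have "coeff (?f * ?g) (2 + 2 * card K) = (\<Sum>i\<le>2 + 2 * card K. if i = 2 then coeff ?f 2 * coeff ?g (2 * card K) else 0)"
            unfolding coeff_mult[of ?f ?g]
          proof (rule sum.cong)
            fix i assume "i \<in> {..2 + 2 * card K}"
            show "coeff ?f i * coeff ?g (2 + 2 * card K - i) = (if i = 2 then coeff ?f 2 * coeff ?g (2 * card K) else 0)"
            proof (cases "i < 2")
              case True
              then have "degree ?g < 2 + 2 * card K - i" using insert.IH by linarith
              then show ?thesis using True by (simp add: coeff_eq_0)
            next
              case False
              then show ?thesis using degf[of k] by (cases "i = 2") (auto simp: coeff_eq_0)
            qed
          qed simp
          then show ?thesis by simp
        qed
        moreover have "coeff ?f 2 = - (t * q)" by (simp add: numeral_2_eq_2)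
        moreover have "degree (?f * ?g) \<le> 2 + 2 * card K"
          using degree_mult_le[of ?f ?g] degf[of k] insert.IH by linarith
        ultimately show ?case using insert by simp
      qed
      then show ?thesis using fin by (simp add: P_def m_def)
    qed
    have polyP: "poly P z = (\<Prod>i\<in>J. (t * z - x i) * (t * x i - q * z))" for z
      by (simp add: P_def poly_prod algebra_simps)
    have sum0: "(\<Sum>y\<in>S. T y) = (- (t * q)) ^ m"
      using sum_lagrange_leading[of S P] degP finS cS coeffP by (simp add: T_def)
    have sumS: "(\<Sum>y\<in>S. T y) = T 0 + ((\<Sum>k\<in>J. T (x k)) + (\<Sum>k\<in>J. T (x k / q)))"
    proof -
      have "(\<Sum>y\<in>S. T y) = T 0 + ((\<Sum>z\<in>A. T z) + (\<Sum>z\<in>B. T z))"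
        unfolding S_def using 0 AB finS by (simp add: sum.union_disjoint)
      then show ?thesis using inj injB by (simp add: A_def B_def sum.reindex)
    qed
    have T0: "T 0 = (- (t * q)) ^ m"
    proof -
      \<comment> \<open>The omitted node receives the factor 1, so that \<open>prodS\<close>
        applies; the other nodes are treated in the same way.\<close>
      have "(\<Prod>z\<in>S - {0}. 0 - z) = (\<Prod>z\<in>S. if z = 0 then 1 else 0 - z)"
        using finS by (intro prod.mono_neutral_cong_left) auto
      also have "\<dots> = (\<Prod>i\<in>J. x i * x i / q)"
        unfolding prodS using x0 q0 by (auto intro!: prod.cong)
      finally have d: "(\<Prod>z\<in>S - {0}. 0 - z) = (\<Prod>i\<in>J. x i * x i / q)" .
      have p: "poly P 0 = (\<Prod>i\<in>J. - x i * (t * x i))" by (simp add: polyP)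
      have "T 0 = (\<Prod>i\<in>J. (- x i * (t * x i)) / (x i * x i / q))"
        by (simp only: T_def p d prod_dividef)
      also have "\<dots> = (\<Prod>i\<in>J. - (t * q))" using x0 q0 by (intro prod.cong) (auto simp: field_simps)
      finally show ?thesis by (simp add: m_def)
    qed
    \<comment> \<open>At x_k the factors with i = k give (t - 1) (t - q) / (1 - 1 / q), and each
      other i gives -q because x_k - x_i / q = (x_i - q x_k) / (-q). At x_k / q only the sign
      changes.\<close>
    define H where "H = (t - 1) * (t - q) / (1 - 1 / q) * (- q) ^ (m - 1)"
    have Jm: "card (J - {k}) = m - 1" if "k \<in> J" for k using that fin by (simp add: m_def)
    have q1: "q \<noteq> 1" if "k \<in> J" for k using qx[OF that that] by auto
    have eqs: "x i = x k \<longleftrightarrow> i = k" "x i / q \<noteq> x k" "x i \<noteq> x k / q" "x i / q = x k / q \<longleftrightarrow> i = k"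
      if "i \<in> J" "k \<in> J" for i k
      using that inj qx[OF that] qx[OF that(2,1)] q0 by (auto simp: field_simps dest: inj_onD)
    have Tx: "T (x k) = H * ?L k" if k: "k \<in> J" for k
    proof -
      have "(\<Prod>z\<in>S - {x k}. x k - z) = (\<Prod>z\<in>S. if z = x k then 1 else x k - z)"
        using finS by (intro prod.mono_neutral_cong_left) auto
      also have "\<dots> = x k * (\<Prod>i\<in>J. (if i = k then 1 else x k - x i) * (x k - x i / q))"
        unfolding prodS using x0[OF k] eqs[OF _ k]
        by (auto intro!: prod.cong)
      also have "\<dots> = x k * ((x k - x k / q) * (\<Prod>i\<in>J - {k}. (x k - x i) * (x k - x i / q)))"
        by (subst prod.remove[OF fin k]) (auto intro!: prod.cong)
      finally have d: "(\<Prod>z\<in>S - {x k}. x k - z) = x k * ((x k - x k / q) * (\<Prod>i\<in>J - {k}. (x k - x i) * (x k - x i / q)))" .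
      have p: "poly P (x k) = ((t * x k - x k) * (t * x k - q * x k)) * (\<Prod>i\<in>J - {k}. (t * x k - x i) * (t * x i - q * x k))"
        unfolding polyP by (subst prod.remove[OF fin k]) simp
      have "T (x k) = ((t * x k - x k) * (t * x k - q * x k)) / (x k * (x k - x k / q)) *
          (\<Prod>i\<in>J - {k}. ((t * x k - x i) * (t * x i - q * x k)) / ((x k - x i) * (x k - x i / q)))"
        unfolding T_def p d by (simp only: prod_dividef times_divide_times_eq mult.assoc)
      also have "((t * x k - x k) * (t * x k - q * x k)) / (x k * (x k - x k / q)) = (t - 1) * (t - q) / (1 - 1 / q)"
      proof -
        have "(t * x k - x k) * (t * x k - q * x k) = (x k * x k) * ((t - 1) * (t - q))" by algebra
        moreover have "x k * (x k - x k / q) = (x k * x k) * (1 - 1 / q)" by (simp add: algebra_simps)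
        ultimately show ?thesis using x0[OF k] by simp
      qed
      also have "(\<Prod>i\<in>J - {k}. ((t * x k - x i) * (t * x i - q * x k)) / ((x k - x i) * (x k - x i / q))) =
          (\<Prod>i\<in>J - {k}. - q * (afactor t (x k) (x i) * afactor t (x i) (q * x k)))"
      proof (rule prod.cong)
        fix i assume i: "i \<in> J - {k}"
        have "x k - x i / q = (x i - q * x k) / (- q)" using q0 by (simp add: field_simps)
        then show "((t * x k - x i) * (t * x i - q * x k)) / ((x k - x i) * (x k - x i / q)) =
            - q * (afactor t (x k) (x i) * afactor t (x i) (q * x k))"
          by (simp add: afactor_def)
      qed simp
      also have "\<dots> = (- q) ^ (m - 1) * ?L k"
        by (simp only: prod.distrib prod_constant Jm[OF k])
      finally show ?thesis by (simp add: H_def)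
    qed
    have Txq: "T (x k / q) = - H * ?R k" if k: "k \<in> J" for k
    proof -
      let ?y = "x k / q"
      have "(\<Prod>z\<in>S - {?y}. ?y - z) = (\<Prod>z\<in>S. if z = ?y then 1 else ?y - z)"
        using finS by (intro prod.mono_neutral_cong_left) auto
      also have "\<dots> = ?y * (\<Prod>i\<in>J. (?y - x i) * (if i = k then 1 else ?y - x i / q))"
        unfolding prodS using x0[OF k] q0 eqs[OF _ k]
        by (auto intro!: prod.cong)
      also have "\<dots> = ?y * ((?y - x k) * (\<Prod>i\<in>J - {k}. (?y - x i) * (?y - x i / q)))"
        by (subst prod.remove[OF fin k]) (auto intro!: prod.cong)
      finally have d: "(\<Prod>z\<in>S - {?y}. ?y - z) = ?y * ((?y - x k) * (\<Prod>i\<in>J - {k}. (?y - x i) * (?y - x i / q)))" .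
      have p: "poly P ?y = ((t * ?y - x k) * (t * x k - q * ?y)) * (\<Prod>i\<in>J - {k}. (t * ?y - x i) * (t * x i - q * ?y))"
        unfolding polyP by (subst prod.remove[OF fin k]) simp
      have "T ?y = ((t * ?y - x k) * (t * x k - q * ?y)) / (?y * (?y - x k)) *
          (\<Prod>i\<in>J - {k}. ((t * ?y - x i) * (t * x i - q * ?y)) / ((?y - x i) * (?y - x i / q)))"
        unfolding T_def p d by (simp only: prod_dividef times_divide_times_eq mult.assoc)
      also have "((t * ?y - x k) * (t * x k - q * ?y)) / (?y * (?y - x k)) = - ((t - 1) * (t - q) / (1 - 1 / q))"
      proof -
        have "(t * ?y - x k) * (t * x k - q * ?y) = (x k * x k / q) * ((t - 1) * (t - q))"
          using q0 by (simp add: field_simps)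
        moreover have "?y * (?y - x k) = (x k * x k / q) * (- (1 - 1 / q))" using q0 by (simp add: field_simps)
        ultimately show ?thesis using x0[OF k] q0 by (simp add: minus_divide_right del: minus_divide_left [symmetric])
      qed
      also have "(\<Prod>i\<in>J - {k}. ((t * ?y - x i) * (t * x i - q * ?y)) / ((?y - x i) * (?y - x i / q))) =
          (\<Prod>i\<in>J - {k}. - q * (afactor t (x i) (x k) * afactor t (x k) (q * x i)))"
      proof (rule prod.cong)
        fix i assume i: "i \<in> J - {k}"
        have e1: "?y - x i = (x k - q * x i) / q" using q0 by (simp add: field_simps)
        have e2: "?y - x i / q = (x i - x k) / (- q)" using q0 by (simp add: field_simps)
        have e3: "t * ?y - x i = (t * x k - q * x i) / q" using q0 by (simp add: field_simps)
        have e4: "t * x i - q * ?y = t * x i - x k" using q0 by simp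
        show "((t * ?y - x i) * (t * x i - q * ?y)) / ((?y - x i) * (?y - x i / q)) =
            - q * (afactor t (x i) (x k) * afactor t (x k) (q * x i))"
          unfolding e1 e2 e3 e4 using q0 by (simp add: afactor_def mult_ac)
      qed simp
      also have "\<dots> = (- q) ^ (m - 1) * ?R k"
        by (simp only: prod.distrib prod_constant Jm[OF k])
      finally show ?thesis by (simp add: H_def)
    qed
    have "H * ((\<Sum>k\<in>J. ?L k) - (\<Sum>k\<in>J. ?R k)) = (\<Sum>k\<in>J. T (x k)) + (\<Sum>k\<in>J. T (x k / q))"
      by (simp add: Tx Txq right_diff_distrib sum_distrib_left sum_negf)
    also have "\<dots> = 0" using sum0 sumS T0 by simp
    finally have z: "H * ((\<Sum>k\<in>J. ?L k) - (\<Sum>k\<in>J. ?R k)) = 0" .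
    show ?thesis
    proof (cases "J = {}")
      case False
      \<comment> \<open>Any k in \<open>J\<close> gives q \<noteq> 1, since x_k \<noteq> q x_k; this
        makes \<open>H\<close> nonzero.\<close>
      then have "q \<noteq> 1" using q1 by auto
      then have "1 - 1 / q \<noteq> 0" using q0 by (simp add: field_simps)
      then have "H \<noteq> 0" using 3 q0 by (simp add: H_def)
      with z show ?thesis by simp
    qed simp
  qed
qed

text \<open>The coefficient in D_r of the product of the shifts over \<open>I\<close>, without the
  power of t.\<close>

definition acoeff :: "'a::field \<Rightarrow> 'i set \<Rightarrow> ('i \<Rightarrow> 'a) \<Rightarrow> 'i set \<Rightarrow> 'a"
  where "acoeff t N y I = (\<Prod>i\<in>I. \<Prod>j\<in>N - I. afactor t (y i) (y j))"

definition shift :: "'a::field \<Rightarrow> 'i set \<Rightarrow> ('i \<Rightarrow> 'a) \<Rightarrow> 'i \<Rightarrow> 'a"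
  where "shift q I y i = (if i \<in> I then q * y i else y i)"

lemma afactor_scale: "q \<noteq> 0 \<Longrightarrow> afactor t (q * x) (q * y) = afactor t x (y :: 'a::field)"
proof -
  assume "q \<noteq> 0"
  have "t * (q * x) - q * y = q * (t * x - y)" "q * x - q * y = q * (x - y)" by (simp_all add: algebra_simps)
  then show ?thesis using \<open>q \<noteq> 0\<close> by (simp add: afactor_def)
qed

text \<open>The coefficient of T_J in the two products of D_1 and D_r, collected over the
  decompositions of J into {k} and J - {k}. The factors between J and its complement do not depend
  on k or on the order and form the constant \<open>C\<close>; those inside J give the interpolation
  identity.\<close>

lemma acoeff_shift_sum:
  fixes x :: "'i \<Rightarrow> 'a::field"
  assumes fin: "finite N" and J: "J \<subseteq> N" and inj: "inj_on x J" and x0: "\<And>k. k \<in> J \<Longrightarrow> x k \<noteq> 0"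
    and q0: "q \<noteq> 0" and qx: "\<And>i k. i \<in> J \<Longrightarrow> k \<in> J \<Longrightarrow> x i \<noteq> q * x k"
  shows "(\<Sum>k\<in>J. acoeff t N x {k} * acoeff t N (shift q {k} x) (J - {k})) =
         (\<Sum>k\<in>J. acoeff t N x (J - {k}) * acoeff t N (shift q (J - {k}) x) {k})"
proof -
  have finJ: "finite J" using fin J finite_subset by blast
  define C where "C = (\<Prod>i\<in>J. \<Prod>j\<in>N - J. afactor t (x i) (x j))"
  have L: "acoeff t N x {k} * acoeff t N (shift q {k} x) (J - {k}) =
      C * (\<Prod>i\<in>J - {k}. afactor t (x k) (x i) * afactor t (x i) (q * x k))"
    and R: "acoeff t N x (J - {k}) * acoeff t N (shift q (J - {k}) x) {k} =
      C * (\<Prod>i\<in>J - {k}. afactor t (x i) (x k) * afactor t (x k) (q * x i))" if k: "k \<in> J" for k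
  proof -
    have N1: "N - {k} = (J - {k}) \<union> (N - J)" and N2: "N - (J - {k}) = insert k (N - J)"
      using k J by auto
    have C: "C = (\<Prod>j\<in>N - J. afactor t (x k) (x j)) * (\<Prod>i\<in>J - {k}. \<Prod>j\<in>N - J. afactor t (x i) (x j))"
      unfolding C_def by (rule prod.remove[OF finJ k])
    have U: "(\<Prod>j\<in>(J - {k}) \<union> (N - J). f j) = (\<Prod>j\<in>J - {k}. f j) * (\<Prod>j\<in>N - J. f j)" for f :: "'i \<Rightarrow> 'a"
      using finJ fin by (intro prod.union_disjoint) auto
    have I: "(\<Prod>j\<in>insert k (N - J). f j) = f k * (\<Prod>j\<in>N - J. f j)" for f :: "'i \<Rightarrow> 'a"
      using fin k by (intro prod.insert) auto
    have sN: "(\<Prod>j\<in>N - J. afactor t u (shift q {k} x j)) = (\<Prod>j\<in>N - J. afactor t u (x j))"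
      and sN': "(\<Prod>j\<in>N - J. afactor t u (shift q (J - {k}) x j)) = (\<Prod>j\<in>N - J. afactor t u (x j))" for u
      using k by (auto intro!: prod.cong simp: shift_def)
    have "acoeff t N (shift q {k} x) (J - {k}) =
        (\<Prod>i\<in>J - {k}. afactor t (x i) (q * x k) * (\<Prod>j\<in>N - J. afactor t (x i) (x j)))"
      unfolding acoeff_def N2 I sN by (rule prod.cong) (auto simp: shift_def)
    then show "acoeff t N x {k} * acoeff t N (shift q {k} x) (J - {k}) =
      C * (\<Prod>i\<in>J - {k}. afactor t (x k) (x i) * afactor t (x i) (q * x k))"
      unfolding C by (simp add: acoeff_def N1 U prod.distrib mult_ac)
    have "acoeff t N (shift q (J - {k}) x) {k} =
        (\<Prod>i\<in>J - {k}. afactor t (x k) (q * x i)) * (\<Prod>j\<in>N - J. afactor t (x k) (x j))"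
      unfolding acoeff_def N1 U sN' by (simp add: shift_def)
    moreover have "acoeff t N x (J - {k}) = (\<Prod>i\<in>J - {k}. afactor t (x i) (x k) * (\<Prod>j\<in>N - J. afactor t (x i) (x j)))"
      unfolding acoeff_def N2 I ..
    ultimately show "acoeff t N x (J - {k}) * acoeff t N (shift q (J - {k}) x) {k} =
      C * (\<Prod>i\<in>J - {k}. afactor t (x i) (x k) * afactor t (x k) (q * x i))"
      unfolding C by (simp add: prod.distrib mult_ac)
  qed
  show ?thesis
    using afactor_sum_identity[OF finJ inj x0 q0 qx, of t]
    by (simp add: L R sum_distrib_left[symmetric])
qed

text \<open>For k in I no summation is required: shifting all of I leaves the factors inside I
  unchanged by homogeneity, and the factors from k to the complement of I occur in either order once
  shifted and once unshifted.\<close>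

lemma acoeff_shift_diag:
  fixes x :: "'i \<Rightarrow> 'a::field"
  assumes fin: "finite N" and I: "I \<subseteq> N" and k: "k \<in> I" and q0: "q \<noteq> 0"
  shows "acoeff t N x {k} * acoeff t N (shift q {k} x) I = acoeff t N x I * acoeff t N (shift q I x) {k}"
proof -
  have finI: "finite I" using fin I finite_subset by blast
  have N1: "N - {k} = (I - {k}) \<union> (N - I)" using k I by auto
  have U: "(\<Prod>j\<in>(I - {k}) \<union> (N - I). f j) = (\<Prod>j\<in>I - {k}. f j) * (\<Prod>j\<in>N - I. f j)" for f :: "'i \<Rightarrow> 'a"
    using finI fin by (intro prod.union_disjoint) auto
  have "acoeff t N (shift q {k} x) I =
      (\<Prod>j\<in>N - I. afactor t (q * x k) (x j)) * (\<Prod>i\<in>I - {k}. \<Prod>j\<in>N - I. afactor t (x i) (x j))"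
    unfolding acoeff_def using k
    by (subst prod.remove[OF finI k]) (auto intro!: arg_cong2[where f = times] prod.cong simp: shift_def)
  moreover have "acoeff t N (shift q I x) {k} =
      (\<Prod>i\<in>I - {k}. afactor t (x k) (x i)) * (\<Prod>j\<in>N - I. afactor t (q * x k) (x j))"
    unfolding acoeff_def N1 U using k q0
    by (auto intro!: arg_cong2[where f = times] prod.cong simp: shift_def afactor_scale)
  moreover have "acoeff t N x {k} = (\<Prod>i\<in>I - {k}. afactor t (x k) (x i)) * (\<Prod>j\<in>N - I. afactor t (x k) (x j))"
    unfolding acoeff_def N1 by (simp add: U)
  moreover have "acoeff t N x I =
      (\<Prod>j\<in>N - I. afactor t (x k) (x j)) * (\<Prod>i\<in>I - {k}. \<Prod>j\<in>N - I. afactor t (x i) (x j))"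
    unfolding acoeff_def by (rule prod.remove[OF finI k])
  ultimately show ?thesis by (simp add: mult_ac)
qed

section \<open>Series in the ratios of the x_i, and commuting q-difference operators on them\<close>

section \<open>Formal series\<close>

lemma mfps_nth_add [simp]: "mfps_nth (f + g) m = mfps_nth f m + mfps_nth g m"
  by (simp add: plus_mfps_def)

lemma mfps_nth_diff [simp]: "mfps_nth (f - g) m = mfps_nth f m - mfps_nth g m"
  by (simp add: minus_mfps_def)

lemma mfps_nth_zero [simp]: "mfps_nth 0 m = 0"
  by (simp add: zero_mfps_def)

lemma mfps_nth_one: "mfps_nth 1 m = (if m = 0 then 1 else 0)"
  by (simp add: one_mfps_def)

lemma mfps_nth_mult: "mfps_nth (f * g) m = (\<Sum>(a, b)\<in>splits m. mfps_nth f a * mfps_nth g b)"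
  by (simp add: times_mfps_def)

lemma mfps_nth_sum: "mfps_nth (\<Sum>i\<in>A. f i) m = (\<Sum>i\<in>A. mfps_nth (f i) m)"
  by (induction A rule: infinite_finite_induct) simp_all

lemma mfps_nth_monom: "mfps_nth (mfps_monom e c) m = (if m = e then c else 0)"
  by (simp add: mfps_monom_def)

lemma mfps_nth_const_mult [simp]: "mfps_nth (mfps_const c * f) m = c * mfps_nth f m"
proof -
  have "mfps_nth (mfps_const c * f) m = (\<Sum>p\<in>splits m. if p = (0, m) then c * mfps_nth f m else 0)"
    unfolding mfps_nth_mult by (rule sum.cong) (auto simp: splits_def mfps_nth_monom split: if_splits)
  then show ?thesis by (simp add: splits_iff)
qed

lemma mfps_monom_mult: "mfps_monom e c * mfps_monom e' c' = mfps_monom (e + e') (c * c')"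
proof (rule mfps_eqI)
  fix m
  have "mfps_nth (mfps_monom e c * mfps_monom e' c') m =
      (\<Sum>p\<in>splits m. if p = (e, e') then c * c' else 0)"
    unfolding mfps_nth_mult by (rule sum.cong) (auto simp: mfps_nth_monom split: if_splits)
  then show "mfps_nth (mfps_monom e c * mfps_monom e' c') m = mfps_nth (mfps_monom (e + e') (c * c')) m"
    by (auto simp: splits_iff mfps_nth_monom)
qed

lemma mfps_monom_add: "mfps_monom e (c + c') = mfps_monom e c + mfps_monom e c'"
  by (rule mfps_eqI) (simp add: mfps_nth_monom)

lemma mfps_const_1 [simp]: "mfps_const 1 = 1"
  by (rule mfps_eqI) (simp add: mfps_nth_monom mfps_nth_one)

lemma mfps_const_hom: "comm_ring_hom mfps_const"
  by unfold_locales (simp_all add: mfps_monom_mult mfps_monom_add)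

lemmas mfps_const_simps = comm_ring_hom.hom_simps[OF mfps_const_hom]

lemma mfps_nth_0_hom: "comm_ring_hom (\<lambda>f. mfps_nth f 0)"
proof
  fix f g :: "'a mfps"
  have "a + b = 0 \<longleftrightarrow> a = 0 \<and> b = 0" for a b :: "nat \<Rightarrow>\<^sub>0 nat"
    by (auto simp: poly_mapping_eq_iff plus_poly_mapping.rep_eq fun_eq_iff)
  then have "splits 0 = {(0, 0)}" by (simp add: splits_def)
  then show "mfps_nth (f * g) 0 = mfps_nth f 0 * mfps_nth g 0" by (simp add: mfps_nth_mult)
qed (simp_all add: mfps_nth_one)

lemma const_hom_mfps: "const_hom (\<lambda>c. mfps_const (ratconst c))"
  by unfold_locales (simp_all add: ratconst_simps mfps_const_simps)

text \<open>Polynomials in the z_a = x_(a+1) / x_a as series, so that \<open>frac_rel expand\<close>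
  says that a series is the expansion of a fraction. The fractions here are functions of x, although
  the same type serves for the functions of s in the coefficients of the series.\<close>

definition expand :: "mpolynomial \<Rightarrow> ratfun mfps"
  where "expand = poly_eval (\<lambda>c. mfps_const (ratconst c)) (\<lambda>a. mfps_monom (single a 1) 1)"

lemma expand_transfer: "frac_transfer expand"
  unfolding frac_transfer_def expand_def by (rule const_hom.poly_eval_hom[OF const_hom_mfps])

lemma monom_eval_mfps: "monom_eval (\<lambda>a. mfps_monom (single a 1) 1 :: 'a::comm_ring_1 mfps) m = mfps_monom m 1"
proof -
  have pow: "(mfps_monom (single a 1) 1 :: 'a mfps) ^ k = mfps_monom (single a k) 1" for a k
    by (induction k) (simp_all add: mfps_monom_mult flip: single_add)
  have pr: "(\<Prod>a\<in>A. mfps_monom (f a) 1 :: 'a mfps) = mfps_monom (\<Sum>a\<in>A. f a) 1" for A and f :: "nat \<Rightarrow> nat \<Rightarrow>\<^sub>0 nat"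
    by (induction A rule: infinite_finite_induct) (simp_all add: mfps_monom_mult)
  show ?thesis
    by (simp add: monom_eval_def pow[unfolded One_nat_def] pr poly_mapping_eq_sum_single)
qed

lemma expand_single: "expand (single m c) = mfps_monom m (ratconst c)"
  unfolding expand_def const_hom.poly_eval_single[OF const_hom_mfps] monom_eval_mfps
  by (simp add: mfps_monom_mult)

lemma root_weight_add: "root_weight (a + b) = root_weight a + root_weight b"
proof -
  let ?f = "\<lambda>m k. single k (int (lookup m k)) - single (Suc k) (int (lookup m k))"
  have e: "root_weight m = (\<Sum>k\<in>A. ?f m k)" if "finite A" "keys m \<subseteq> A" for A m
    unfolding root_weight_def using that by (intro sum.mono_neutral_left) (auto simp: in_keys_iff)
  let ?A = "keys a \<union> keys b"
  have "root_weight (a + b) = (\<Sum>k\<in>?A. ?f (a + b) k)"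
    by (rule e) (use Poly_Mapping.keys_add[of a b] in auto)
  also have "\<dots> = (\<Sum>k\<in>?A. ?f a k) + (\<Sum>k\<in>?A. ?f b k)"
    unfolding sum.distrib[symmetric] by (rule sum.cong) (simp_all add: lookup_add single_add)
  finally show ?thesis using e[of ?A a] e[of ?A b] by simp
qed

lemma lookup_root_weight_Suc: "lookup (root_weight m) (Suc i) = int (lookup m (Suc i)) - int (lookup m i)"
proof -
  have "lookup (root_weight m) (Suc i) =
    (\<Sum>k\<in>keys m. (if k = Suc i then int (lookup m k) else 0) - (if k = i then int (lookup m k) else 0))"
    unfolding root_weight_def lookup_sum by (rule sum.cong) (auto simp: lookup_minus lookup_single when_def)
  also have "\<dots> = int (lookup m (Suc i)) - int (lookup m i)"
    by (simp add: sum_subtractf in_keys_iff)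
  finally show ?thesis .
qed

lemma lookup_root_weight_0: "lookup (root_weight m) 0 = int (lookup m 0)"
proof -
  have "lookup (root_weight m) 0 = (\<Sum>k\<in>keys m. (if k = 0 then int (lookup m k) else 0))"
    unfolding root_weight_def lookup_sum by (rule sum.cong) (auto simp: lookup_minus lookup_single when_def)
  then show ?thesis by (simp add: in_keys_iff)
qed

lemma root_weight_zero [simp]: "root_weight 0 = 0"
  by (simp add: root_weight_def)

lemma lookup_root_weight_root_multiple:
  assumes "i < j"
  shows "lookup (root_weight (root_multiple i j k)) l = (if l = i then int k else if l = j then - int k else 0)"
  using assms by (cases l) (auto simp: lookup_root_weight_Suc lookup_root_weight_0 lookup_root_multiple)

section \<open>The shift operators on series\<close>

definition qweight :: "complex \<Rightarrow> nat set \<Rightarrow> (nat \<Rightarrow>\<^sub>0 nat) \<Rightarrow> complex"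
  where "qweight q I m = (\<Prod>i\<in>I. q powi (- lookup (root_weight m) i))"

text \<open>The part of \<open>qshift\<close> that does not come from x^\<lambda>. Unlike
  \<open>qshift\<close> it is a ring homomorphism, so it can be moved past the coefficients of the
  operators.\<close>

definition qact :: "complex \<Rightarrow> nat set \<Rightarrow> ratfun mfps \<Rightarrow> ratfun mfps"
  where "qact q I \<phi> = Abs_mfps (\<lambda>m. ratconst (qweight q I m) * mfps_nth \<phi> m)"

lemma mfps_nth_qact: "mfps_nth (qact q I \<phi>) m = ratconst (qweight q I m) * mfps_nth \<phi> m"
  by (simp add: qact_def)

lemma qweight_0 [simp]: "qweight q I 0 = 1"
  by (simp add: qweight_def)

lemma qweight_add: "q \<noteq> 0 \<Longrightarrow> qweight q I (a + b) = qweight q I a * qweight q I b"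
proof -
  assume q: "q \<noteq> 0"
  have "q powi (- (x + y)) = q powi (- x) * q powi (- y)" for x y
    using power_int_add[of q "- x" "- y"] q by simp
  then show ?thesis by (simp add: qweight_def root_weight_add lookup_add prod.distrib)
qed

lemma qact_hom: "q \<noteq> 0 \<Longrightarrow> comm_ring_hom (qact q I)"
proof
  fix f g
  assume q: "q \<noteq> 0"
  show "qact q I (f + g) = qact q I f + qact q I g"
    by (rule mfps_eqI) (simp add: mfps_nth_qact distrib_left)
  show "qact q I 1 = 1"
    by (rule mfps_eqI) (simp add: mfps_nth_qact mfps_nth_one)
  show "qact q I (f * g) = qact q I f * qact q I g"
  proof (rule mfps_eqI)
    fix m
    show "mfps_nth (qact q I (f * g)) m = mfps_nth (qact q I f * qact q I g) m"
      unfolding mfps_nth_qact mfps_nth_mult sum_distrib_left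
      by (rule sum.cong) (auto simp: splits_def qweight_add[OF q] ratconst_simps mult_ac)
  qed
qed

lemma qact_monom: "qact q I (mfps_monom e c) = mfps_monom e (ratconst (qweight q I e) * c)"
  by (rule mfps_eqI) (simp add: mfps_nth_qact mfps_nth_monom)

lemma qact_const [simp]: "qact q I (mfps_const c) = mfps_const c"
  by (simp add: qact_monom)

lemma qact_commute: "qact q I (qact q J \<phi>) = qact q J (qact q I \<phi>)"
  by (rule mfps_eqI) (simp add: mfps_nth_qact mult_ac)

lemma qact_Un:
  assumes "finite I" "finite J" "I \<inter> J = {}"
  shows "qact q I (qact q J \<phi>) = qact q (I \<union> J) \<phi>"
  using assms by (intro mfps_eqI) (simp add: mfps_nth_qact qweight_def prod.union_disjoint ratconst_simps)

lemma qact_empty [simp]: "qact q {} \<phi> = \<phi>"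
  by (rule mfps_eqI) (simp add: mfps_nth_qact qweight_def)

text \<open>The monomials \<open>xmon i\<close> play the role of \<open>x\<^sub>i\<close>: their quotients are the \<open>x\<^sub>j / x\<^sub>i\<close>.\<close>

definition xmon :: "nat \<Rightarrow> ratfun"
  where "xmon i = Fract (single (root_multiple 0 i 1) 1) 1"

lemma xmon_neq_0 [simp]: "xmon i \<noteq> 0"
  by (simp add: xmon_def) (metis lookup_single_eq lookup_zero one_neq_zero)

lemma root_multiple_neq: "i \<noteq> j \<Longrightarrow> root_multiple 0 i 1 \<noteq> root_multiple 0 j 1"
proof (induction i j rule: linorder_wlog)
  case (le a b)
  then have "lookup (root_multiple 0 a 1) a \<noteq> lookup (root_multiple 0 b 1) a"
    by (simp add: lookup_root_multiple)
  then show ?case by metis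
next
  case (sym a b)
  then show ?case by metis
qed

lemma xmon_neq:
  assumes "i \<noteq> j" "c \<noteq> 0" "d \<noteq> 0"
  shows "ratconst c * xmon i \<noteq> ratconst d * xmon j"
  using assms root_multiple_neq[OF assms(1)]
  by (simp add: xmon_def ratconst_def mult_single single_eq_iff)

lemma xmon_less:
  assumes "i < j"
  shows "xmon j = xmon i * Fract (single (root_multiple i j 1) 1) 1"
proof -
  have "root_multiple 0 j 1 = root_multiple 0 i 1 + root_multiple i j 1"
    using assms by (intro poly_mapping_eqI) (auto simp: lookup_add lookup_root_multiple)
  then show ?thesis by (simp add: xmon_def mult_single)
qed

definition kap :: "complex \<Rightarrow> nat set \<Rightarrow> nat \<Rightarrow> complex"
  where "kap q I i = (if i \<in> I then q else 1)"

lemma shift_xmon: "shift (ratconst q) I xmon i = ratconst (kap q I i) * xmon i"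
  by (simp add: shift_def kap_def)

lemma qweight_root_multiple:
  assumes "i < j" "finite I" "q \<noteq> 0"
  shows "qweight q I (root_multiple i j 1) = kap q I j / kap q I i"
proof -
  have "qweight q I (root_multiple i j 1) =
      (\<Prod>l\<in>I. (if l = i then inverse q else 1) * (if l = j then q else 1))"
    unfolding qweight_def
    by (rule prod.cong) (use assms in \<open>auto simp: lookup_root_weight_root_multiple power_int_minus\<close>)
  also have "\<dots> = kap q I j / kap q I i"
    using assms by (simp add: prod.distrib kap_def field_simps)
  finally show ?thesis .
qed

text \<open>Dividing numerator and denominator by the dominant variable leaves a quotient with
  denominator 1 - r, where r is a multiple of the small ratio. It is nonzero because the
  \<open>xmon\<close> are distinct monomials, and its image is inverted by the shifted geometric
  series, as seen by applying \<open>qact\<close> to \<open>xgeom_inverse\<close>.\<close>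

lemma frac_rel_D_factor:
  assumes ij: "i \<noteq> j" and fin: "finite I" and q0: "q \<noteq> 0"
  shows "frac_rel expand (afactor (ratconst t) (shift (ratconst q) I xmon i) (shift (ratconst q) I xmon j))
    (qact q I (D_factor t i j))"
proof -
  interpret frac_transfer expand by (rule expand_transfer)
  interpret Q: comm_ring_hom "qact q I" by (rule qact_hom[OF q0])
  have k0: "kap q I l \<noteq> 0" for l using q0 by (simp add: kap_def)
  have rc: "frac_rel expand (ratconst c) (mfps_const (ratconst c))" for c
    using rel_base[of "single 0 c"] by (simp add: ratconst_def[symmetric] expand_single)
  define W where "W a b = (Fract (single (root_multiple a b 1) 1) 1 :: ratfun)" for a b
  have rW: "frac_rel expand (W a b) (xratio a b)" for a b
    using rel_base[of "single (root_multiple a b 1) 1"] by (simp add: W_def xratio_def expand_single)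
  have inv: "(1 - mfps_const (ratconst (kap q I b / kap q I a)) * xratio a b) * qact q I (xgeom a b) = 1"
    and rat: "qact q I (xratio a b) = mfps_const (ratconst (kap q I b / kap q I a)) * xratio a b"
    if "a < b" for a b
  proof -
    show rat: "qact q I (xratio a b) = mfps_const (ratconst (kap q I b / kap q I a)) * xratio a b"
      by (simp add: xratio_def qact_monom mfps_monom_mult qweight_root_multiple[unfolded One_nat_def, OF that fin q0])
    have "qact q I ((1 - xratio a b) * xgeom a b) = 1"
      by (simp only: xgeom_inverse[OF that] Q.hom_one)
    then show "(1 - mfps_const (ratconst (kap q I b / kap q I a)) * xratio a b) * qact q I (xgeom a b) = 1"
      by (simp add: Q.hom_simps rat)
  qed
  have nz: "1 - ratconst (kap q I b / kap q I a) * W a b \<noteq> 0" if "a < b" for a b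
  proof
    assume "1 - ratconst (kap q I b / kap q I a) * W a b = 0"
    then have "ratconst (kap q I a) * xmon a * (1 - ratconst (kap q I b / kap q I a) * W a b) = 0" by simp
    moreover have "ratconst (kap q I a) * ratconst (kap q I b / kap q I a) = ratconst (kap q I b)"
      using k0 by (simp flip: ratconst_simps)
    ultimately have "ratconst (kap q I a) * xmon a = ratconst (kap q I b) * (xmon a * W a b)"
      by (simp add: algebra_simps)
    then show False
      using xmon_neq[of a b] xmon_less[OF that] k0 that by (simp add: W_def)
  qed
  have y: "shift (ratconst q) I xmon b = shift (ratconst q) I xmon a * (ratconst (kap q I b / kap q I a) * W a b)"
    if "a < b" for a b
  proof -
    have "ratconst (kap q I b) = ratconst (kap q I a) * ratconst (kap q I b / kap q I a)"
      using k0 by (simp flip: ratconst_simps)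
    then show ?thesis using xmon_less[OF that] by (simp add: shift_xmon W_def)
  qed
  have y0: "shift (ratconst q) I xmon a \<noteq> 0" for a using k0 by (simp add: shift_xmon)
  consider "i < j" | "j < i" using ij by linarith
  then show ?thesis
  proof cases
    case 1
    let ?r = "ratconst (kap q I j / kap q I i) * W i j" and ?y = "shift (ratconst q) I xmon i"
    have "afactor (ratconst t) ?y (?y * ?r) = (?y * (ratconst t - ?r)) / (?y * (1 - ?r))"
      unfolding afactor_def by (simp add: algebra_simps)
    also have "\<dots> = (ratconst t - ?r) / (1 - ?r)" using y0[of i] by simp
    finally have "afactor (ratconst t) ?y (shift (ratconst q) I xmon j) = (ratconst t - ?r) / (1 - ?r)"
      by (simp add: y[OF 1])
    moreover have "qact q I (D_factor t i j) =
        (mfps_const (ratconst t) - mfps_const (ratconst (kap q I j / kap q I i)) * xratio i j) * qact q I (xgeom i j)"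
      using 1 by (simp add: D_factor_def Q.hom_simps rat)
    ultimately show ?thesis
      using rel_divide[OF rel_diff[OF rc rel_mult[OF rc rW]] rel_diff[OF rel_1 rel_mult[OF rc rW]] nz[OF 1] inv[OF 1]]
      by simp
  next
    case 2
    let ?r = "ratconst (kap q I i / kap q I j) * W j i" and ?y = "shift (ratconst q) I xmon j"
    have "afactor (ratconst t) (?y * ?r) ?y = (- ?y * (1 - ratconst t * ?r)) / (- ?y * (1 - ?r))"
      unfolding afactor_def by (simp add: algebra_simps)
    also have "\<dots> = (1 - ratconst t * ?r) / (1 - ?r)" using y0[of j] by simp
    finally have "afactor (ratconst t) (shift (ratconst q) I xmon i) ?y = (1 - ratconst t * ?r) / (1 - ?r)"
      by (simp add: y[OF 2])
    moreover have "qact q I (D_factor t i j) =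
        (1 - mfps_const (ratconst t) * (mfps_const (ratconst (kap q I i / kap q I j)) * xratio j i)) * qact q I (xgeom j i)"
      using 2 by (simp add: D_factor_def Q.hom_simps rat)
    ultimately show ?thesis
      using rel_divide[OF rel_diff[OF rel_1 rel_mult[OF rc rel_mult[OF rc rW]]] rel_diff[OF rel_1 rel_mult[OF rc rW]] nz[OF 2] inv[OF 2]]
      by simp
  qed
qed

section \<open>Commutativity of the operators\<close>

definition Dcoeff :: "nat \<Rightarrow> complex \<Rightarrow> nat set \<Rightarrow> ratfun mfps"
  where "Dcoeff n t I = (\<Prod>i\<in>I. \<Prod>j\<in>{1..n} - I. D_factor t i j)"

definition sscale :: "nat \<Rightarrow> complex \<Rightarrow> nat set \<Rightarrow> ratfun"
  where "sscale n t I = (\<Prod>i\<in>I. svar i * ratconst (t powi (int i - int n)))"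

text \<open>D_r without t^(r choose 2), with the scalar produced by x^\<lambda> split off, so that
  commutation only concerns \<open>Dcoeff\<close> and \<open>qact\<close>.\<close>

definition Dop :: "nat \<Rightarrow> complex \<Rightarrow> complex \<Rightarrow> nat \<Rightarrow> ratfun mfps \<Rightarrow> ratfun mfps"
  where "Dop n q t r \<phi> =
    (\<Sum>I | I \<subseteq> {1..n} \<and> card I = r. mfps_const (sscale n t I) * (Dcoeff n t I * qact q I \<phi>))"

lemma qshift_eq: "qshift n q t I \<phi> = mfps_const (sscale n t I) * qact q I \<phi>"
proof (rule mfps_eqI)
  fix m
  show "mfps_nth (qshift n q t I \<phi>) m = mfps_nth (mfps_const (sscale n t I) * qact q I \<phi>) m"
    unfolding mfps_nth_const_mult
    by (simp add: qshift_def mfps_nth_qact sscale_def qweight_def ratconst_simps prod.distrib mult_ac)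
qed

lemma macdonald_D_eq: "macdonald_D n q t r \<phi> = mfps_const (ratconst (t ^ (r choose 2))) * Dop n q t r \<phi>"
  by (simp add: macdonald_D_def Dop_def qshift_eq Dcoeff_def mult_ac)

lemma frac_rel_Dcoeff:
  assumes "I \<subseteq> {1..n}" "finite L" "q \<noteq> 0"
  shows "frac_rel expand (acoeff (ratconst t) {1..n} (shift (ratconst q) L xmon) I) (qact q L (Dcoeff n t I))"
proof -
  interpret frac_transfer expand by (rule expand_transfer)
  interpret Q: comm_ring_hom "qact q L" by (rule qact_hom[OF assms(3)])
  show ?thesis
    unfolding acoeff_def Dcoeff_def Q.hom_prod
    by (intro rel_prod frac_rel_D_factor) (use assms in auto)
qed

lemma frac_rel_Dcoeff_0:
  assumes "I \<subseteq> {1..n}"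
  shows "frac_rel expand (acoeff (ratconst t) {1..n} xmon I) (Dcoeff n t I)"
  using frac_rel_Dcoeff[OF assms, of "{}" 1 t] by (simp add: shift_def[abs_def])

text \<open>\<open>acoeff_shift_sum\<close> at the nodes \<open>xmon\<close>, transferred along
  \<open>expand\<close>. The hypothesis q \<noteq> 1 excludes x_k = q x_k.\<close>

lemma Dcoeff_shift_sum:
  assumes J: "J \<subseteq> {1..n}" and q0: "q \<noteq> 0" and q1: "q \<noteq> 1"
  shows "(\<Sum>k\<in>J. Dcoeff n t {k} * qact q {k} (Dcoeff n t (J - {k}))) =
         (\<Sum>k\<in>J. Dcoeff n t (J - {k}) * qact q (J - {k}) (Dcoeff n t {k}))"
proof -
  interpret frac_transfer expand by (rule expand_transfer)
  let ?N = "{1..n}" and ?a = "acoeff (ratconst t) {1..n}" and ?sh = "\<lambda>L. shift (ratconst q) L xmon"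
  have finJ: "finite J" using J finite_subset by blast
  have "xmon i \<noteq> ratconst q * xmon k" for i k
  proof (cases "i = k")
    case True
    then show ?thesis using q1 ratconst_eq_iff[of q 1] by auto
  next
    case False
    then show ?thesis using xmon_neq[of i k 1 q] q0 by simp
  qed
  moreover have "inj_on xmon J"
    using xmon_neq[of _ _ 1 1] by (auto simp: inj_on_def)
  ultimately have eq: "(\<Sum>k\<in>J. ?a xmon {k} * ?a (?sh {k}) (J - {k})) = (\<Sum>k\<in>J. ?a xmon (J - {k}) * ?a (?sh (J - {k})) {k})"
    using J q0 by (intro acoeff_shift_sum) auto
  have 1: "frac_rel expand (\<Sum>k\<in>J. ?a xmon {k} * ?a (?sh {k}) (J - {k}))
      (\<Sum>k\<in>J. Dcoeff n t {k} * qact q {k} (Dcoeff n t (J - {k})))"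
    by (intro rel_sum rel_mult frac_rel_Dcoeff frac_rel_Dcoeff_0) (use J q0 in auto)
  have 2: "frac_rel expand (\<Sum>k\<in>J. ?a xmon (J - {k}) * ?a (?sh (J - {k})) {k})
      (\<Sum>k\<in>J. Dcoeff n t (J - {k}) * qact q (J - {k}) (Dcoeff n t {k}))"
    by (intro rel_sum rel_mult frac_rel_Dcoeff frac_rel_Dcoeff_0) (use J q0 finJ in auto)
  show ?thesis using rel_unique[OF 1[unfolded eq] 2] .
qed

lemma Dcoeff_shift_diag:
  assumes I: "I \<subseteq> {1..n}" and k: "k \<in> I" and q0: "q \<noteq> 0"
  shows "Dcoeff n t {k} * qact q {k} (Dcoeff n t I) = Dcoeff n t I * qact q I (Dcoeff n t {k})"
proof -
  interpret frac_transfer expand by (rule expand_transfer)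
  let ?a = "acoeff (ratconst t) {1..n}" and ?sh = "\<lambda>L. shift (ratconst q) L xmon"
  have finI: "finite I" using I finite_subset by blast
  have eq: "?a xmon {k} * ?a (?sh {k}) I = ?a xmon I * ?a (?sh I) {k}"
    using I k q0 by (intro acoeff_shift_diag) auto
  have 1: "frac_rel expand (?a xmon {k} * ?a (?sh {k}) I) (Dcoeff n t {k} * qact q {k} (Dcoeff n t I))"
    by (intro rel_mult frac_rel_Dcoeff frac_rel_Dcoeff_0) (use I k q0 in auto)
  have 2: "frac_rel expand (?a xmon I * ?a (?sh I) {k}) (Dcoeff n t I * qact q I (Dcoeff n t {k}))"
    by (intro rel_mult frac_rel_Dcoeff frac_rel_Dcoeff_0) (use I k q0 finI in auto)
  show ?thesis using rel_unique[OF 1[unfolded eq] 2] .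
qed

lemma card_1_subsets: "{K. K \<subseteq> N \<and> card K = 1} = (\<lambda>k. {k}) ` N"
  by (auto simp: card_1_singleton_iff)

lemma Dop_1: "Dop n q t 1 \<phi> = (\<Sum>k\<in>{1..n}. mfps_const (sscale n t {k}) * (Dcoeff n t {k} * qact q {k} \<phi>))"
  unfolding Dop_def card_1_subsets by (simp add: sum.reindex)

text \<open>Both compositions are sums over pairs (k, I). The pairs with k in I agree individually.
  The others are grouped by J, the union of {k} and I: the scalars and the shift depend only on J,
  so the sum of the coefficients over k in J decides.\<close>

lemma Dop_commute:
  assumes q0: "q \<noteq> 0" and q1: "q \<noteq> 1"
  shows "Dop n q t 1 (Dop n q t r \<phi>) = Dop n q t r (Dop n q t 1 \<phi>)"
proof -
  let ?N = "{1..n}"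
  define S where "S = {I. I \<subseteq> ?N \<and> card I = r}"
  define f where "f k I = mfps_const (sscale n t {k}) * mfps_const (sscale n t I) *
      (Dcoeff n t {k} * qact q {k} (Dcoeff n t I)) * qact q {k} (qact q I \<phi>)" for k I
  define g where "g k I = mfps_const (sscale n t {k}) * mfps_const (sscale n t I) *
      (Dcoeff n t I * qact q I (Dcoeff n t {k})) * qact q {k} (qact q I \<phi>)" for k I
  have finS: "finite S" unfolding S_def by simp
  note Q = comm_ring_hom.hom_simps[OF qact_hom[OF q0]]
  have 1: "Dop n q t 1 (Dop n q t r \<phi>) = (\<Sum>k\<in>?N. \<Sum>I\<in>S. f k I)"
    unfolding Dop_1 Dop_def[of n q t r] S_def[symmetric]
    by (simp add: Q sum_distrib_left f_def mult_ac)
  have "Dop n q t r (Dop n q t 1 \<phi>) = (\<Sum>I\<in>S. \<Sum>k\<in>?N. g k I)"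
    unfolding Dop_1 Dop_def[of n q t r] S_def[symmetric]
    by (simp add: Q sum_distrib_left g_def mult_ac qact_commute[of q _ "{_}"])
  also have "\<dots> = (\<Sum>k\<in>?N. \<Sum>I\<in>S. g k I)" by (rule sum.swap)
  finally have 2: "Dop n q t r (Dop n q t 1 \<phi>) = (\<Sum>k\<in>?N. \<Sum>I\<in>S. g k I)" .
  define U where "U = {(k, I). k \<in> ?N \<and> I \<in> S \<and> k \<in> I}"
  define V where "V = {(k, I). k \<in> ?N \<and> I \<in> S \<and> k \<notin> I}"
  have UV: "?N \<times> S = U \<union> V" "U \<inter> V = {}" "finite (?N \<times> S)"
    using finS by (auto simp: U_def V_def)
  have split: "(\<Sum>k\<in>?N. \<Sum>I\<in>S. F k I) = (\<Sum>(k, I)\<in>U. F k I) + (\<Sum>(k, I)\<in>V. F k I)"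
    for F :: "nat \<Rightarrow> nat set \<Rightarrow> ratfun mfps"
    using UV by (simp add: sum.cartesian_product sum.union_disjoint)
  have U: "(\<Sum>(k, I)\<in>U. f k I) = (\<Sum>(k, I)\<in>U. g k I)"
    by (rule sum.cong) (auto simp: U_def S_def f_def g_def Dcoeff_shift_diag[OF _ _ q0])
  define S' where "S' = {J. J \<subseteq> ?N \<and> card J = Suc r}"
  have finS': "finite S'" unfolding S'_def by simp
  have finJ: "finite J" if "J \<in> S'" for J using that finite_subset by (auto simp: S'_def)
  have V: "(\<Sum>(k, I)\<in>V. F k I) = (\<Sum>J\<in>S'. \<Sum>k\<in>J. F k (J - {k}))"
    for F :: "nat \<Rightarrow> nat set \<Rightarrow> ratfun mfps"
  proof -
    have "(\<Sum>(k, I)\<in>V. F k I) = (\<Sum>(J, k)\<in>Sigma S' (\<lambda>J. J). F k (J - {k}))"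
    proof (rule sum.reindex_bij_witness[where i = "\<lambda>(J, k). (k, J - {k})" and j = "\<lambda>(k, I). (insert k I, k)"])
      fix a assume "a \<in> V"
      then obtain k I where a: "a = (k, I)" "k \<in> ?N" "I \<subseteq> ?N" "card I = r" "k \<notin> I"
        by (auto simp: V_def S_def)
      then have "finite I" using finite_subset by blast
      with a show "(\<lambda>(k, I). (insert k I, k)) a \<in> Sigma S' (\<lambda>J. J)" by (auto simp: S'_def)
      from a show "(\<lambda>(J, k). (k, J - {k})) ((\<lambda>(k, I). (insert k I, k)) a) = a" by auto
      from a show "(case (\<lambda>(k, I). (insert k I, k)) a of (J, k) \<Rightarrow> F k (J - {k})) = (case a of (k, I) \<Rightarrow> F k I)" by simp
    next
      fix b assume "b \<in> Sigma S' (\<lambda>J. J)"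
      then obtain J k where b: "b = (J, k)" "J \<in> S'" "k \<in> J" by auto
      with finJ[OF b(2)] show "(\<lambda>(J, k). (k, J - {k})) b \<in> V" by (auto simp: V_def S_def S'_def)
      from b show "(\<lambda>(k, I). (insert k I, k)) ((\<lambda>(J, k). (k, J - {k})) b) = b" by auto
    qed
    also have "\<dots> = (\<Sum>J\<in>S'. \<Sum>k\<in>J. F k (J - {k}))"
      using finS' finJ by (subst sum.Sigma) auto
    finally show ?thesis .
  qed
  have com: "f k (J - {k}) = mfps_const (sscale n t J) * qact q J \<phi> * (Dcoeff n t {k} * qact q {k} (Dcoeff n t (J - {k})))"
    "g k (J - {k}) = mfps_const (sscale n t J) * qact q J \<phi> * (Dcoeff n t (J - {k}) * qact q (J - {k}) (Dcoeff n t {k}))"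
    if J: "J \<in> S'" and k: "k \<in> J" for k J
  proof -
    have a: "qact q {k} (qact q (J - {k}) \<phi>) = qact q J \<phi>"
      using qact_Un[of "{k}" "J - {k}" q \<phi>] finJ[OF J] k by (simp add: insert_absorb)
    have s: "sscale n t {k} * sscale n t (J - {k}) = sscale n t J"
      unfolding sscale_def prod.remove[OF finJ[OF J] k] by simp
    have b: "mfps_const (sscale n t {k}) * mfps_const (sscale n t (J - {k})) = mfps_const (sscale n t J)"
      by (simp add: mfps_monom_mult s)
    show "f k (J - {k}) = mfps_const (sscale n t J) * qact q J \<phi> * (Dcoeff n t {k} * qact q {k} (Dcoeff n t (J - {k})))"
      "g k (J - {k}) = mfps_const (sscale n t J) * qact q J \<phi> * (Dcoeff n t (J - {k}) * qact q (J - {k}) (Dcoeff n t {k}))"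
      unfolding f_def g_def a b by (simp_all add: mult_ac)
  qed
  have "(\<Sum>(k, I)\<in>V. f k I) = (\<Sum>(k, I)\<in>V. g k I)"
    unfolding V
  proof (rule sum.cong)
    fix J assume J: "J \<in> S'"
    then have "J \<subseteq> ?N" by (simp add: S'_def)
    then show "(\<Sum>k\<in>J. f k (J - {k})) = (\<Sum>k\<in>J. g k (J - {k}))"
      using com[OF J] Dcoeff_shift_sum[of J n q t] q0 q1
      by (simp add: sum_distrib_left[symmetric] cong: sum.cong)
  qed simp
  with U show ?thesis unfolding 1 2 split by simp
qed

section \<open>Eigenvalue equations for single operators and their leading terms\<close>

section \<open>Elementary symmetric functions\<close>

definition esym :: "'i set \<Rightarrow> ('i \<Rightarrow> 'a::comm_ring_1) \<Rightarrow> nat \<Rightarrow> 'a"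
  where "esym N y r = (\<Sum>I | I \<subseteq> N \<and> card I = r. \<Prod>i\<in>I. y i)"

text \<open>Vieta's formula. At x = 1 it expands the eigenvalue polynomial in u; at x = s_j / s_1 it
  combines the n equations.\<close>

lemma prod_minus_esym:
  fixes x :: "'a::comm_ring_1"
  assumes "finite N"
  shows "(\<Prod>i\<in>N. x - y i) = (\<Sum>r\<le>card N. (- 1) ^ r * x ^ (card N - r) * esym N y r)"
proof -
  have "(\<Prod>i\<in>N. - y i + x) = (\<Sum>I\<in>Pow N. (\<Prod>i\<in>I. - y i) * (\<Prod>i\<in>N - I. x))"
    by (rule prod_add[OF assms])
  also have "\<dots> = (\<Sum>I\<in>Pow N. (- 1) ^ card I * x ^ (card N - card I) * (\<Prod>i\<in>I. y i))"
    by (rule sum.cong)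
      (auto simp: prod_uminus card_Diff_subset finite_subset[OF _ assms] mult_ac)
  also have "\<dots> = (\<Sum>r\<le>card N. \<Sum>I\<in>{I \<in> Pow N. card I = r}. (- 1) ^ card I * x ^ (card N - card I) * (\<Prod>i\<in>I. y i))"
    by (rule sum.group[symmetric]) (use assms in \<open>auto intro: card_mono\<close>)
  also have "\<dots> = (\<Sum>r\<le>card N. (- 1) ^ r * x ^ (card N - r) * esym N y r)"
    by (rule sum.cong) (auto simp: esym_def sum_distrib_left Pow_def)
  finally show ?thesis by simp
qed

lemma esym_scale: "esym N (\<lambda>i. u * y i) r = u ^ r * esym N y r"
  unfolding esym_def sum_distrib_left
  by (rule sum.cong) (auto simp: prod.distrib)

lemma (in comm_ring_hom) hom_esym: "h (esym N y r) = esym N (\<lambda>i. h (y i)) r"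
  by (simp add: esym_def hom_sum hom_prod)

lemma upar_power: "upar ^ r = monom 1 r"
  by (simp add: upar_def monom_altdef)

lemma pCons_hom: "comm_ring_hom (\<lambda>c. [:c:])"
  by unfold_locales simp_all

text \<open>Comparison of the coefficients of u^r: both sides have degree at most n in u, and the
  common sign (-1)^r is invertible.\<close>

lemma joint_eigenfunction_iff:
  "joint_eigenfunction n q t \<phi> \<longleftrightarrow>
    (\<forall>r\<le>n. macdonald_D n q t r \<phi> = mfps_const (esym {1..n} svar r) * \<phi>)"
proof -
  define e where "e r = mfps_const (esym {1..n} svar r)" for r
  have sgn: "(- 1) ^ r * f = (- 1) ^ r * g \<longleftrightarrow> f = g" for r and f g :: "ratfun mfps"
  proof -
    have "(- 1) ^ r * ((- 1) ^ r * h) = h" for h :: "ratfun mfps"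
      by (simp add: mult.assoc[symmetric] power_mult_distrib[symmetric])
    then show ?thesis by metis
  qed
  have mon: "(- upar) ^ r * [:f:] = monom ((- 1) ^ r * f) r" for r f
  proof -
    have "(- upar) ^ r = smult ((- 1) ^ r) (monom 1 r)"
      by (simp add: power_minus[of upar] upar_power minus_one_power_iff)
    then show ?thesis by (simp add: smult_monom mult_monom flip: monom_0)
  qed
  have L: "coeff (macdonald_Du n q t \<phi>) k = (if k \<le> n then (- 1) ^ k * macdonald_D n q t k \<phi> else 0)" for k
    unfolding macdonald_Du_def mon by (simp add: coeff_sum)
  have "(\<Prod>i = 1..n. 1 - upar * [:mfps_const (svar i):]) =
      (\<Sum>r\<le>n. (- 1) ^ r * esym {1..n} (\<lambda>i. upar * [:mfps_const (svar i):]) r)"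
    by (subst prod_minus_esym) simp_all
  also have "\<dots> = (\<Sum>r\<le>n. (- upar) ^ r * [:e r:])"
    unfolding esym_scale e_def
    by (simp add: comm_ring_hom.hom_esym[OF mfps_const_hom] comm_ring_hom.hom_esym[OF pCons_hom]
        power_minus[of upar] mult_ac)
  finally have "[:\<phi>:] * (\<Prod>i = 1..n. 1 - upar * [:mfps_const (svar i):]) = (\<Sum>r\<le>n. (- upar) ^ r * [:e r * \<phi>:])"
    by (simp add: sum_distrib_left mult_ac)
  then have R: "coeff ([:\<phi>:] * (\<Prod>i = 1..n. 1 - upar * [:mfps_const (svar i):])) k =
      (if k \<le> n then (- 1) ^ k * (e k * \<phi>) else 0)" for k
    unfolding mon by (simp add: coeff_sum)
  show ?thesis
    unfolding joint_eigenfunction_def poly_eq_iff L R using sgn by (auto simp: e_def)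
qed

section \<open>The triangular form of the operators\<close>

lemma Qplus_0 [simp]: "0 \<in> Qplus n"
  by (simp add: Qplus_def)

lemma keys_add_nat: "keys (a + b :: 'a \<Rightarrow>\<^sub>0 nat) = keys a \<union> keys b"
  by (auto simp: in_keys_iff lookup_add)

lemma Qplus_add_iff [simp]: "a + b \<in> Qplus n \<longleftrightarrow> a \<in> Qplus n \<and> b \<in> Qplus n"
  by (auto simp: Qplus_def keys_add_nat)

lemma root_multiple_0 [simp]: "root_multiple i j 0 = 0"
  by (rule poly_mapping_eqI) (simp add: lookup_root_multiple)

lemma keys_root_multiple: "keys (root_multiple i j k) = (if k = 0 then {} else {i..<j})"
  by (auto simp: in_keys_iff lookup_root_multiple split: if_splits)

lemma root_multiple_Qplus: "1 \<le> i \<Longrightarrow> j \<le> n \<Longrightarrow> root_multiple i j k \<in> Qplus n"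
  by (auto simp: Qplus_def keys_root_multiple)

lemma root_multiple_eq_0_iff: "i < j \<Longrightarrow> root_multiple i j k = 0 \<longleftrightarrow> k = 0"
  using keys_root_multiple[of i j k] by (auto split: if_splits)

text \<open>The expanded coefficients of D_r do not involve s; therefore they contribute no poles to
  the recursion.\<close>

definition const_series :: "nat \<Rightarrow> ratfun mfps set"
  where "const_series n = {F. \<forall>m. mfps_nth F m \<in> range ratconst \<and> (m \<notin> Qplus n \<longrightarrow> mfps_nth F m = 0)}"

lemma range_ratconst_add: "x \<in> range ratconst \<Longrightarrow> y \<in> range ratconst \<Longrightarrow> x + y \<in> range ratconst"
  by (auto simp flip: ratconst_simps)

lemma range_ratconst_diff: "x \<in> range ratconst \<Longrightarrow> y \<in> range ratconst \<Longrightarrow> x - y \<in> range ratconst"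
  by (auto simp flip: ratconst_simps)

lemma range_ratconst_mult: "x \<in> range ratconst \<Longrightarrow> y \<in> range ratconst \<Longrightarrow> x * y \<in> range ratconst"
  by (auto simp flip: ratconst_simps)

lemma range_ratconst_0_1 [simp]: "0 \<in> range ratconst" "1 \<in> range ratconst"
  by (metis ratconst_0 rangeI, metis ratconst_1 rangeI)

lemma range_ratconst_sum: "(\<And>i. i \<in> A \<Longrightarrow> f i \<in> range ratconst) \<Longrightarrow> (\<Sum>i\<in>A. f i) \<in> range ratconst"
  by (induction A rule: infinite_finite_induct) (auto intro: range_ratconst_add)

lemma range_ratconst_prod: "(\<And>i. i \<in> A \<Longrightarrow> f i \<in> range ratconst) \<Longrightarrow> (\<Prod>i\<in>A. f i) \<in> range ratconst"
  by (induction A rule: infinite_finite_induct) (auto intro: range_ratconst_mult)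

lemma const_series_diff: "f \<in> const_series n \<Longrightarrow> g \<in> const_series n \<Longrightarrow> f - g \<in> const_series n"
  by (auto simp: const_series_def intro: range_ratconst_diff)

lemma const_series_1: "1 \<in> const_series n"
  by (auto simp: const_series_def mfps_nth_one)

lemma const_series_const: "mfps_const (ratconst c) \<in> const_series n"
  by (auto simp: const_series_def mfps_nth_monom)

lemma const_series_mult:
  assumes "f \<in> const_series n" "g \<in> const_series n"
  shows "f * g \<in> const_series n"
  unfolding const_series_def mem_Collect_eq
proof (intro allI conjI impI)
  fix m
  show "mfps_nth (f * g) m \<in> range ratconst"
    unfolding mfps_nth_mult using assms
    by (intro range_ratconst_sum) (auto simp: const_series_def simp del: image_iff intro: range_ratconst_mult)
  assume m: "m \<notin> Qplus n"
  show "mfps_nth (f * g) m = 0"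
    unfolding mfps_nth_mult
  proof (rule sum.neutral, clarify)
    fix a b assume "(a, b) \<in> splits m"
    then have "a \<notin> Qplus n \<or> b \<notin> Qplus n" using m by (auto simp: splits_def)
    then show "mfps_nth f a * mfps_nth g b = 0" using assms by (auto simp: const_series_def)
  qed
qed

lemma const_series_prod: "(\<And>i. i \<in> A \<Longrightarrow> f i \<in> const_series n) \<Longrightarrow> (\<Prod>i\<in>A. f i) \<in> const_series n"
  by (induction A rule: infinite_finite_induct) (auto intro: const_series_mult const_series_1)

lemma const_series_D_factor:
  assumes "i \<in> {1..n}" "j \<in> {1..n}"
  shows "D_factor t i j \<in> const_series n"
proof -
  have "xratio i j \<in> const_series n" "xgeom i j \<in> const_series n"
    if "i \<in> {1..n}" "j \<in> {1..n}" for i j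
    using that by (auto simp: const_series_def xratio_def xgeom_def mfps_nth_monom root_multiple_Qplus)
  with assms show ?thesis
    by (auto simp: D_factor_def intro!: const_series_mult const_series_diff const_series_1 const_series_const)
qed

lemma const_series_Dcoeff: "I \<subseteq> {1..n} \<Longrightarrow> Dcoeff n t I \<in> const_series n"
  unfolding Dcoeff_def by (intro const_series_prod const_series_D_factor) auto

lemma D_factor_0:
  assumes "i \<noteq> j"
  shows "mfps_nth (D_factor t i j) 0 = ratconst (if i < j then t else 1)"
proof -
  have "mfps_nth (xratio i j) 0 = (0::ratfun)" if "i < j" for i j
    using root_multiple_eq_0_iff[OF that, of 1] by (simp add: xratio_def mfps_nth_monom)
  moreover have "mfps_nth (xgeom i j) 0 = (1::ratfun)" for i j
    by (auto simp: xgeom_def intro: exI[of _ 0])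
  ultimately show ?thesis
    using assms by (simp add: D_factor_def comm_ring_hom.hom_simps[OF mfps_nth_0_hom] mfps_nth_monom del: mfps_nth_const_mult)
qed

text \<open>Both sides count the pairs i < j in \<open>I\<close>; the induction inserts a new
  maximum, which forms a pair with each older element.\<close>

lemma sum_card_greater:
  fixes I :: "nat set"
  assumes "finite I"
  shows "(\<Sum>i\<in>I. card {j \<in> I. i < j}) = card I choose 2"
  using assms
proof (induction I rule: finite_linorder_max_induct)
  case empty
  then show ?case by simp
next
  case (insert b A)
  have b: "b \<notin> A" using insert.hyps by auto
  have "{j \<in> insert b A. b < j} = {}" using insert.hyps by auto
  moreover have "card {j \<in> insert b A. i < j} = Suc (card {j \<in> A. i < j})" if "i \<in> A" for i
  proof -
    have "{j \<in> insert b A. i < j} = insert b {j \<in> A. i < j}" using insert.hyps that by auto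
    then show ?thesis using insert.hyps b by simp
  qed
  ultimately have "(\<Sum>i\<in>insert b A. card {j \<in> insert b A. i < j}) = (card A choose 2) + card A"
    using b insert by (simp add: sum_Suc)
  also have "\<dots> = card (insert b A) choose 2"
    using b insert.hyps by (simp add: numeral_2_eq_2)
  finally show ?case .
qed

text \<open>The powers of t cancel. The initial coefficient gives one t for each pair i < j with i
  in I and j outside, and t^(r choose 2) gives one for each pair inside I. Together this is t^(n -
  i) for each i in I, against t^(i - n) from x^\<lambda>.\<close>

lemma Dcoeff_0:
  assumes "I \<subseteq> {1..n}" "t \<noteq> 0"
  shows "ratconst (t ^ (card I choose 2)) * (\<Prod>i\<in>I. ratconst (t powi (int i - int n))) * mfps_nth (Dcoeff n t I) 0 = 1"
proof -
  have fin: "finite I" using assms finite_subset by blast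
  define c where "c i = card {j \<in> {1..n} - I. i < j}" for i
  have "mfps_nth (Dcoeff n t I) 0 = (\<Prod>i\<in>I. \<Prod>j\<in>{1..n} - I. ratconst (if i < j then t else 1))"
    unfolding Dcoeff_def comm_ring_hom.hom_prod[OF mfps_nth_0_hom]
    by (intro prod.cong refl D_factor_0) auto
  also have "\<dots> = ratconst (\<Prod>i\<in>I. \<Prod>j\<in>{1..n} - I. if i < j then t else 1)"
    by (simp add: ratconst_simps)
  also have "(\<Prod>i\<in>I. \<Prod>j\<in>{1..n} - I. if i < j then t else 1) = (\<Prod>i\<in>I. t ^ c i)"
    by (simp add: prod.If_cases c_def Int_def)
  also have "\<dots> = t ^ (\<Sum>i\<in>I. c i)" by (simp add: power_sum)
  finally have D: "mfps_nth (Dcoeff n t I) 0 = ratconst (t ^ (\<Sum>i\<in>I. c i))" .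
  have "c i + card {j \<in> I. i < j} = n - i" if "i \<in> I" for i
  proof -
    have "c i + card {j \<in> I. i < j} = card ({j \<in> {1..n} - I. i < j} \<union> {j \<in> I. i < j})"
      unfolding c_def using fin by (subst card_Un_disjoint) auto
    also have "{j \<in> {1..n} - I. i < j} \<union> {j \<in> I. i < j} = {i<..n}" using assms by auto
    finally show ?thesis by simp
  qed
  then have e: "(\<Sum>i\<in>I. c i) + (card I choose 2) = (\<Sum>i\<in>I. n - i)"
    by (simp add: sum_card_greater[OF fin, symmetric] sum.distrib[symmetric])
  have P: "(\<Prod>i\<in>I. t powi (int i - int n)) * t ^ (\<Sum>i\<in>I. n - i) = 1"
  proof -
    have "t powi (int i - int n) * t ^ (n - i) = 1" if "i \<in> I" for i
    proof -
      have "i \<le> n" using that assms by auto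
      then have z: "int i - int n + int (n - i) = 0" by simp
      have "t powi (int i - int n) * t ^ (n - i) = t powi (int i - int n) * t powi (int (n - i))"
        by (simp only: power_int_of_nat)
      also have "\<dots> = t powi ((int i - int n) + int (n - i))"
        using assms(2) by (intro power_int_add[symmetric]) simp
      also have "\<dots> = 1" unfolding z by simp
      finally show ?thesis .
    qed
    then show ?thesis by (simp add: power_sum prod.distrib[symmetric])
  qed
  have "t ^ (card I choose 2) * (\<Prod>i\<in>I. t powi (int i - int n)) * t ^ (\<Sum>i\<in>I. c i) =
      (\<Prod>i\<in>I. t powi (int i - int n)) * t ^ ((\<Sum>i\<in>I. c i) + (card I choose 2))"
    by (simp add: power_add mult_ac)
  also have "\<dots> = 1" unfolding e by (rule P)
  finally have "ratconst (t ^ (card I choose 2) * (\<Prod>i\<in>I. t powi (int i - int n)) * t ^ (\<Sum>i\<in>I. c i)) = 1"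
    by simp
  then show ?thesis unfolding D by (simp only: ratconst_simps)
qed

text \<open>All powers of t are absorbed, so that the value at 0 is 1. The chosen number is unique
  because \<open>ratconst\<close> is injective.\<close>

definition Kcoeff :: "nat \<Rightarrow> complex \<Rightarrow> nat set \<Rightarrow> (nat \<Rightarrow>\<^sub>0 nat) \<Rightarrow> complex"
  where "Kcoeff n t I a = (SOME c. ratconst c =
    ratconst (t ^ (card I choose 2)) * (\<Prod>i\<in>I. ratconst (t powi (int i - int n))) * mfps_nth (Dcoeff n t I) a)"

lemma ratconst_Kcoeff:
  assumes "I \<subseteq> {1..n}"
  shows "ratconst (Kcoeff n t I a) =
    ratconst (t ^ (card I choose 2)) * (\<Prod>i\<in>I. ratconst (t powi (int i - int n))) * mfps_nth (Dcoeff n t I) a"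
proof -
  have "mfps_nth (Dcoeff n t I) a \<in> range ratconst"
    using const_series_Dcoeff[OF assms] by (auto simp: const_series_def)
  then have "ratconst (t ^ (card I choose 2)) * (\<Prod>i\<in>I. ratconst (t powi (int i - int n))) * mfps_nth (Dcoeff n t I) a \<in> range ratconst"
    by (intro range_ratconst_mult range_ratconst_prod) auto
  then show ?thesis unfolding Kcoeff_def by (intro someI_ex[of "\<lambda>c. ratconst c = _"]) (auto simp: image_iff)
qed

lemma Kcoeff_0:
  assumes "I \<subseteq> {1..n}" "t \<noteq> 0"
  shows "Kcoeff n t I 0 = 1"
  using ratconst_Kcoeff[OF assms(1), of t 0] Dcoeff_0[OF assms] ratconst_eq_iff[of _ 1] by simp

lemma Kcoeff_notin:
  assumes "I \<subseteq> {1..n}" "a \<notin> Qplus n"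
  shows "Kcoeff n t I a = 0"
  using ratconst_Kcoeff[OF assms(1), of t a] const_series_Dcoeff[OF assms(1), of t] assms(2)
  by (simp add: const_series_def)

text \<open>The eigenvalue of \<open>D\<^sub>r\<close> on the leading term at \<open>\<mu>\<close>: \<open>e\<^sub>r\<close> in the variables \<open>q^(-\<mu>\<^sub>i) s\<^sub>i\<close>.\<close>

definition qsvar :: "complex \<Rightarrow> (nat \<Rightarrow>\<^sub>0 nat) \<Rightarrow> nat \<Rightarrow> ratfun"
  where "qsvar q m i = ratconst (q powi (- lookup (root_weight m) i)) * svar i"

lemma prod_qsvar: "(\<Prod>i\<in>I. qsvar q m i) = ratconst (qweight q I m) * (\<Prod>i\<in>I. svar i)"
  by (simp add: qsvar_def qweight_def prod.distrib ratconst_simps)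

lemma qsvar_0 [simp]: "qsvar q 0 = svar"
  by (simp add: qsvar_def fun_eq_iff)

definition lower_term :: "nat \<Rightarrow> complex \<Rightarrow> complex \<Rightarrow> nat \<Rightarrow> ((nat \<Rightarrow>\<^sub>0 nat) \<Rightarrow> ratfun) \<Rightarrow> (nat \<Rightarrow>\<^sub>0 nat) \<Rightarrow> ratfun"
  where "lower_term n q t r f m = (\<Sum>p\<in>splits m - {(0, m)}. \<Sum>I | I \<subseteq> {1..n} \<and> card I = r.
    ratconst (Kcoeff n t I (fst p) * qweight q I (snd p)) * (\<Prod>i\<in>I. svar i) * f (snd p))"

lemma macdonald_D_nth:
  assumes "t \<noteq> 0"
  shows "mfps_nth (macdonald_D n q t r \<phi>) m =
    esym {1..n} (qsvar q m) r * mfps_nth \<phi> m + lower_term n q t r (mfps_nth \<phi>) m"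
proof -
  let ?S = "{I. I \<subseteq> {1..n} \<and> card I = r}"
  let ?T = "\<lambda>p I. ratconst (Kcoeff n t I (fst p) * qweight q I (snd p)) * (\<Prod>i\<in>I. svar i) * mfps_nth \<phi> (snd p)"
  have "mfps_nth (macdonald_D n q t r \<phi>) m = (\<Sum>I\<in>?S. \<Sum>p\<in>splits m. ?T p I)"
    unfolding macdonald_D_eq Dop_def mfps_nth_const_mult mfps_nth_sum sum_distrib_left
  proof (rule sum.cong)
    fix I assume "I \<in> ?S"
    then have I: "I \<subseteq> {1..n}" "card I = r" by auto
    show "ratconst (t ^ (r choose 2)) * (sscale n t I * mfps_nth (Dcoeff n t I * qact q I \<phi>) m) = (\<Sum>p\<in>splits m. ?T p I)"
      unfolding mfps_nth_mult mfps_nth_qact sum_distrib_left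
      by (rule sum.cong)
        (auto simp: ratconst_simps(4) ratconst_Kcoeff[OF I(1)] I(2) sscale_def prod.distrib mult_ac)
  qed simp
  also have "\<dots> = (\<Sum>p\<in>splits m. \<Sum>I\<in>?S. ?T p I)" by (rule sum.swap)
  also have "\<dots> = (\<Sum>I\<in>?S. ?T (0, m) I) + (\<Sum>p\<in>splits m - {(0, m)}. \<Sum>I\<in>?S. ?T p I)"
    by (rule sum.remove) (auto simp: splits_iff)
  also have "(\<Sum>I\<in>?S. ?T (0, m) I) = esym {1..n} (qsvar q m) r * mfps_nth \<phi> m"
    unfolding esym_def sum_distrib_right
    by (rule sum.cong) (auto simp: Kcoeff_0[OF _ assms] prod_qsvar)
  finally show ?thesis unfolding lower_term_def .
qed

lemma lower_term_notin:
  assumes "\<And>m. m \<notin> Qplus n \<Longrightarrow> f m = 0" "m \<notin> Qplus n"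
  shows "lower_term n q t r f m = 0"
  unfolding lower_term_def
proof (intro sum.neutral ballI)
  fix p I assume p: "p \<in> splits m - {(0, m)}" and I: "I \<in> {I. I \<subseteq> {1..n} \<and> card I = r}"
  from p have "fst p + snd p = m" by (auto simp: splits_def)
  with assms(2) have "fst p \<notin> Qplus n \<or> snd p \<notin> Qplus n" by (metis Qplus_add_iff)
  then show "ratconst (Kcoeff n t I (fst p) * qweight q I (snd p)) * (\<Prod>i\<in>I. svar i) * f (snd p) = 0"
    using Kcoeff_notin[of I n "fst p" t] assms(1)[of "snd p"] I by auto
qed

definition tdeg :: "(nat \<Rightarrow>\<^sub>0 nat) \<Rightarrow> nat"
  where "tdeg m = (\<Sum>a\<in>keys m. lookup m a)"

lemma tdeg_add: "tdeg (a + b) = tdeg a + tdeg b"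
proof -
  have e: "tdeg m = (\<Sum>k\<in>A. lookup m k)" if "finite A" "keys m \<subseteq> A" for A m
    unfolding tdeg_def using that by (intro sum.mono_neutral_left) (auto simp: in_keys_iff)
  show ?thesis
    using e[of "keys a \<union> keys b" a] e[of "keys a \<union> keys b" b] e[of "keys a \<union> keys b" "a + b"]
    by (simp add: keys_add_nat lookup_add sum.distrib)
qed

lemma tdeg_eq_0_iff: "tdeg m = 0 \<longleftrightarrow> m = 0"
  by (auto simp: tdeg_def in_keys_iff intro!: poly_mapping_eqI)

lemma tdeg_splits:
  assumes "p \<in> splits m - {(0, m)}"
  shows "tdeg (snd p) < tdeg m"
proof -
  obtain a b where p: "p = (a, b)" by fastforce
  with assms have m: "m = a + b" and "a \<noteq> 0" by (auto simp: splits_def)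
  then have "tdeg a > 0" using tdeg_eq_0_iff[of a] by simp
  then show ?thesis by (simp add: p m tdeg_add)
qed

section \<open>The normalised eigenfunction and its uniqueness\<close>

section \<open>Existence and uniqueness for the first operator\<close>

locale macdonald =
  fixes n :: nat and q t :: complex
  assumes q0: "q \<noteq> 0" and t0: "t \<noteq> 0" and q_less: "norm q < 1"
begin

lemma q_neq_1: "q \<noteq> 1"
  using q_less by auto

text \<open>From |q| < 1 it follows that q is not a root of unity; this is what separates the
  eigenvalues.\<close>

lemma q_powi_eq_1_iff [simp]: "q powi k = 1 \<longleftrightarrow> k = 0"
proof
  have pos: "q ^ j \<noteq> 1" if "j > 0" for j
    using power_strict_decreasing[OF that, of "norm q"] q_less q0
    by (metis norm_one norm_power power_0 less_irrefl zero_less_norm_iff)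
  assume "q powi k = 1"
  then have "q ^ nat \<bar>k\<bar> = 1"
    by (auto simp: power_int_def power_inverse split: if_splits)
  then show "k = 0" using pos[of "nat \<bar>k\<bar>"] by auto
qed simp

lemma q_powi_eq_iff: "q powi k = q powi l \<longleftrightarrow> k = l"
proof
  assume "q powi k = q powi l"
  then have "q powi (k - l) = 1" using q0 by (simp add: power_int_diff)
  then show "k = l" by simp
qed simp

lemma sum_svar_eq_0:
  assumes "finite A" "(\<Sum>i\<in>A. ratconst (c i) * svar i) = 0" "i \<in> A"
  shows "c i = 0"
proof -
  have "(\<Sum>i\<in>A. ratconst (c i) * svar i) = Fract (\<Sum>i\<in>A. single (single i 1) (c i)) 1"
    by (simp add: ratconst_def svar_def mult_single comm_ring_hom.hom_simps[OF fract_hom])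
  then have "(\<Sum>i\<in>A. single (single i 1) (c i)) = (0 :: mpolynomial)" using assms(2) by simp
  then have "lookup (\<Sum>i\<in>A. single (single i 1) (c i) :: mpolynomial) (single i 1) = 0"
    by (simp only: lookup_zero)
  moreover have "lookup (\<Sum>i\<in>A. single (single i 1) (c i) :: mpolynomial) (single i 1) = (\<Sum>j\<in>A. if j = i then c i else 0)"
    unfolding lookup_sum lookup_single when_def by (rule sum.cong) (auto simp: single_eq_iff)
  ultimately show ?thesis using assms(1,3) by simp
qed

lemma root_weight_nonzero:
  assumes "m \<in> Qplus n" "m \<noteq> 0"
  obtains i where "i \<in> {1..n}" "lookup (root_weight m) i \<noteq> 0"
proof -
  \<comment> \<open>At the smallest index of the support the weight m_i - m_(i-1) reduces to
    m_i.\<close>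
  let ?i = "Min (keys m)"
  have ne: "keys m \<noteq> {}" using assms(2) by (metis poly_mapping_eqI lookup_zero ex_in_conv in_keys_iff)
  then have i: "?i \<in> keys m" by simp
  then have r: "?i \<in> {1..<n}" using assms(1) by (auto simp: Qplus_def)
  then obtain k where k: "?i = Suc k" by (cases "?i") auto
  have "k \<notin> keys m" using k Min_le[of "keys m" k] by auto
  then have "lookup (root_weight m) ?i = int (lookup m ?i)"
    unfolding k by (simp add: lookup_root_weight_Suc in_keys_iff)
  moreover have "lookup m ?i \<noteq> 0" using i by (simp add: in_keys_iff)
  ultimately show thesis using that[of ?i] r by auto
qed

lemma esym_1: "esym {1..n} y 1 = (\<Sum>i\<in>{1..n}. y i)" for y :: "nat \<Rightarrow> 'a::comm_ring_1"
  unfolding esym_def card_1_subsets by (simp add: sum.reindex)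

lemma eigenvalue_1_neq:
  assumes "m \<in> Qplus n" "m \<noteq> 0"
  shows "esym {1..n} (qsvar q m) 1 \<noteq> esym {1..n} svar 1"
proof
  obtain i where i: "i \<in> {1..n}" "lookup (root_weight m) i \<noteq> 0" by (rule root_weight_nonzero[OF assms])
  assume "esym {1..n} (qsvar q m) 1 = esym {1..n} svar 1"
  then have "(\<Sum>i\<in>{1..n}. ratconst (q powi (- lookup (root_weight m) i) - 1) * svar i) = 0"
    unfolding esym_1 by (simp add: qsvar_def ratconst_simps left_diff_distrib sum_subtractf)
  then have "q powi (- lookup (root_weight m) i) - 1 = 0" by (rule sum_svar_eq_0[rotated]) (use i in auto)
  with i(2) show False by simp
qed

lemma D1_eigen_unique:
  assumes supp: "\<And>m. m \<notin> Qplus n \<Longrightarrow> mfps_nth \<psi> m = 0" and z: "mfps_nth \<psi> 0 = 0"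
    and eig: "macdonald_D n q t 1 \<psi> = mfps_const (esym {1..n} svar 1) * \<psi>"
  shows "\<psi> = 0"
proof (rule mfps_eqI)
  fix m
  show "mfps_nth \<psi> m = mfps_nth 0 m"
  proof (induction m rule: measure_induct_rule[where f = tdeg])
    case (less m)
    show ?case
    proof (cases "m \<in> Qplus n \<and> m \<noteq> 0")
      case True
      have "lower_term n q t 1 (mfps_nth \<psi>) m = 0"
        unfolding lower_term_def using less.IH[OF tdeg_splits] by (intro sum.neutral ballI) simp
      then have "esym {1..n} (qsvar q m) 1 * mfps_nth \<psi> m = esym {1..n} svar 1 * mfps_nth \<psi> m"
        using arg_cong[OF eig, of "\<lambda>f. mfps_nth f m"] unfolding macdonald_D_nth[OF t0] by simp
      then show ?thesis using eigenvalue_1_neq True by auto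
    qed (use supp z in auto)
  qed
qed

text \<open>The equation of D_1 at \<mu>, solved for the coefficient. \<open>lower_term\<close> is
  written out so that the recursive calls at \<open>snd p\<close>, of smaller degree, are
  visible.\<close>

function phi :: "(nat \<Rightarrow>\<^sub>0 nat) \<Rightarrow> ratfun" where
  "phi m = (if m = 0 then 1 else if m \<notin> Qplus n then 0 else
    (\<Sum>p\<in>splits m - {(0, m)}. \<Sum>I | I \<subseteq> {1..n} \<and> card I = 1.
      ratconst (Kcoeff n t I (fst p) * qweight q I (snd p)) * (\<Prod>i\<in>I. svar i) * phi (snd p))
    / (esym {1..n} svar 1 - esym {1..n} (qsvar q m) 1))"
  by auto
termination by (relation "measure tdeg") (simp_all only: wf_measure in_measure tdeg_splits)

declare phi.simps [simp del]

lemma phi_0 [simp]: "phi 0 = 1" and phi_notin: "m \<notin> Qplus n \<Longrightarrow> phi m = 0"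
  by (auto simp: phi.simps)

lemma phi_eq: "m \<in> Qplus n \<Longrightarrow> m \<noteq> 0 \<Longrightarrow>
    phi m = lower_term n q t 1 phi m / (esym {1..n} svar 1 - esym {1..n} (qsvar q m) 1)"
  by (subst phi.simps) (simp add: lower_term_def)

definition Phi :: "ratfun mfps" where "Phi = Abs_mfps phi"

lemma mfps_nth_Phi [simp]: "mfps_nth Phi = phi"
  by (simp add: Phi_def)

lemma splits_0: "splits 0 - {(0, 0)} = {}"
  using tdeg_splits[of _ 0] by (auto simp: tdeg_def)

lemma D1_Phi: "macdonald_D n q t 1 Phi = mfps_const (esym {1..n} svar 1) * Phi"
proof (rule mfps_eqI)
  fix m
  consider "m = 0" | "m \<notin> Qplus n" | "m \<in> Qplus n" "m \<noteq> 0" by blast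
  then show "mfps_nth (macdonald_D n q t 1 Phi) m = mfps_nth (mfps_const (esym {1..n} svar 1) * Phi) m"
  proof cases
    case 1
    then show ?thesis unfolding macdonald_D_nth[OF t0] by (simp add: lower_term_def splits_0)
  next
    case 2
    then show ?thesis unfolding macdonald_D_nth[OF t0] using lower_term_notin[of n phi m] by (simp add: phi_notin)
  next
    case 3
    then have "phi m * (esym {1..n} svar 1 - esym {1..n} (qsvar q m) 1) = lower_term n q t 1 phi m"
      using eigenvalue_1_neq[OF 3] phi_eq[OF 3] by simp
    then show ?thesis unfolding macdonald_D_nth[OF t0] mfps_nth_const_mult by (simp add: algebra_simps)
  qed
qed

lemma Dop_linear:
  "Dop n q t r (f - g) = Dop n q t r f - Dop n q t r g"
  "Dop n q t r (mfps_const c * f) = mfps_const c * Dop n q t r f"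
  unfolding Dop_def comm_ring_hom.hom_simps[OF qact_hom[OF q0]] qact_const
  by (simp_all add: right_diff_distrib sum_subtractf sum_distrib_left mult_ac)

lemma macdonald_D_linear:
  "macdonald_D n q t r (f - g) = macdonald_D n q t r f - macdonald_D n q t r g"
  "macdonald_D n q t r (mfps_const c * f) = mfps_const c * macdonald_D n q t r f"
  unfolding macdonald_D_eq Dop_linear by (simp_all add: right_diff_distrib mult_ac)

lemma macdonald_D_commute:
  "macdonald_D n q t 1 (macdonald_D n q t r f) = macdonald_D n q t r (macdonald_D n q t 1 f)"
  unfolding macdonald_D_eq Dop_linear by (simp add: Dop_commute[OF q0 q_neq_1, unfolded One_nat_def] mult_ac)

lemma Dr_Phi: "macdonald_D n q t r Phi = mfps_const (esym {1..n} svar r) * Phi"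
proof -
  let ?e = "\<lambda>r. mfps_const (esym {1..n} svar r)"
  define \<psi> where "\<psi> = macdonald_D n q t r Phi - ?e r * Phi"
  have "\<psi> = 0"
  proof (rule D1_eigen_unique)
    show "mfps_nth \<psi> m = 0" if "m \<notin> Qplus n" for m
      using that lower_term_notin[of n phi m] unfolding \<psi>_def mfps_nth_diff macdonald_D_nth[OF t0]
      by (simp add: phi_notin)
    \<comment> \<open>At 0 the eigenvalue is e_r(s) itself, and there are no lower terms.\<close>
    show "mfps_nth \<psi> 0 = 0"
      unfolding \<psi>_def mfps_nth_diff macdonald_D_nth[OF t0] by (simp add: lower_term_def splits_0)
    have "macdonald_D n q t 1 (macdonald_D n q t r Phi) = ?e 1 * macdonald_D n q t r Phi"
      unfolding macdonald_D_commute D1_Phi macdonald_D_linear ..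
    then show "macdonald_D n q t 1 \<psi> = ?e 1 * \<psi>"
      unfolding \<psi>_def macdonald_D_linear D1_Phi by (simp add: right_diff_distrib mult_ac)
  qed
  then show ?thesis by (simp add: \<psi>_def)
qed

lemma joint_eigenfunction_Phi: "joint_eigenfunction n q t Phi"
  by (simp add: joint_eigenfunction_iff Dr_Phi)

lemma joint_eigenfunction_unique:
  assumes n1: "1 \<le> n" and "joint_eigenfunction n q t f" "\<And>m. m \<notin> Qplus n \<Longrightarrow> mfps_nth f m = 0" "mfps_nth f 0 = 1"
  shows "f = Phi"
proof -
  have "f - Phi = 0"
  proof (rule D1_eigen_unique)
    \<comment> \<open>The assumption n \<ge> 1 puts r = 1 among the equations of the system.\<close>
    show "macdonald_D n q t 1 (f - Phi) = mfps_const (esym {1..n} svar 1) * (f - Phi)"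
      using assms(2) n1 unfolding macdonald_D_linear D1_Phi joint_eigenfunction_iff
      by (auto simp: right_diff_distrib)
  qed (use assms phi_notin in auto)
  then show ?thesis by simp
qed

end

section \<open>Primality, zero sets and divisibility of the possible denominators\<close>

section \<open>Prime polynomials\<close>

text \<open>The kernel of a homomorphism to a domain is a prime ideal, so its generator is
  prime.\<close>

lemma prime_elem_kernel:
  fixes \<theta> :: "'a::idom \<Rightarrow> 'b::idom"
  assumes "comm_ring_hom \<theta>" and ker: "\<And>x. \<theta> x = 0 \<Longrightarrow> e dvd x" and e: "\<theta> e = 0" "e \<noteq> 0"
  shows "prime_elem e"
proof -
  interpret comm_ring_hom \<theta> by fact
  have z: "\<theta> x = 0" if "e dvd x" for x using that e by (auto simp: hom_mult)
  have "\<not> e dvd 1" using z[of 1] by (auto simp: hom_one)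
  moreover have "e dvd x \<or> e dvd y" if "e dvd x * y" for x y
    using z[OF that] ker by (auto simp: hom_mult)
  ultimately show ?thesis using e(2) by (simp add: prime_elem_def)
qed

lemma prime_elem_dvd_prod:
  assumes "prime_elem p" "finite A" "p dvd prod f A"
  shows "\<exists>a\<in>A. p dvd f a"
  using assms(2,3)
proof (induction A)
  case empty
  then show ?case using assms(1) by (simp add: prime_elem_def)
next
  case (insert a A)
  then show ?case using prime_elem_dvd_multD[OF assms(1)] by auto
qed

text \<open>A prime of the product that does not divide \<open>d\<close> divides the cofactor and
  can be cancelled. Iterating leaves the empty product.\<close>

lemma dvd_prod_primes_unit:
  fixes d :: "'a::idom"
  assumes "finite S" "\<And>e. e \<in> S \<Longrightarrow> prime_elem (p e)" "d dvd (\<Prod>e\<in>S. p e)" "\<And>e. e \<in> S \<Longrightarrow> \<not> p e dvd d"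
  shows "d dvd 1"
  using assms
proof (induction S)
  case (insert e S)
  from insert.prems(2) obtain c where c: "p e * (\<Prod>e\<in>S. p e) = d * c"
    using insert.hyps by (auto simp: dvd_def)
  then have "p e dvd d * c" by (metis dvd_triv_left)
  then have "p e dvd c" using insert.prems by (auto dest: prime_elem_dvd_multD)
  then obtain c' where "c = p e * c'" by blast
  with c have "p e * (\<Prod>e\<in>S. p e) = p e * (d * c')" by (simp add: mult_ac)
  moreover have "p e \<noteq> 0" using insert.prems(1) by (auto simp: prime_elem_def)
  ultimately have "d dvd (\<Prod>e\<in>S. p e)" by auto
  then show ?case using insert.IH insert.prems by auto
qed simp

definition wvar :: "nat \<Rightarrow> mpolynomial"
  where "wvar a = single (single a 1) 1"

lemma monom_eval_wvar: "monom_eval wvar m = single m 1"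
  unfolding wvar_def[abs_def] by (rule monom_eval_vars)

lemma wvar_power: "wvar a ^ k = single (single a k) 1"
  using monom_eval_wvar[of "single a k"] by simp

lemma hom_sum_singles:
  assumes "comm_ring_hom h"
  shows "h P = (\<Sum>m\<in>keys P. h (single m (lookup P m)))"
  by (metis poly_mapping_eq_sum_single comm_ring_hom.hom_sum[OF assms])

text \<open>The constant term is the value at the origin.\<close>

lemma lookup_0_hom: "comm_ring_hom (\<lambda>P :: mpolynomial. lookup P 0)"
proof -
  have m: "monom_eval (\<lambda>_. 0 :: complex) m = (if m = 0 then 1 else 0)" for m
  proof (cases "m = 0")
    case False
    then obtain a where a: "a \<in> keys m"
      by (metis in_keys_iff lookup_zero poly_mapping_eqI)
    then have "(0 :: complex) ^ lookup m a = 0" by (simp add: in_keys_iff)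
    then show ?thesis using a False by (auto simp: monom_eval_def)
  qed simp
  have "poly_eval (\<lambda>x. x) (\<lambda>_. 0) P = lookup P 0" for P
    by (simp add: poly_eval_def m in_keys_iff if_distrib cong: if_cong)
  then have "poly_eval (\<lambda>x. x) (\<lambda>_. 0) = (\<lambda>P :: mpolynomial. lookup P 0)" by (rule ext)
  then show ?thesis using const_hom.poly_eval_hom[OF const_hom_id, of "\<lambda>_. 0"] by metis
qed

text \<open>The map \<theta> sets w_a = 0; each monomial differs from its image by a multiple of
  w_a.\<close>

lemma prime_wvar: "prime_elem (wvar a)"
proof -
  define \<theta> where "\<theta> = poly_eval (single 0) (\<lambda>b. if b = a then 0 else wvar b)"
  interpret comm_ring_hom \<theta>
    unfolding \<theta>_def by (rule const_hom.poly_eval_hom[OF const_hom_single])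
  have s: "\<theta> (single m c) = single 0 c * monom_eval (\<lambda>b. if b = a then 0 else wvar b) m" for m c
    unfolding \<theta>_def by (rule const_hom.poly_eval_single[OF const_hom_single])
  have mono: "wvar a dvd single m c - \<theta> (single m c)" for m c
  proof (cases "a \<in> keys m")
    case True
    define m' where "m' = Poly_Mapping.update a (lookup m a - 1) m"
    have "m = single a 1 + m'"
      using True by (intro poly_mapping_eqI) (auto simp: m'_def lookup_add lookup_update lookup_single when_def in_keys_iff)
    then have "single m c = wvar a * single m' c" by (simp add: wvar_def mult_single)
    moreover have "(\<lambda>b. if b = a then 0 else wvar b) a ^ lookup m a = 0" using True by (simp add: in_keys_iff)
    then have "monom_eval (\<lambda>b. if b = a then 0 else wvar b) m = (0 :: mpolynomial)"
      unfolding monom_eval_def by (intro prod_zero) (use True in auto)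
    ultimately show ?thesis unfolding s by simp
  next
    case False
    then have "monom_eval (\<lambda>b. if b = a then 0 else wvar b) m = monom_eval wvar m"
      unfolding monom_eval_def by (intro prod.cong) auto
    then show ?thesis by (simp add: s monom_eval_wvar mult_single)
  qed
  have "wvar a dvd x" if "\<theta> x = 0" for x
  proof -
    have "x - \<theta> x = (\<Sum>m\<in>keys x. single m (lookup x m) - \<theta> (single m (lookup x m)))"
      using hom_sum_singles[OF comm_ring_hom_axioms, of x] by (simp add: sum_subtractf poly_mapping_eq_sum_single)
    then have "wvar a dvd x - \<theta> x" using mono by (simp add: dvd_sum)
    with that show ?thesis by simp
  qed
  moreover have "\<theta> (wvar a) = 0" unfolding wvar_def s by simp
  moreover have "wvar a \<noteq> 0" by (simp add: wvar_def single_eq_iff[of _ _ 0 0, simplified])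
  ultimately show ?thesis by (intro prime_elem_kernel[OF comm_ring_hom_axioms])
qed

text \<open>The equation \<open>1 - c s\<^sub>b / s\<^sub>a\<close>.\<close>

definition binom_poly :: "nat \<Rightarrow> nat \<Rightarrow> complex \<Rightarrow> mpolynomial"
  where "binom_poly a b c = 1 - single (root_multiple a b 1) c"

lemma pole_equation_eq: "pole_equation q i j k = binom_poly i j (q ^ (k + 1))"
  by (simp add: pole_equation_def binom_poly_def)

lemma lookup_binom_poly_0:
  assumes "a < b"
  shows "lookup (binom_poly a b c) 0 = 1"
  using root_multiple_eq_0_iff[OF assms, of 1]
  by (simp add: binom_poly_def lookup_minus lookup_single when_def)

text \<open>
  Modulo \<open>1 - c w\<^sub>a M\<close> the variable \<open>w\<^sub>a\<close> is inverse to \<open>c M\<close>, so every polynomial is congruent to a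
  power of \<open>w\<^sub>a\<close> times a polynomial without \<open>w\<^sub>a\<close>, on which the substitution is injective.
\<close>

lemma prime_binom_poly:
  assumes ab: "a < b" and c0: "c \<noteq> 0"
  shows "prime_elem (binom_poly a b c)"
proof -
  define e where "e = binom_poly a b c"
  define M where "M = single (root_multiple (Suc a) b 1) c"
  define v where "v l = (if l = a then inverse (Fract M 1) else svar l)" for l
  define \<theta> where "\<theta> = poly_eval ratconst v"
  interpret comm_ring_hom \<theta>
    unfolding \<theta>_def by (rule const_hom.poly_eval_hom[OF const_hom_ratconst])
  have s: "\<theta> (single m c) = ratconst c * monom_eval v m" for m c
    unfolding \<theta>_def by (rule const_hom.poly_eval_single[OF const_hom_ratconst])
  have M0: "M \<noteq> 0" using c0 by (metis M_def lookup_single_eq lookup_zero)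
  have free: "\<theta> (single m c) = Fract (single m c) 1" if "a \<notin> keys m" for m c
  proof -
    have "monom_eval v m = monom_eval svar m"
      unfolding monom_eval_def using that by (intro prod.cong) (auto simp: v_def)
    then show ?thesis by (simp add: s monom_eval_svar ratconst_def mult_single)
  qed
  have "a \<notin> keys (root_multiple (Suc a) b 1)" by (simp add: keys_root_multiple)
  then have \<theta>M: "\<theta> M = Fract M 1" unfolding M_def by (rule free)
  have \<theta>w: "\<theta> (wvar a) = inverse (Fract M 1)" unfolding wvar_def s by (simp add: v_def)
  have wM: "wvar a * M = 1 - e"
  proof -
    have "root_multiple a b 1 = single a 1 + root_multiple (Suc a) b 1"
      using ab by (intro poly_mapping_eqI) (auto simp: lookup_add lookup_single lookup_root_multiple when_def)
    then show ?thesis by (simp add: wvar_def M_def e_def binom_poly_def mult_single)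
  qed
  have "Fract M 1 \<noteq> 0" using M0 by simp
  then have "\<theta> (wvar a) * \<theta> M = 1" unfolding \<theta>w \<theta>M by (rule left_inverse)
  then have \<theta>e: "\<theta> e = 0" using arg_cong[OF wM, of \<theta>] by (simp add: hom_simps)
  have "e dvd x" if x: "\<theta> x = 0" for x
  proof -
    define N where "N = (\<Sum>m\<in>keys x. lookup m a)"
    have N: "lookup m a \<le> N" if "m \<in> keys x" for m
      unfolding N_def using that by (intro member_le_sum) auto
    define r where "r m = Poly_Mapping.update a 0 m" for m :: "nat \<Rightarrow>\<^sub>0 nat"
    have r: "m = single a (lookup m a) + r m" "a \<notin> keys (r m)" for m
      by (auto intro!: poly_mapping_eqI simp: r_def lookup_add lookup_update lookup_single when_def in_keys_iff)
    \<comment> \<open>Modulo \<open>e\<close> the product of w_a and \<open>M\<close> is 1, so w_a^k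
      is congruent to w_a^N M^(N - k). The common exponent \<open>N\<close> allows w_a^N to be
      factored out of all monomials.\<close>
    define Y where "Y = (\<Sum>m\<in>keys x. single (r m) (lookup x m) * M ^ (N - lookup m a))"
    have "x - wvar a ^ N * Y = (\<Sum>m\<in>keys x. single m (lookup x m) - wvar a ^ N * (single (r m) (lookup x m) * M ^ (N - lookup m a)))"
      by (simp add: Y_def sum_distrib_left sum_subtractf poly_mapping_eq_sum_single)
    moreover have "e dvd single m (lookup x m) - wvar a ^ N * (single (r m) (lookup x m) * M ^ (N - lookup m a))"
      if m: "m \<in> keys x" for m
    proof -
      let ?k = "lookup m a" and ?c = "lookup x m"
      have mono: "wvar a ^ ?k * single (r m) ?c = single m ?c"
        unfolding wvar_power using r(1)[of m] by (simp add: mult_single)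
      have "wvar a ^ N = wvar a ^ ?k * wvar a ^ (N - ?k)" using N[OF m] by (simp flip: power_add)
      then have "wvar a ^ N * (single (r m) ?c * M ^ (N - ?k)) = single m ?c * (wvar a * M) ^ (N - ?k)"
        unfolding mono[symmetric] by (simp add: power_mult_distrib mult_ac)
      then have "single m ?c - wvar a ^ N * (single (r m) ?c * M ^ (N - ?k)) = single m ?c * (1 - (wvar a * M) ^ (N - ?k))"
        by (simp add: right_diff_distrib)
      moreover have "1 - wvar a * M dvd 1 - (wvar a * M) ^ (N - ?k)"
        by (metis one_diff_power_eq dvd_triv_left)
      then have "e dvd 1 - (wvar a * M) ^ (N - ?k)" unfolding wM by simp
      ultimately show ?thesis by simp
    qed
    ultimately have d: "e dvd x - wvar a ^ N * Y" by (simp add: dvd_sum)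
    then have "\<theta> (x - wvar a ^ N * Y) = 0" using \<theta>e by (auto simp: hom_mult)
    then have "\<theta> (wvar a) ^ N * \<theta> Y = 0" using x by (simp add: hom_simps)
    moreover have "\<theta> (wvar a) \<noteq> 0" using M0 by (simp add: \<theta>w del: inverse_fract)
    \<comment> \<open>Neither \<open>r m\<close> nor \<open>M\<close> contains w_a, so \<theta> acts
      on \<open>Y\<close> as the embedding. Hence \<theta> Y = 0 forces Y = 0.\<close>
    moreover have "\<theta> Y = Fract Y 1"
      unfolding Y_def comm_ring_hom.hom_simps[OF fract_hom] hom_simps \<theta>M
      using r(2) by (simp add: free)
    ultimately have "Y = 0" by simp
    with d show ?thesis by simp
  qed
  moreover have "e \<noteq> 0" using lookup_binom_poly_0[OF ab, of c] by (auto simp: e_def)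
  ultimately show ?thesis
    unfolding e_def[symmetric] using \<theta>e by (intro prime_elem_kernel[OF comm_ring_hom_axioms])
qed

lemma monom_eval_ratio:
  fixes s :: "nat \<Rightarrow> 'a::field"
  assumes "\<And>l. s l \<noteq> 0" "a \<le> b"
  shows "monom_eval (\<lambda>l. s (Suc l) / s l) (root_multiple a b 1) = s b / s a"
proof -
  have "monom_eval (\<lambda>l. s (Suc l) / s l) (root_multiple a b 1) = (\<Prod>l = a..<b. s (Suc l) / s l)"
    unfolding root_multiple_def monom_eval_sum by simp
  also have "\<dots> = s b / s a"
    using assms(2) by (induction b rule: dec_induct) (simp_all add: assms(1))
  finally show ?thesis .
qed

text \<open>The point is given in the coordinates s, where the zero set of a binomial is a
  hyperplane s_a = c s_b.\<close>

definition point_eval :: "(nat \<Rightarrow> complex) \<Rightarrow> mpolynomial \<Rightarrow> complex"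
  where "point_eval s = poly_eval (\<lambda>x. x) (\<lambda>l. s (Suc l) / s l)"

lemma point_eval_hom: "comm_ring_hom (point_eval s)"
  unfolding point_eval_def by (rule const_hom.poly_eval_hom[OF const_hom_id])

lemma point_eval_single:
  assumes "\<And>l. s l \<noteq> 0" "a \<le> b"
  shows "point_eval s (single (root_multiple a b 1) c) = c * (s b / s a)"
  using monom_eval_ratio[of s, OF assms]
  by (simp add: point_eval_def const_hom.poly_eval_single[OF const_hom_id])

lemma point_eval_binom_poly:
  assumes "\<And>l. s l \<noteq> 0" "a \<le> b"
  shows "point_eval s (binom_poly a b c) = 0 \<longleftrightarrow> s a = c * s b"
  unfolding binom_poly_def comm_ring_hom.hom_simps[OF point_eval_hom] point_eval_single[OF assms]
  using assms(1)[of a] by (auto simp: field_simps)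

text \<open>Test point: s_a = c and all other coordinates 1. Doubling a coordinate outside {a, b}
  stays on the first hyperplane, so the second equation cannot involve it; the values at the test
  point then determine d.\<close>

lemma hyperplane_eq:
  fixes c d :: complex and a b i j :: nat
  assumes ne: "i \<noteq> j" "a \<noteq> b" "c \<noteq> 0"
    and imp: "\<And>s. (\<And>l. s l \<noteq> 0) \<Longrightarrow> s a = c * s b \<Longrightarrow> s j = d * s i"
  shows "(j = a \<and> i = b \<and> d = c) \<or> (j = b \<and> i = a \<and> d * c = 1)"
proof -
  define s where "s l = (if l = a then c else 1)" for l :: nat
  have s: "s l \<noteq> 0" for l using ne by (simp add: s_def)
  have sab: "s a = c * s b" using ne by (simp add: s_def)
  have base: "s j = d * s i" by (rule imp[OF s sab])
  have j: "j \<in> {a, b}"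
  proof (rule ccontr)
    assume "j \<notin> {a, b}"
    then have "(s(j := 2 * s j)) j = d * (s(j := 2 * s j)) i"
      by (intro imp) (auto simp: s sab)
    then show False using base ne s[of j] by simp
  qed
  have i: "i \<in> {a, b}"
  proof (rule ccontr)
    assume "i \<notin> {a, b}"
    then have "(s(i := 2 * s i)) j = d * (s(i := 2 * s i)) i"
      by (intro imp) (auto simp: s sab)
    then show False using base ne s[of j] by auto
  qed
  show ?thesis using i j ne base by (auto simp: s_def)
qed

text \<open>Divisibility becomes an inclusion of hyperplanes. The alternative with exchanged indices
  contradicts a < b and a' < b'.\<close>

lemma binom_poly_dvd_imp:
  assumes "a < b" "c \<noteq> 0" "a' < b'" "binom_poly a b c dvd binom_poly a' b' c'"
  shows "a = a' \<and> b = b' \<and> c = c'"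
proof -
  have "(a' = a \<and> b' = b \<and> c' = c) \<or> (a' = b \<and> b' = a \<and> c' * c = 1)"
  proof (rule hyperplane_eq)
    fix s :: "nat \<Rightarrow> complex"
    assume s: "\<And>l. s l \<noteq> 0" "s a = c * s b"
    obtain g where g: "binom_poly a' b' c' = binom_poly a b c * g" using assms(4) by blast
    have "point_eval s (binom_poly a b c) = 0" using s assms by (subst point_eval_binom_poly) auto
    then have "point_eval s (binom_poly a' b' c') = 0"
      unfolding g comm_ring_hom.hom_simps[OF point_eval_hom] by simp
    then show "s a' = c' * s b'" using s assms by (subst (asm) point_eval_binom_poly) auto
  qed (use assms in auto)
  with assms show ?thesis by auto
qed

section \<open>Polynomials in the ratios\<close>

lemma wpolys_single: "m \<in> Qplus n \<Longrightarrow> single m c \<in> wpolys n"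
  by (simp add: wpolys_def)

lemma wpolys_const [simp]: "single 0 c \<in> wpolys n" "1 \<in> wpolys n" "0 \<in> wpolys n"
  by (simp_all add: wpolys_def)

lemma wpolys_uminus: "P \<in> wpolys n \<Longrightarrow> - P \<in> wpolys n"
  by (simp add: wpolys_def subset_iff in_keys_iff)

lemma wpolys_add: "P \<in> wpolys n \<Longrightarrow> Q \<in> wpolys n \<Longrightarrow> P + Q \<in> wpolys n"
  using Poly_Mapping.keys_add[of P Q] by (auto simp: wpolys_def)

lemma wpolys_diff: "P \<in> wpolys n \<Longrightarrow> Q \<in> wpolys n \<Longrightarrow> P - Q \<in> wpolys n"
  using wpolys_add[of P n "- Q"] wpolys_uminus by simp

lemma wpolys_mult:
  assumes "P \<in> wpolys n" "Q \<in> wpolys n"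
  shows "P * Q \<in> wpolys n"
proof -
  have "keys (P * Q) \<subseteq> {a + b | a b. a \<in> keys P \<and> b \<in> keys Q}" by (rule keys_mult)
  also have "\<dots> \<subseteq> Qplus n" using assms by (auto simp: wpolys_def)
  finally show ?thesis by (simp add: wpolys_def)
qed

lemma wpolys_sum: "(\<And>i. i \<in> A \<Longrightarrow> f i \<in> wpolys n) \<Longrightarrow> (\<Sum>i\<in>A. f i) \<in> wpolys n"
  by (induction A rule: infinite_finite_induct) (auto intro: wpolys_add)

lemma wpolys_prod: "(\<And>i. i \<in> A \<Longrightarrow> f i \<in> wpolys n) \<Longrightarrow> (\<Prod>i\<in>A. f i) \<in> wpolys n"
  by (induction A rule: infinite_finite_induct) (auto intro: wpolys_mult)

lemma wpolys_power: "P \<in> wpolys n \<Longrightarrow> P ^ k \<in> wpolys n"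
  by (induction k) (auto intro: wpolys_mult)

lemma wpolys_wvar: "1 \<le> a \<Longrightarrow> a < n \<Longrightarrow> wvar a \<in> wpolys n"
  by (simp add: wvar_def wpolys_def Qplus_def)

lemma wpolys_binom_poly: "1 \<le> a \<Longrightarrow> b \<le> n \<Longrightarrow> binom_poly a b c \<in> wpolys n"
  unfolding binom_poly_def by (intro wpolys_diff wpolys_single root_multiple_Qplus) auto

text \<open>Setting the variables outside \<open>w\<^sub>1, \<dots>, w\<^sub>n\<^sub>-\<^sub>1\<close> to 1 is a retraction onto \<open>wpolys n\<close>.\<close>

lemma wpolys_cofactor:
  assumes "P * Q \<in> wpolys n" "P \<in> wpolys n" "P \<noteq> 0"
  shows "Q \<in> wpolys n"
proof -
  define v where "v l = (if l \<in> {1..<n} then wvar l else 1)" for l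
  define \<pi> where "\<pi> = poly_eval (single 0) v"
  interpret comm_ring_hom \<pi>
    unfolding \<pi>_def by (rule const_hom.poly_eval_hom[OF const_hom_single])
  have id: "\<pi> x = x" if "x \<in> wpolys n" for x
  proof -
    have "\<pi> x = (\<Sum>m\<in>keys x. single 0 (lookup x m) * monom_eval v m)" by (simp add: \<pi>_def poly_eval_def)
    also have "\<dots> = (\<Sum>m\<in>keys x. single m (lookup x m))"
    proof (rule sum.cong)
      fix m assume "m \<in> keys x"
      then have "keys m \<subseteq> {1..<n}" using that by (auto simp: wpolys_def Qplus_def)
      then have "monom_eval v m = monom_eval wvar m"
        unfolding monom_eval_def by (intro prod.cong) (auto simp: v_def)
      then show "single 0 (lookup x m) * monom_eval v m = single m (lookup x m)"
        by (simp add: monom_eval_wvar mult_single)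
    qed simp
    finally show ?thesis by (simp add: poly_mapping_eq_sum_single)
  qed
  have rng: "\<pi> x \<in> wpolys n" for x
    unfolding \<pi>_def poly_eval_def monom_eval_def
    by (intro wpolys_sum wpolys_mult wpolys_prod wpolys_power) (auto simp: v_def wpolys_wvar)
  have "P * \<pi> Q = P * Q" using id[OF assms(1)] id[OF assms(2)] by (simp add: hom_mult)
  then have "\<pi> Q = Q" using assms(3) by simp
  with rng[of Q] show ?thesis by simp
qed

definition wimage :: "nat \<Rightarrow> ratfun set"
  where "wimage n = at_ratios ` wpolys n"

lemma wimage_add: "x \<in> wimage n \<Longrightarrow> y \<in> wimage n \<Longrightarrow> x + y \<in> wimage n"
  by (auto simp: wimage_def at_ratios_simps[symmetric] intro!: imageI wpolys_add)

lemma wimage_mult: "x \<in> wimage n \<Longrightarrow> y \<in> wimage n \<Longrightarrow> x * y \<in> wimage n"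
  by (auto simp: wimage_def at_ratios_simps[symmetric] intro!: imageI wpolys_mult)

lemma wimage_at_ratios: "P \<in> wpolys n \<Longrightarrow> at_ratios P \<in> wimage n"
  by (simp add: wimage_def)

lemma wimage_ratconst: "ratconst c \<in> wimage n"
  using wimage_at_ratios[of "single 0 c" n] by (simp add: at_ratios_single)

lemma wimage_uminus: "x \<in> wimage n \<Longrightarrow> - x \<in> wimage n"
  using wimage_mult[OF wimage_ratconst[of "- 1"]] by (simp add: ratconst_simps)

lemma wimage_0: "0 \<in> wimage n"
  using wimage_ratconst[of 0] by simp

lemma wimage_sum: "(\<And>i. i \<in> A \<Longrightarrow> f i \<in> wimage n) \<Longrightarrow> (\<Sum>i\<in>A. f i) \<in> wimage n"
  by (induction A rule: infinite_finite_induct) (auto intro: wimage_add wimage_0)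

section \<open>Reduced denominators and their irreducible factors\<close>

section \<open>From a product of distinct pole equations to the polar divisor\<close>

definition pole_index :: "nat \<Rightarrow> (nat \<times> nat \<times> nat) set"
  where "pole_index n = {(i, j, k). 1 \<le> i \<and> i < j \<and> j \<le> n}"

definition pole_eq :: "complex \<Rightarrow> nat \<times> nat \<times> nat \<Rightarrow> mpolynomial"
  where "pole_eq q = (\<lambda>(i, j, k). pole_equation q i j k)"

definition Den :: "complex \<Rightarrow> (nat \<times> nat \<times> nat) set \<Rightarrow> mpolynomial"
  where "Den q S = (\<Prod>e\<in>S. pole_eq q e)"

lemma prime_pole_eq: "q \<noteq> 0 \<Longrightarrow> e \<in> pole_index n \<Longrightarrow> prime_elem (pole_eq q e)"
  by (auto simp: pole_index_def pole_eq_def pole_equation_eq intro!: prime_binom_poly)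

lemma wpolys_pole_eq: "e \<in> pole_index n \<Longrightarrow> pole_eq q e \<in> wpolys n"
  by (auto simp: pole_index_def pole_eq_def pole_equation_eq intro!: wpolys_binom_poly)

lemma wpolys_Den: "S \<subseteq> pole_index n \<Longrightarrow> Den q S \<in> wpolys n"
  unfolding Den_def by (intro wpolys_prod wpolys_pole_eq) auto

lemma lookup_Den_0: "S \<subseteq> pole_index n \<Longrightarrow> lookup (Den q S) 0 = 1"
  unfolding Den_def comm_ring_hom.hom_prod[OF lookup_0_hom]
  by (intro prod.neutral ballI)
    (auto simp: pole_index_def pole_eq_def pole_equation_eq intro!: lookup_binom_poly_0)

lemma Den_neq_0: "S \<subseteq> pole_index n \<Longrightarrow> Den q S \<noteq> 0"
  using lookup_Den_0[of S n q] by auto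

lemma regular_at_origin_Den:
  assumes "S \<subseteq> pole_index n" "at_ratios (Den q S) * F \<in> wimage n"
  shows "regular_at_origin n F"
proof -
  obtain P where P: "P \<in> wpolys n" "at_ratios (Den q S) * F = at_ratios P"
    using assms(2) by (auto simp: wimage_def)
  then have "F = at_ratios P / at_ratios (Den q S)"
    using Den_neq_0[OF assms(1), of q] by (simp add: field_simps)
  then show ?thesis
    unfolding regular_at_origin_def
    by (intro bexI[of _ P] bexI[of _ "Den q S"]) (use P wpolys_Den[OF assms(1)] lookup_Den_0[OF assms(1), of q] in auto)
qed

text \<open>Every factor of \<open>Den\<close> that divides the numerator is cancelled. Since the
  factors are primes, what remains is in lowest terms.\<close>

lemma Den_reduce:
  assumes "finite S" "S \<subseteq> pole_index n" "A \<in> wpolys n" "at_ratios (Den q S) * F = at_ratios A"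
  shows "\<exists>S' A'. S' \<subseteq> S \<and> A' \<in> wpolys n \<and> at_ratios (Den q S') * F = at_ratios A' \<and>
    (\<forall>e\<in>S'. \<not> pole_eq q e dvd A')"
  using assms
proof (induction "card S" arbitrary: S A rule: less_induct)
  case less
  show ?case
  proof (cases "\<exists>e\<in>S. pole_eq q e dvd A")
    case False
    then show ?thesis using less.prems by blast
  next
    case True
    then obtain e B where e: "e \<in> S" and B: "A = pole_eq q e * B" by blast
    have ei: "e \<in> pole_index n" using e less.prems by auto
    have nz: "pole_eq q e \<noteq> 0" using Den_neq_0[of "{e}" n q] ei by (simp add: Den_def)
    have Bw: "B \<in> wpolys n"
      by (rule wpolys_cofactor[of "pole_eq q e"]) (use B less.prems(3) wpolys_pole_eq[OF ei] nz in auto)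
    have "Den q S = pole_eq q e * Den q (S - {e})"
      unfolding Den_def by (rule prod.remove) (use less.prems e in auto)
    then have "at_ratios (Den q (S - {e})) * F = at_ratios B"
      using less.prems(4) nz by (simp add: B at_ratios_simps)
    moreover have "card (S - {e}) < card S" using less.prems e by (intro card_Diff1_less) auto
    ultimately have "\<exists>S' A'. S' \<subseteq> S - {e} \<and> A' \<in> wpolys n \<and> at_ratios (Den q S') * F = at_ratios A' \<and>
        (\<forall>e\<in>S'. \<not> pole_eq q e dvd A')"
      using less.prems Bw by (intro less.hyps) auto
    then show ?thesis by blast
  qed
qed

text \<open>An irreducible divisor of a product of primes is associated to one of them. If its
  square divided the product, one pole equation would divide another one; then their indices and
  powers of q agree, and injectivity of k \<mapsto> q^k makes them the same factor.\<close>

lemma simple_poles_Den: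
  assumes q0: "q \<noteq> 0" and q1: "\<And>k l. q ^ k = q ^ l \<Longrightarrow> k = l"
    and fin: "finite S" and S: "S \<subseteq> pole_index n" and F: "at_ratios (Den q S) * F \<in> wimage n"
  shows "simple_poles n q F"
proof -
  obtain A where "A \<in> wpolys n" "at_ratios (Den q S) * F = at_ratios A"
    using F by (auto simp: wimage_def)
  then obtain S' P where S': "S' \<subseteq> S" and P: "P \<in> wpolys n" and eq: "at_ratios (Den q S') * F = at_ratios P"
    and nd: "\<And>e. e \<in> S' \<Longrightarrow> \<not> pole_eq q e dvd P"
    using Den_reduce[OF fin S, of A q F] by blast
  have finS': "finite S'" and S'i: "S' \<subseteq> pole_index n" using S' S fin finite_subset by auto
  let ?Q = "Den q S'"
  have pr: "prime_elem (pole_eq q e)" if "e \<in> S'" for e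
    using that S'i by (intro prime_pole_eq[OF q0]) auto
  have Q0: "?Q \<noteq> 0" by (rule Den_neq_0[OF S'i])
  have "d dvd 1" if "d dvd P" "d dvd ?Q" for d
  proof (rule dvd_prod_primes_unit[where p = "pole_eq q", OF finS' pr])
    show "d dvd prod (pole_eq q) S'" using that by (simp add: Den_def)
    show "\<not> pole_eq q e dvd d" if "e \<in> S'" for e using nd[OF that] \<open>d dvd P\<close> dvd_trans by blast
  qed
  then have "lowest_terms n F P ?Q"
    unfolding lowest_terms_def using P wpolys_Den[OF S'i] Q0 eq by (auto simp: field_simps)
  moreover have "\<not> p ^ 2 dvd ?Q \<and> (\<exists>i j k. 1 \<le> i \<and> i < j \<and> j \<le> n \<and> p dvd pole_equation q i j k \<and> pole_equation q i j k dvd p)"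
    if p: "irreducible p" "p dvd ?Q" for p
  proof -
    have "\<not> p dvd 1" using p by (simp add: irreducible_def)
    \<comment> \<open>If no factor of \<open>Den\<close> divided p, then p would be a unit.\<close>
    then obtain e where e: "e \<in> S'" "pole_eq q e dvd p"
      using dvd_prod_primes_unit[where p = "pole_eq q" and d = p, OF finS' pr] p(2) by (auto simp: Den_def)
    then obtain g where g: "p = pole_eq q e * g" by blast
    then have "g dvd 1" using irreducibleD[OF p(1) g] pr[OF e(1)] by (auto simp: prime_elem_def)
    then obtain u where "1 = g * u" by blast
    then have "pole_eq q e = p * u" using g by (simp add: mult.assoc)
    then have pe: "p dvd pole_eq q e" by simp
    have "\<not> p ^ 2 dvd ?Q"
    proof
      assume "p ^ 2 dvd ?Q"
      then have "pole_eq q e ^ 2 dvd ?Q" using e(2) dvd_power_same dvd_trans by blast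
      moreover have "?Q = pole_eq q e * Den q (S' - {e})"
        unfolding Den_def by (rule prod.remove[OF finS' e(1)])
      ultimately have "pole_eq q e dvd Den q (S' - {e})"
        using pr[OF e(1)] by (simp add: power2_eq_square prime_elem_def)
      then obtain e' where e': "e' \<in> S' - {e}" "pole_eq q e dvd pole_eq q e'"
        using prime_elem_dvd_prod[OF pr[OF e(1)], of "S' - {e}" "pole_eq q"] finS' unfolding Den_def by blast
      obtain i j k i' j' k' where ee: "e = (i, j, k)" "e' = (i', j', k')" by (cases e, cases e')
      then have "i < j" "i' < j'" using e(1) e'(1) S'i by (auto simp: pole_index_def)
      then have "i = i' \<and> j = j' \<and> q ^ (k + 1) = q ^ (k' + 1)"
        using e'(2) q0 unfolding ee pole_eq_def pole_equation_eq prod.case by (intro binom_poly_dvd_imp) auto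
      then have "e = e'" using q1[of "k + 1" "k' + 1"] ee by simp
      with e' show False by simp
    qed
    moreover obtain i j k where "e = (i, j, k)" by (cases e)
    then have "1 \<le> i \<and> i < j \<and> j \<le> n \<and> p dvd pole_equation q i j k \<and> pole_equation q i j k dvd p"
      using e pe S'i by (auto simp: pole_index_def pole_eq_def)
    ultimately show ?thesis by blast
  qed
  ultimately show ?thesis unfolding simple_poles_def by blast
qed

section \<open>Elimination of spurious denominators by the joint system\<close>

section \<open>Denominators of the coefficients\<close>

definition sigma :: "nat \<Rightarrow> mpolynomial"  \<comment> \<open>\<open>s\<^sub>i / s\<^sub>1\<close>\<close>
  where "sigma i = single (root_multiple 1 i 1) 1"

definition sexp :: "nat set \<Rightarrow> (nat \<Rightarrow>\<^sub>0 nat)"  \<comment> \<open>the exponent of \<open>\<Prod>\<^sub>i\<^sub>\<in>\<^sub>I s\<^sub>i / s\<^sub>1\<close>\<close>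
  where "sexp I = (\<Sum>i\<in>I. root_multiple 1 i 1)"

lemma prod_sigma: "(\<Prod>i\<in>I. sigma i) = single (sexp I) 1"
  unfolding sigma_def sexp_def by (induction I rule: infinite_finite_induct) (simp_all add: mult_single)

lemma lookup_sexp:
  assumes "finite I"
  shows "lookup (sexp I) a = (if a = 0 then 0 else card {i \<in> I. a < i})"
proof -
  have "lookup (sexp I) a = (\<Sum>i\<in>I. if 1 \<le> a \<and> a < i then 1 else 0)"
    unfolding sexp_def lookup_sum by (rule sum.cong) (auto simp: lookup_root_multiple)
  then show ?thesis using assms by (simp add: sum.If_cases Int_def Collect_conj_eq[symmetric] conj_commute)
qed

lemma sexp_Qplus:
  assumes "I \<subseteq> {1..n}"
  shows "sexp I \<in> Qplus n"
proof -
  have "finite I" using assms finite_subset by blast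
  then show ?thesis unfolding sexp_def using assms
    by (induction I) (auto intro: root_multiple_Qplus[of 1, unfolded One_nat_def])
qed

text \<open>The exponent of \<open>\<Prod>\<^sub>i\<^sub>\<in>\<^sub>I s\<^sub>i / (s\<^sub>1 \<cdots> s\<^sub>r)\<close> where \<open>r = |I|\<close>.\<close>

definition rexp :: "nat set \<Rightarrow> (nat \<Rightarrow>\<^sub>0 nat)"
  where "rexp I = sexp I - sexp {1..card I}"

text \<open>The truncated subtraction in \<open>rexp\<close> is exact: at most a elements of I lie
  in {1..a}, so at least card I - a of them exceed a, which is the number for {1..card I}.\<close>

lemma sexp_rexp:
  assumes "finite I" "0 \<notin> I"
  shows "sexp {1..card I} + rexp I = sexp I"
proof (rule poly_mapping_eqI)
  fix a
  have "lookup (sexp {1..card I}) a \<le> lookup (sexp I) a"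
  proof (cases "a = 0")
    case False
    have "card I \<le> card ({1..a} \<union> {i \<in> I. a < i})"
      using assms by (intro card_mono) (auto simp: not_less_eq_eq Suc_le_eq intro: gr0I)
    also have "\<dots> \<le> a + card {i \<in> I. a < i}" using card_Un_le[of "{1..a}" "{i \<in> I. a < i}"] by simp
    finally have "card I - a \<le> card {i \<in> I. a < i}" by simp
    moreover have "{i \<in> {1..card I}. a < i} = {a<..card I}" by auto
    ultimately show ?thesis using assms by (simp add: lookup_sexp)
  qed (simp add: lookup_sexp assms)
  then show "lookup (sexp {1..card I} + rexp I) a = lookup (sexp I) a"
    by (simp add: rexp_def lookup_add minus_poly_mapping.rep_eq)
qed

lemma rexp_Qplus: "I \<subseteq> {1..n} \<Longrightarrow> rexp I \<in> Qplus n"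
  using sexp_Qplus[of I n] sexp_rexp[of I] finite_subset[of I "{1..n}"]
  by (metis Qplus_add_iff atLeastAtMost_iff finite_atLeastAtMost not_one_le_zero subsetD)

text \<open>Exactly one product of r of the s_i has exponent 0 after normalisation; it supplies the
  constant term of \<open>Epoly\<close>. Comparing exponents at card I shows that no element of I
  exceeds card I.\<close>

lemma rexp_eq_0_iff:
  assumes "finite I" "0 \<notin> I"
  shows "rexp I = 0 \<longleftrightarrow> I = {1..card I}"
proof
  assume "rexp I = 0"
  then have e: "sexp {1..card I} = sexp I" using sexp_rexp[OF assms] by simp
  have "{i \<in> {1..card I}. card I < i} = {}" by auto
  then have "lookup (sexp {1..card I}) (card I) = 0"
    unfolding lookup_sexp[OF finite_atLeastAtMost] by simp
  then have "card I = 0 \<or> card {i \<in> I. card I < i} = 0"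
    unfolding e lookup_sexp[OF assms(1)] by (simp split: if_splits)
  then have "x \<le> card I" if "x \<in> I" for x
    using that assms(1) by (auto simp: not_less)
  moreover have "1 \<le> x" if "x \<in> I" for x
    using that assms(2) by (cases x) auto
  ultimately have "I \<subseteq> {1..card I}" by auto
  then show "I = {1..card I}" by (intro card_subset_eq) auto
next
  assume "I = {1..card I}"
  then show "rexp I = 0" by (metis cancel_comm_monoid_add_class.diff_cancel rexp_def)
qed

lemma at_ratios_sigma:
  assumes "1 \<le> i"
  shows "svar 1 * at_ratios (sigma i) = svar i"
  using monom_eval_ratio[of svar 1 i] assms
  by (simp add: sigma_def at_ratios_single)

lemma prod_svar_rexp:
  assumes "finite I" "0 \<notin> I"
  shows "(\<Prod>i\<in>I. svar i) = (\<Prod>i\<in>{1..card I}. svar i) * at_ratios (single (rexp I) 1)"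
proof -
  have e: "(\<Prod>i\<in>K. svar i) = svar 1 ^ card K * at_ratios (single (sexp K) 1)" if "0 \<notin> K" for K
  proof -
    have "(\<Prod>i\<in>K. svar i) = (\<Prod>i\<in>K. svar 1 * at_ratios (sigma i))"
      using that by (intro prod.cong refl) (metis at_ratios_sigma less_one not_le)
    then show ?thesis by (simp add: prod.distrib prod_sigma flip: at_ratios_simps)
  qed
  have "single (sexp I) 1 = (single (sexp {1..card I}) 1 * single (rexp I) 1 :: mpolynomial)"
    unfolding mult_single sexp_rexp[OF assms] by simp
  then show ?thesis using e[OF assms(2)] e[of "{1..card I}"] by (simp add: at_ratios_simps)
qed

context macdonald
begin

definition wt :: "(nat \<Rightarrow>\<^sub>0 nat) \<Rightarrow> nat \<Rightarrow> int"
  where "wt m i = lookup (root_weight m) i"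

lemma sum_wt:
  assumes "m \<in> Qplus n"
  shows "(\<Sum>i\<in>{1..l}. wt m i) = int (lookup m l)"
proof -
  have "lookup m 0 = 0" using assms by (auto simp: Qplus_def in_keys_iff subset_iff)
  then show ?thesis
    by (induction l) (simp_all add: wt_def lookup_root_weight_Suc)
qed

lemma qweight_wt: "qweight q I m = (\<Prod>i\<in>I. q powi (- wt m i))"
  by (simp add: qweight_def wt_def)

lemma qweight_interval:
  assumes "m \<in> Qplus n"
  shows "qweight q {1..l} m = q powi (- int (lookup m l))"
proof -
  have "qweight q {1..l} m = q powi (- (\<Sum>i\<in>{1..l}. wt m i))"
    unfolding qweight_wt
  proof (induction l)
    case (Suc l)
    then show ?case
      using q0 power_int_add[of q "- (\<Sum>i\<in>{1..l}. wt m i)" "- wt m (Suc l)"] by simp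
  qed simp
  then show ?thesis using sum_wt[OF assms] by simp
qed

lemma phi_recursion:
  "(esym {1..n} (qsvar q m) r - esym {1..n} svar r) * phi m = - lower_term n q t r phi m"
  using arg_cong[OF Dr_Phi[of r], of "\<lambda>f. mfps_nth f m"] unfolding macdonald_D_nth[OF t0] mfps_nth_const_mult
  by (simp add: algebra_simps eq_neg_iff_add_eq_0)

text \<open>The difference of the eigenvalues of \<open>D\<^sub>r\<close> at \<open>\<mu>\<close> and at \<open>0\<close>, divided by \<open>s\<^sub>1 \<cdots> s\<^sub>r\<close>.\<close>

definition Epoly :: "(nat \<Rightarrow>\<^sub>0 nat) \<Rightarrow> nat \<Rightarrow> mpolynomial"
  where "Epoly m r = (\<Sum>I | I \<subseteq> {1..n} \<and> card I = r. single (rexp I) (qweight q I m - 1))"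

lemma subsetN: "I \<subseteq> {1..n} \<Longrightarrow> finite I \<and> 0 \<notin> I"
  by (auto intro: finite_subset)

text \<open>After division by s_1 ... s_r the equation of D_r involves only ratios:
  \<open>Epoly m r\<close> times the coefficient at m is a polynomial combination of lower
  coefficients.\<close>

lemma Epoly_phi:
  "at_ratios (Epoly m r) * phi m = - (\<Sum>p\<in>splits m - {(0, m)}. \<Sum>I | I \<subseteq> {1..n} \<and> card I = r.
    ratconst (Kcoeff n t I (fst p) * qweight q I (snd p)) * at_ratios (single (rexp I) 1) * phi (snd p))"
    (is "_ = - ?L")
proof -
  define P where "P = (\<Prod>i\<in>{1..r}. svar i)"
  have P0: "P \<noteq> 0" by (simp add: P_def)
  have pr: "(\<Prod>i\<in>I. svar i) = P * at_ratios (single (rexp I) 1)" if "I \<subseteq> {1..n}" "card I = r" for I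
    using prod_svar_rexp[of I] subsetN[OF that(1)] that(2) by (simp add: P_def)
  have "esym {1..n} (qsvar q m) r - esym {1..n} svar r = P * at_ratios (Epoly m r)"
    unfolding esym_def Epoly_def prod_qsvar sum_subtractf[symmetric] at_ratios_simps(7) sum_distrib_left
    by (rule sum.cong) (auto simp: pr at_ratios_single ratconst_simps algebra_simps)
  moreover have "lower_term n q t r phi m = P * ?L"
    unfolding lower_term_def sum_distrib_left by (intro sum.cong refl) (auto simp: pr)
  ultimately have "P * (at_ratios (Epoly m r) * phi m) = P * (- ?L)"
    using phi_recursion[of m r] by (simp add: mult_ac)
  then show ?thesis by (rule mult_left_cancel[OF P0, THEN iffD1])
qed

lemma Epoly_wpolys: "Epoly m r \<in> wpolys n"
  unfolding Epoly_def by (intro wpolys_sum wpolys_single rexp_Qplus) auto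

text \<open>Only I = {1..r} contributes, and \<mu>_1 + ... + \<mu>_r telescopes to m_r.\<close>

lemma lookup_Epoly_0:
  assumes "m \<in> Qplus n" "r \<le> n"
  shows "lookup (Epoly m r) 0 = q powi (- int (lookup m r)) - 1"
proof -
  let ?S = "{I. I \<subseteq> {1..n} \<and> card I = r}"
  have "lookup (Epoly m r) 0 = (\<Sum>I\<in>?S. if I = {1..r} then qweight q {1..r} m - 1 else 0)"
    unfolding Epoly_def lookup_sum
  proof (rule sum.cong)
    fix I assume I: "I \<in> ?S"
    then have "card I = r" and I0: "finite I" "0 \<notin> I" using subsetN[of I] by simp_all
    then have r: "rexp I = 0 \<longleftrightarrow> I = {1..r}" using rexp_eq_0_iff[OF I0] by (simp only:)
    show "lookup (single (rexp I) (qweight q I m - 1)) 0 = (if I = {1..r} then qweight q {1..r} m - 1 else 0)"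
      unfolding lookup_single when_def r by (rule if_cong) simp_all
  qed simp
  also have "\<dots> = qweight q {1..r} m - 1" using assms(2) by (simp add: sum.delta)
  finally show ?thesis using qweight_interval[OF assms(1)] by simp
qed

text \<open>The value at \<open>u = 1 / s\<^sub>j\<close> of the generating function of the differences of eigenvalues.\<close>

definition factor :: "(nat \<Rightarrow>\<^sub>0 nat) \<Rightarrow> nat \<Rightarrow> nat \<Rightarrow> mpolynomial"
  where "factor m j i = sigma j - single 0 (q powi (- wt m i)) * sigma i"

definition Mpoly :: "(nat \<Rightarrow>\<^sub>0 nat) \<Rightarrow> nat \<Rightarrow> mpolynomial"
  where "Mpoly m j = (\<Prod>i\<in>{1..n}. factor m j i)"

text \<open>The product of the sigma j - sigma i vanishes because of i = j. Subtracting it replaces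
  the elementary symmetric functions by differences, which puts \<open>Mpoly m j\<close> into the
  ideal generated by the \<open>Epoly m r\<close>.\<close>

lemma Mpoly_eq:
  assumes j: "j \<in> {1..n}"
  shows "Mpoly m j = (\<Sum>r\<le>n. (- 1) ^ r * sigma j ^ (n - r) * single (sexp {1..r}) 1 * Epoly m r)"
proof -
  let ?y = "\<lambda>i. single 0 (q powi (- wt m i)) * sigma i"
  have pc: "(\<Prod>i\<in>I. single 0 (c i)) = (single 0 (\<Prod>i\<in>I. c i) :: mpolynomial)" for I and c :: "nat \<Rightarrow> complex"
    by (induction I rule: infinite_finite_induct) (simp_all add: mult_single)
  have py: "(\<Prod>i\<in>I. ?y i) = single 0 (qweight q I m) * single (sexp I) 1" for I
    by (simp add: prod.distrib pc qweight_wt prod_sigma)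
  have E: "esym {1..n} ?y r - esym {1..n} sigma r = single (sexp {1..r}) 1 * Epoly m r" for r
  proof -
    have "esym {1..n} ?y r - esym {1..n} sigma r =
        (\<Sum>I | I \<subseteq> {1..n} \<and> card I = r. single (sexp I) (qweight q I m - 1))"
      unfolding esym_def py prod_sigma sum_subtractf[symmetric]
      by (rule sum.cong) (simp_all add: mult_single single_diff)
    also have "\<dots> = single (sexp {1..r}) 1 * Epoly m r"
      unfolding Epoly_def sum_distrib_left
    proof (rule sum.cong)
      fix I assume "I \<in> {I. I \<subseteq> {1..n} \<and> card I = r}"
      then have r: "r = card I" and I: "finite I" "0 \<notin> I" using subsetN[of I] by simp_all
      show "single (sexp I) (qweight q I m - 1) = single (sexp {1..r}) 1 * single (rexp I) (qweight q I m - 1)"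
        unfolding r mult_single sexp_rexp[OF I] by simp
    qed simp
    finally show ?thesis .
  qed
  have "(\<Prod>i\<in>{1..n}. sigma j - sigma i) = 0" by (rule prod_zero) (use j in auto)
  then have "Mpoly m j = (\<Prod>i\<in>{1..n}. sigma j - ?y i) - (\<Prod>i\<in>{1..n}. sigma j - sigma i)"
    by (simp add: Mpoly_def factor_def)
  also have "\<dots> = (\<Sum>r\<le>n. (- 1) ^ r * sigma j ^ (n - r) * (esym {1..n} ?y r - esym {1..n} sigma r))"
    by (simp add: prod_minus_esym right_diff_distrib sum_subtractf)
  finally show ?thesis unfolding E by (simp add: mult_ac)
qed

lemma sigma_wpolys: "i \<le> n \<Longrightarrow> sigma i \<in> wpolys n"
  unfolding sigma_def by (intro wpolys_single root_multiple_Qplus) auto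

lemma factor_wpolys: "i \<le> n \<Longrightarrow> j \<le> n \<Longrightarrow> factor m j i \<in> wpolys n"
  unfolding factor_def by (intro wpolys_diff wpolys_mult sigma_wpolys wpolys_const)

lemma sigma_mult:
  assumes "1 \<le> i" "i < j"
  shows "sigma j = sigma i * single (root_multiple i j 1) 1"
proof -
  have "root_multiple 1 j 1 = root_multiple 1 i 1 + root_multiple i j 1"
    using assms by (intro poly_mapping_eqI) (auto simp: lookup_add lookup_root_multiple)
  then show ?thesis by (simp add: sigma_def mult_single)
qed

lemma factor_diag: "factor m j j = single 0 (1 - q powi (- wt m j)) * sigma j"
  by (simp add: factor_def single_diff left_diff_distrib)

lemma factor_gt:
  assumes "1 \<le> j" "j < i"
  shows "factor m j i = sigma j * binom_poly j i (q powi (- wt m i))"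
  by (simp add: factor_def binom_poly_def sigma_mult[OF assms, unfolded One_nat_def] right_diff_distrib mult_single mult.left_commute[of _ "sigma j"])

text \<open>Only ratios s_j / s_i with i < j are available, so the leading term of the binomial is
  now the other one: the constant is inverted and a unit splits off.\<close>

lemma factor_lt:
  assumes "1 \<le> i" "i < j"
  shows "factor m j i = single 0 (- (q powi (- wt m i))) * sigma i * binom_poly i j (q powi wt m i)"
proof -
  have "single 0 (- (q powi (- wt m i))) * single (root_multiple i j 1) (q powi wt m i) = - single (root_multiple i j 1) 1"
    using q0 by (simp add: mult_single power_int_minus single_uminus)
  then show ?thesis
    unfolding factor_def binom_poly_def sigma_mult[OF assms]
    by (simp add: right_diff_distrib mult_ac single_uminus)
qed

lemma point_eval_factor:
  assumes "\<And>l. s l \<noteq> 0" "1 \<le> i" "1 \<le> j"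
  shows "point_eval s (factor m j i) = 0 \<longleftrightarrow> s j = q powi (- wt m i) * s i"
proof -
  have c: "point_eval s (single 0 c) = c" for c
    by (simp add: point_eval_def const_hom.poly_eval_single[OF const_hom_id])
  show ?thesis
    unfolding factor_def sigma_def comm_ring_hom.hom_simps[OF point_eval_hom] c
      point_eval_single[OF assms(1,2)] point_eval_single[OF assms(1,3)]
    using assms(1)[of 1] by (simp add: field_simps)
qed

text \<open>
  A common prime factor \<open>1 - c s\<^sub>b / s\<^sub>a\<close> of the \<open>Mpoly m j\<close> forces
  \<open>\<mu> = k (\<epsilon>\<^sub>a - \<epsilon>\<^sub>b)\<close> and \<open>c = q\<^sup>k\<close>: evaluating at the points with \<open>s\<^sub>a = c s\<^sub>b\<close> shows that \<open>\<mu>\<^sub>j = 0\<close> off \<open>{a, b}\<close>.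
\<close>

lemma exists_Mpoly_not_dvd:
  assumes m: "m \<in> Qplus n" "m \<noteq> 0" and ab: "1 \<le> a" "a < b" "b \<le> n" and c: "c \<noteq> 0"
    and not_root: "\<And>k. m = root_multiple a b (k + 1) \<Longrightarrow> c \<noteq> q ^ (k + 1)"
  shows "\<exists>j\<in>{1..n}. \<not> binom_poly a b c dvd Mpoly m j"
proof (rule ccontr)
  assume "\<not> ?thesis"
  then have dvd: "binom_poly a b c dvd Mpoly m j" if "j \<in> {1..n}" for j using that by auto
  have key: "(j = a \<and> q powi (- wt m b) = c) \<or> (j = b \<and> q powi (- wt m a) * c = 1)"
    if j: "j \<in> {1..n}" "wt m j \<noteq> 0" for j
  proof -
    obtain i where i: "i \<in> {1..n}" "binom_poly a b c dvd factor m j i"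
      using prime_elem_dvd_prod[OF prime_binom_poly[OF ab(2) c] _ dvd[OF j(1), unfolded Mpoly_def]] by auto
    then obtain g where g: "factor m j i = binom_poly a b c * g" by blast
    have imp: "s j = q powi (- wt m i) * s i" if s: "\<And>l. s l \<noteq> 0" "s a = c * s b" for s
    proof -
      have "point_eval s (binom_poly a b c) = 0" using s ab by (subst point_eval_binom_poly) auto
      then have "point_eval s (factor m j i) = 0" unfolding g comm_ring_hom.hom_simps[OF point_eval_hom] by simp
      then show ?thesis using s i j by (subst (asm) point_eval_factor) auto
    qed
    \<comment> \<open>For i = j the point with s_a = c and all other coordinates 1 gives
      q^(-\<mu>_j) = 1, contrary to \<mu>_j \<noteq> 0.\<close>
    have "i \<noteq> j"
    proof
      assume "i = j"
      have "(\<lambda>l. if l = a then c else 1) j = q powi (- wt m i) * (\<lambda>l. if l = a then c else 1) i"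
        by (rule imp) (use c ab in auto)
      then have "q powi (- wt m i) = 1" using \<open>i = j\<close> c by (auto split: if_splits)
      then show False using \<open>i = j\<close> j by simp
    qed
    have "a \<noteq> b" using ab by simp
    have "(j = a \<and> i = b \<and> q powi (- wt m i) = c) \<or> (j = b \<and> i = a \<and> q powi (- wt m i) * c = 1)"
      by (rule hyperplane_eq[OF \<open>i \<noteq> j\<close> \<open>a \<noteq> b\<close> c imp])
    then show ?thesis by blast
  qed
  have w0: "wt m l = 0" if "l \<in> {1..n}" "l \<noteq> a" "l \<noteq> b" for l using key[OF that(1)] that by blast
  \<comment> \<open>Partial sums of the weights are the coordinates m_l. With weights only at a and
    b, and m_n = 0, the exponent is constant on {a..<b} and 0 elsewhere.\<close>
  have lm: "int (lookup m l) = (\<Sum>i\<in>{1..l} \<inter> {a, b}. wt m i)" if "l \<le> n" for l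
    unfolding sum_wt[OF m(1), symmetric]
    by (rule sum.mono_neutral_right) (use w0 that in auto)
  have out: "lookup m l = 0" if "l = 0 \<or> n \<le> l" for l using m(1) that by (auto simp: Qplus_def in_keys_iff subset_iff)
  have ln: "wt m a + wt m b = 0"
  proof -
    have "{1..n} \<inter> {a, b} = {a, b}" using ab by auto
    then show ?thesis using lm[of n] out[of n] ab by simp
  qed
  have la: "wt m a = int (lookup m a)"
  proof -
    have "{1..a} \<inter> {a, b} = {a}" using ab by auto
    then show ?thesis using lm[of a] ab by simp
  qed
  have m_eq: "m = root_multiple a b (lookup m a)"
  proof (rule poly_mapping_eqI)
    fix l
    consider "l < a" | "a \<le> l" "l < b" | "b \<le> l" "l \<le> n" | "n < l" by linarith
    then show "lookup m l = lookup (root_multiple a b (lookup m a)) l"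
    proof cases
      case 1
      then have "{1..l} \<inter> {a, b} = {}" using ab by auto
      then show ?thesis using lm[of l] 1 ab by (simp add: lookup_root_multiple)
    next
      case 2
      then have "{1..l} \<inter> {a, b} = {a}" using ab by auto
      then show ?thesis using lm[of l] 2 ab la by (simp add: lookup_root_multiple)
    next
      case 3
      then have "{1..l} \<inter> {a, b} = {a, b}" using ab by auto
      then show ?thesis using lm[of l] 3 ab ln by (simp add: lookup_root_multiple)
    next
      case 4
      then show ?thesis using out[of l] ab by (simp add: lookup_root_multiple)
    qed
  qed
  have "lookup m a \<noteq> 0" using m_eq m(2) by (metis root_multiple_0)
  then obtain k where k: "lookup m a = k + 1" by (metis Suc_eq_plus1 not0_implies_Suc)
  have "a \<in> {1..n}" "wt m a \<noteq> 0" using la k ab by auto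
  then have "c = q powi (- wt m b)" using key[of a] ab by auto
  also have "\<dots> = q ^ (k + 1)"
  proof -
    have "- wt m b = int (k + 1)" using ln la k by linarith
    then show ?thesis by (simp only: power_int_of_nat)
  qed
  finally show False using not_root[of k] m_eq k by auto
qed

text \<open>The poles allowed at m: all positive multiples of positive roots that lie below m. The
  witness \<open>d\<close> expresses this order, since exponents are natural numbers.\<close>

definition Pset :: "(nat \<Rightarrow>\<^sub>0 nat) \<Rightarrow> (nat \<times> nat \<times> nat) set"
  where "Pset m = {(i, j, k). 1 \<le> i \<and> i < j \<and> j \<le> n \<and> (\<exists>d. m = root_multiple i j (k + 1) + d)}"

lemma Pset_pole_index: "Pset m \<subseteq> pole_index n"
  by (auto simp: Pset_def pole_index_def)

lemma finite_Pset: "finite (Pset m)"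
proof (rule finite_subset)
  show "Pset m \<subseteq> {1..n} \<times> {1..n} \<times> {..(\<Sum>i\<in>{1..n}. lookup m i)}"
  proof
    fix e assume "e \<in> Pset m"
    then obtain i j k d where d: "e = (i, j, k)" "1 \<le> i" "i < j" "j \<le> n" "m = root_multiple i j (k + 1) + d"
      by (auto simp: Pset_def)
    then have "k \<le> lookup m i" by (simp add: lookup_add lookup_root_multiple)
    also have "\<dots> \<le> (\<Sum>i\<in>{1..n}. lookup m i)" using d by (intro member_le_sum) auto
    finally show "e \<in> {1..n} \<times> {1..n} \<times> {..(\<Sum>i\<in>{1..n}. lookup m i)}" using d by simp
  qed
qed auto

definition root_index :: "(nat \<Rightarrow>\<^sub>0 nat) \<Rightarrow> (nat \<times> nat \<times> nat) set"
  where "root_index m = {(i, j, k). 1 \<le> i \<and> i < j \<and> j \<le> n \<and> m = root_multiple i j (k + 1)}"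

lemma root_index_Pset: "root_index m \<subseteq> Pset m"
  unfolding root_index_def Pset_def using add_0_right by fastforce

lemma root_index_unique:
  assumes "e \<in> root_index m" "e' \<in> root_index m"
  shows "e = e'"
proof -
  obtain i j k i' j' k' where e: "e = (i, j, k)" "e' = (i', j', k')" by (cases e, cases e')
  then have ij: "i < j" "i' < j'" and eq: "root_multiple i j (k + 1) = root_multiple i' j' (k' + 1)"
    using assms by (auto simp: root_index_def)
  have "{i..<j} = {i'..<j'}" using arg_cong[OF eq, of keys] by (simp add: keys_root_multiple)
  then have "i = i'" "j = j'" using atLeastLessThan_eq_iff[OF ij] by simp_all
  moreover have "k = k'"
    using arg_cong[OF eq, of "\<lambda>m. lookup m i"] ij calculation by (simp add: lookup_root_multiple)
  ultimately show ?thesis using e by simp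
qed

text \<open>A root multiple equal to m cannot lie below the proper part \<open>snd p\<close>. So the
  pole that enters at m is absent from all lower coefficients.\<close>

lemma Pset_split:
  assumes p: "p \<in> splits m - {(0, m)}"
  shows "Pset (snd p) \<subseteq> Pset m - root_index m"
proof
  fix e assume "e \<in> Pset (snd p)"
  then obtain i j k d where e: "e = (i, j, k)" "1 \<le> i" "i < j" "j \<le> n" "snd p = root_multiple i j (k + 1) + d"
    by (auto simp: Pset_def)
  obtain a b where ab: "p = (a, b)" by fastforce
  with p have ab: "p = (a, b)" "a + b = m" "a \<noteq> 0" by (auto simp: splits_def)
  then have m: "m = root_multiple i j (k + 1) + (a + d)" using e by (simp add: add_ac)
  then have "e \<in> Pset m" using e by (auto simp: Pset_def)
  moreover have "m \<noteq> root_multiple i j (k + 1)"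
  proof
    assume "m = root_multiple i j (k + 1)"
    then have "a + d = 0" using m by (metis add_cancel_right_right)
    then have "tdeg a = 0" using tdeg_add[of a d] by (simp add: tdeg_def)
    then show False using ab(3) tdeg_eq_0_iff by blast
  qed
  ultimately show "e \<in> Pset m - root_index m" using e by (auto simp: root_index_def)
qed

lemma Den_subset:
  assumes "S \<subseteq> T" "T \<subseteq> Pset m"
  shows "Den q T = Den q S * Den q (T - S)"
  unfolding Den_def using assms finite_subset[OF assms(2) finite_Pset]
  by (subst prod.subset_diff[of S T]) (auto simp: mult_ac)

text \<open>Induction on the degree. The set \<open>S\<close> omits the pole entering at m, and
  \<open>Den q S\<close> suffices for all lower coefficients. Then every \<open>Epoly m r\<close>,
  and with them every \<open>Mpoly m j\<close>, clears what is left of the coefficient at m. From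
  one well-chosen \<open>Mpoly m j\<close> all factors but at most one are cancelled.\<close>

lemma Den_phi: "at_ratios (Den q (Pset m)) * phi m \<in> wimage n"
proof (induction m rule: measure_induct_rule[where f = tdeg])
  case (less m)
  consider "m \<notin> Qplus n" | "m = 0" | "m \<in> Qplus n" "m \<noteq> 0" by blast
  then show ?case
  proof cases
    case 1
    then show ?thesis by (simp add: phi_notin wimage_0)
  next
    case 2
    then show ?thesis using wimage_at_ratios[OF wpolys_Den[OF Pset_pole_index]] by simp
  next
    case m: 3
    define S where "S = Pset m - root_index m"
    have S: "S \<subseteq> pole_index n" using Pset_pole_index by (auto simp: S_def)
    define F where "F = at_ratios (Den q S) * phi m"
    \<comment> \<open>The ideal of denominators of \<open>F\<close>. The aim is to find in it 1, or
      the single pole equation that enters at m.\<close>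
    define J where "J = {x \<in> wpolys n. at_ratios x * F \<in> wimage n}"
    \<comment> \<open>The elements that may be cancelled inside \<open>J\<close>.\<close>
    define G where "G = {x. \<forall>z\<in>wpolys n. x * z \<in> J \<longrightarrow> z \<in> J}"
    have J_w: "x \<in> wpolys n" if "x \<in> J" for x using that by (simp add: J_def)
    have J_mult: "x * y \<in> J" if "x \<in> wpolys n" "y \<in> J" for x y
      using that wimage_mult[OF wimage_at_ratios[OF that(1)], of "at_ratios y * F"]
      by (simp add: J_def wpolys_mult at_ratios_simps mult_ac)
    have J_sum: "(\<Sum>i\<in>A. f i) \<in> J" if "\<And>i. i \<in> A \<Longrightarrow> f i \<in> J" for A :: "nat set" and f
      using that by (auto simp: J_def at_ratios_simps sum_distrib_right intro!: wpolys_sum wimage_sum)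
    have lower: "at_ratios (Den q S) * phi (snd p) \<in> wimage n" if p: "p \<in> splits m - {(0, m)}" for p
    proof -
      have "Den q S = Den q (S - Pset (snd p)) * Den q (Pset (snd p))"
        using Den_subset[of "Pset (snd p)" S m] Pset_split[OF p] by (simp add: S_def mult_ac)
      then show ?thesis
        using wimage_mult[OF wimage_at_ratios[OF wpolys_Den[of "S - Pset (snd p)"]] less.IH[OF tdeg_splits[OF p]]] S
        by (simp add: at_ratios_simps mult_ac Diff_subset[THEN order_trans])
    qed
    have E_J: "Epoly m r \<in> J" for r
    proof -
      have "at_ratios (Epoly m r) * F = at_ratios (Den q S) * (at_ratios (Epoly m r) * phi m)"
        by (simp add: F_def mult_ac)
      also have "\<dots> = - (\<Sum>p\<in>splits m - {(0, m)}. \<Sum>I | I \<subseteq> {1..n} \<and> card I = r.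
          ratconst (Kcoeff n t I (fst p) * qweight q I (snd p)) * at_ratios (single (rexp I) 1) * (at_ratios (Den q S) * phi (snd p)))"
        unfolding Epoly_phi by (simp add: sum_distrib_left mult_ac)
      also have "\<dots> \<in> wimage n"
        by (intro wimage_uminus wimage_sum wimage_mult wimage_ratconst lower wimage_at_ratios wpolys_single rexp_Qplus) auto
      finally show ?thesis by (simp add: J_def Epoly_wpolys)
    qed
    have M_J: "Mpoly m j \<in> J" if j: "j \<in> {1..n}" for j
      unfolding Mpoly_eq[OF j]
    proof (intro J_sum J_mult wpolys_mult wpolys_power E_J sigma_wpolys wpolys_single sexp_Qplus)
      show "- 1 \<in> wpolys n" by (intro wpolys_uminus wpolys_const)
    qed (use j in auto)
    \<comment> \<open>From e z F = A and X F = Y follows X A = e z Y. So e divides X A but not X,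
      hence it divides A, and z F = A / e is a polynomial in the ratios.\<close>
    have G_prime: "e \<in> G" if e: "prime_elem e" "e \<in> wpolys n" and X: "X \<in> J" "\<not> e dvd X" for e X
      unfolding G_def mem_Collect_eq
    proof (intro ballI impI)
      fix z assume z: "z \<in> wpolys n" "e * z \<in> J"
      have e0: "e \<noteq> 0" using e by (auto simp: prime_elem_def)
      obtain A where A: "A \<in> wpolys n" "at_ratios (e * z) * F = at_ratios A" using z by (auto simp: J_def wimage_def)
      obtain Y where Y: "at_ratios X * F = at_ratios Y" using X by (auto simp: J_def wimage_def)
      have "at_ratios (X * A) = at_ratios (e * (z * Y))"
        unfolding at_ratios_simps(4) A(2)[symmetric] Y[symmetric] by (simp add: mult_ac)
      then have "X * A = e * (z * Y)" by simp
      then have "e dvd X * A" by simp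
      then have "e dvd A" using e X by (auto simp: prime_elem_def)
      then obtain B where B: "A = e * B" by blast
      have "B \<in> wpolys n" by (rule wpolys_cofactor[of e]) (use A B e e0 in auto)
      moreover have "at_ratios z * F = at_ratios B"
        using A(2) e0 by (simp add: B at_ratios_simps mult.assoc)
      ultimately show "z \<in> J" using z by (simp add: J_def wimage_at_ratios)
    qed
    have G_mult: "x * y \<in> G" if "x \<in> G" "y \<in> G" "y \<in> wpolys n" for x y
      unfolding G_def mem_Collect_eq
    proof (intro ballI impI)
      fix z assume z: "z \<in> wpolys n" "x * y * z \<in> J"
      then have "x * (y * z) \<in> J" by (simp add: mult.assoc)
      then have "y * z \<in> J" using that z wpolys_mult[of y n z] by (auto simp: G_def)
      then show "z \<in> J" using that z by (auto simp: G_def)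
    qed
    have G_const: "single 0 c \<in> G" if "c \<noteq> 0" for c
      unfolding G_def mem_Collect_eq
    proof (intro ballI impI)
      fix z assume z: "z \<in> wpolys n" "single 0 c * z \<in> J"
      have "single 0 (inverse c) * (single 0 c * z) \<in> J" by (rule J_mult) (use z in auto)
      then show "z \<in> J" using that by (simp add: mult.assoc[symmetric] mult_single)
    qed
    have G_prod: "(\<Prod>i\<in>A. f i) \<in> G" if "\<And>i. i \<in> A \<Longrightarrow> f i \<in> G" "\<And>i. i \<in> A \<Longrightarrow> f i \<in> wpolys n" for A :: "nat set" and f
      using that G_const[of 1]
      by (induction A rule: infinite_finite_induct) (auto intro!: G_mult wpolys_prod)
    have wvar_G: "wvar a \<in> G" if a: "1 \<le> a" "a < n" for a
    proof -
      have "keys m \<noteq> {}" using m(2) by (metis ex_in_conv in_keys_iff lookup_zero poly_mapping_eqI)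
      then obtain r where r: "r \<in> keys m" by blast
      then have "r < n" using m(1) by (auto simp: Qplus_def)
      \<comment> \<open>The constant term q^(-m_r) - 1 is nonzero for r in the support of m, whereas
        multiples of w_a vanish at the origin.\<close>
      then have "lookup (Epoly m r) 0 \<noteq> 0"
        using r lookup_Epoly_0[OF m(1), of r] by (simp add: in_keys_iff)
      moreover have "lookup (wvar a * g) 0 = 0" for g
        unfolding comm_ring_hom.hom_mult[OF lookup_0_hom]
        by (simp add: wvar_def lookup_single when_def single_eq_iff[of _ _ 0 0, simplified])
      ultimately have "\<not> wvar a dvd Epoly m r" by auto
      then show ?thesis by (intro G_prime[OF prime_wvar wpolys_wvar[OF a] E_J])
    qed
    have sigma_G: "sigma i \<in> G" if i: "i \<le> n" for i
    proof -
      have "sigma i = (\<Prod>l\<in>{1..<i}. wvar l)"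
        unfolding sigma_def monom_eval_wvar[symmetric] root_multiple_def monom_eval_sum by simp
      moreover have "(\<Prod>l\<in>{1..<i}. wvar l) \<in> G"
        by (rule G_prod) (use i in \<open>auto intro: wvar_G wpolys_wvar\<close>)
      ultimately show ?thesis by simp
    qed
    have binom_G: "binom_poly a b c \<in> G"
      if ab: "1 \<le> a" "a < b" "b \<le> n" and c: "c \<noteq> 0" and nr: "\<And>k. m \<noteq> root_multiple a b (k + 1)" for a b c
    proof -
      obtain j where "j \<in> {1..n}" "\<not> binom_poly a b c dvd Mpoly m j"
        using exists_Mpoly_not_dvd[OF m ab c] nr by blast
      then show ?thesis
        by (intro G_prime[OF prime_binom_poly[OF ab(2) c] wpolys_binom_poly[OF ab(1,3)] M_J])
    qed
    have qp: "q powi k \<noteq> 0" for k using q0 by simp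
    have factor_G: "factor m j i \<in> G"
      if ij: "i \<in> {1..n}" "j \<in> {1..n}" "wt m j \<noteq> 0"
        and nr: "\<And>a b k. m = root_multiple a b (k + 1) \<Longrightarrow> {a, b} = {i, j} \<Longrightarrow> a < b \<Longrightarrow> False" for i j
    proof -
      consider "i = j" | "j < i" | "i < j" by linarith
      then show ?thesis
      proof cases
        case 1
        then have "1 - q powi (- wt m j) \<noteq> 0" using ij by simp
        then show ?thesis unfolding 1 factor_diag using ij
          by (intro G_mult G_const sigma_G sigma_wpolys) auto
      next
        case 2
        have "m \<noteq> root_multiple j i (k + 1)" for k using nr[of j i k] 2 by blast
        then have "binom_poly j i (q powi (- wt m i)) \<in> G"
          using ij 2 by (intro binom_G qp) auto
        then show ?thesis using ij 2
          by (subst factor_gt) (auto intro!: G_mult sigma_G wpolys_binom_poly)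
      next
        case 3
        have "m \<noteq> root_multiple i j (k + 1)" for k using nr[of i j k] 3 by blast
        then have "binom_poly i j (q powi wt m i) \<in> G"
          using ij 3 by (intro binom_G qp) auto
        moreover have "- (q powi (- wt m i)) \<noteq> 0" using qp by simp
        ultimately show ?thesis using ij 3
          by (subst factor_lt) (auto intro!: G_mult G_const sigma_G sigma_wpolys wpolys_binom_poly)
      qed
    qed
    show ?thesis
    proof (cases "root_index m = {}")
      case True
      \<comment> \<open>When m is not a multiple of a root, any j with \<mu>_j \<noteq> 0 works:
        every factor of \<open>Mpoly m j\<close> can be cancelled, including the diagonal one with
        its constant 1 - q^(-\<mu>_j), and 1 is left.\<close>
      obtain j where j: "j \<in> {1..n}" "wt m j \<noteq> 0" using root_weight_nonzero[OF m] by (metis wt_def)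
      have "Mpoly m j \<in> G" unfolding Mpoly_def
      proof (rule G_prod)
        fix i assume i: "i \<in> {1..n}"
        show "factor m j i \<in> G"
        proof (rule factor_G[OF i j])
          fix a b k assume "m = root_multiple a b (k + 1)" "{a, b} = {i, j}" "a < b"
          then have "(a, b, k) \<in> root_index m" using i j(1) by (auto simp: root_index_def doubleton_eq_iff)
          with True show False by simp
        qed
      qed (use j in \<open>auto intro: factor_wpolys\<close>)
      then have "1 \<in> J" using M_J[OF j(1)] by (auto simp: G_def)
      then show ?thesis using True by (simp add: J_def F_def S_def at_ratios_simps)
    next
      case False
      then obtain a b k where abk: "(a, b, k) \<in> root_index m" by auto
      then have ab: "1 \<le> a" "a < b" "b \<le> n" and m_eq: "m = root_multiple a b (k + 1)" by (auto simp: root_index_def)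
      have ri: "root_index m = {(a, b, k)}" using abk root_index_unique by blast
      have wta: "wt m a = int (k + 1)" and wtb: "wt m b = - int (k + 1)"
        unfolding wt_def m_eq lookup_root_weight_root_multiple[OF ab(2)] using ab by auto
      have aN: "a \<in> {1..n}" "wt m a \<noteq> 0" using ab wta by auto
      \<comment> \<open>For j = a the factor at i = b is sigma a times the pole equation itself,
        because -\<mu>_b = k + 1. All other factors, and sigma a, are cancelled.\<close>
      have "q powi (- wt m b) = q ^ (k + 1)" unfolding wtb by (simp only: minus_minus power_int_of_nat)
      then have fb: "factor m a b = sigma a * pole_equation q a b k"
        using factor_gt[OF ab(1,2), of m] by (simp add: pole_equation_eq)
      have "Mpoly m a = factor m a b * (\<Prod>i\<in>{1..n} - {b}. factor m a i)"
        unfolding Mpoly_def by (rule prod.remove) (use ab in auto)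
      then have M: "Mpoly m a = ((\<Prod>i\<in>{1..n} - {b}. factor m a i) * sigma a) * pole_equation q a b k"
        by (simp add: fb mult_ac)
      have "(\<Prod>i\<in>{1..n} - {b}. factor m a i) \<in> G"
      proof (rule G_prod)
        fix i assume i: "i \<in> {1..n} - {b}"
        show "factor m a i \<in> G"
        proof (rule factor_G)
          fix a' b' k' assume "m = root_multiple a' b' (k' + 1)" "{a', b'} = {i, a}" "a' < b'"
          then have "(a', b', k') \<in> root_index m" using i aN by (auto simp: root_index_def doubleton_eq_iff)
          with ri \<open>{a', b'} = {i, a}\<close> i show False by (auto simp: doubleton_eq_iff)
        qed (use i aN in auto)
      qed (use aN in \<open>auto intro: factor_wpolys\<close>)
      then have "(\<Prod>i\<in>{1..n} - {b}. factor m a i) * sigma a \<in> G"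
        using ab by (intro G_mult sigma_G sigma_wpolys) auto
      moreover have pw: "pole_equation q a b k \<in> wpolys n"
        unfolding pole_equation_eq by (rule wpolys_binom_poly[OF ab(1,3)])
      ultimately have "pole_equation q a b k \<in> J" using M_J[OF aN(1)] unfolding M by (auto simp: G_def)
      moreover have "Den q (Pset m) = pole_equation q a b k * Den q S"
        using Den_subset[OF root_index_Pset order_refl] by (simp add: S_def ri Den_def pole_eq_def)
      ultimately show ?thesis by (simp add: J_def F_def at_ratios_simps mult_ac)
    qed
  qed
qed

lemma regular_phi: "regular_at_origin n (phi m)"
  by (rule regular_at_origin_Den[OF Pset_pole_index Den_phi])

lemma simple_poles_phi: "simple_poles n q (phi m)"
proof (rule simple_poles_Den[OF q0 _ finite_Pset Pset_pole_index Den_phi])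
  show "k = l" if "q ^ k = q ^ l" for k l
    using that q_powi_eq_iff[of "int k" "int l"] by simp
qed

lemma phi_sratio_field: "phi m \<in> sratio_field n"
proof -
  obtain P where P: "P \<in> wpolys n" "at_ratios (Den q (Pset m)) * phi m = at_ratios P"
    using Den_phi[of m] by (auto simp: wimage_def)
  have D: "Den q (Pset m) \<in> wpolys n" "Den q (Pset m) \<noteq> 0"
    by (rule wpolys_Den[OF Pset_pole_index], rule Den_neq_0[OF Pset_pole_index])
  then have "phi m = at_ratios P / at_ratios (Den q (Pset m))"
    using P(2) by (simp add: field_simps)
  then show ?thesis unfolding sratio_field_def using P(1) D by blast
qed

lemma is_solution_iff: "1 \<le> n \<Longrightarrow> is_solution n q t f \<longleftrightarrow> f = Phi"
  using joint_eigenfunction_unique[of f] joint_eigenfunction_Phi phi_sratio_field phi_notin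
  by (auto simp: is_solution_def sratio_series_def)

end

theorem theorem1p1:
  fixes n :: nat and q t :: complex
  assumes "1 \<le> n" and "q \<noteq> 0" and "t \<noteq> 0" and "norm q < 1"
  shows "(\<exists>!\<phi>. is_solution n q t \<phi>) \<and>
    (\<forall>\<phi>. is_solution n q t \<phi> \<longrightarrow>
      (\<forall>\<mu>\<in>Qplus n. regular_at_origin n (mfps_nth \<phi> \<mu>)) \<and>
      (\<forall>\<mu>\<in>Qplus n. simple_poles n q (mfps_nth \<phi> \<mu>)))"
proof -
  interpret macdonald n q t by unfold_locales (fact assms)+
  show ?thesis
    by (simp add: is_solution_iff[OF assms(1)] regular_phi simple_poles_phi)
qed

end
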